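(* Let $X$ be a locally compact (Hausdorff), path connected, locally path connected and semilocally simply connected topological space. Consider the following statements: (1) the (topological) fundamental groupoid $\Pi_1(X)$ has a Haar system; (2) the universal covering space $\tilde X$ of $X$ has a $\pi_1(X)$-invariant fully supported Radon measure; (3) $X$ has a fully supported Radon measure. Then (1)$\iff$(2) and (3)$\implies$(2). If $X$ is paracompact, then (2)$\implies$(3).
   Context: **Fundamental groupoid.** $\Pi_1(X)$ is the groupoid of endpoint-fixing homotopy classes $[\gamma]$ of paths $\gamma\colon[0,1]\to X$, with range $r([\gamma])=\gamma(1)$, source $s([\gamma])=\gamma(0)$, and unit space $X$ (constant paths). The product $[\gamma][\delta]$ is defined when $\gamma(0)=\delta(1)$ and is the class of the concatenation "first $\delta$, then $\gamma$", written $[\gamma * \delta]$. For $X$ locally path connected and semilocally simply connected, $\Pi_1(X)$ is topologised as the quotient of the path space with the compact-open topology. Equivalently, a basis is given by the sets $N([\gamma],U,V)=\{[\delta * \gamma * \omega] : \delta \text{ a path in } U,\ \delta(0)=\gamma(1),\ \omega \text{ a path in } V,\ \omega(1)=\gamma(0)\}$, where $U,V\subseteq X$ are path connected open sets whose inclusions into $X$ induce trivial maps on fundamental groups, and $\gamma$ is a path with $\gamma(0)\in V$, $\gamma(1)\in U$. This makes $\Pi_1(X)$ a topological groupoid. **Universal cover.** $\pi_1(X)$ acts on $\tilde X$ by deck transformations. For $x\in X$ one may take $\tilde X=\Pi_1(X)^x=r^{-1}(x)$ with covering map $s|_{\Pi_1(X)^x}$ and $\pi_1(X,x)=\Pi_1(X)^x_x$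 acting by left multiplication. **Measures.** Measures are positive Radon measures; "fully supported" means the support is the whole space. For a locally compact groupoid $G$ with unit space $G^{(0)}$, put $G^u=r^{-1}(u)$. A Haar system on $G$ is a family $\{\alpha^u\}_{u\in G^{(0)}}$ of positive Radon measures on $G$ such that: $\alpha^u$ has support $G^u$; for every $f\in C_c(G)$ the function $u\mapsto\int f\,d\alpha^u$ is in $C_c(G^{(0)})$; and for all $\gamma\in G$, $f\in C_c(G)$, $\int_{G^{s(\gamma)}} f(\gamma\eta)\,d\alpha^{s(\gamma)}(\eta)=\int_{G^{r(\gamma)}} f(\eta)\,d\alpha^{r(\gamma)}(\eta)$. *)

theory Defs
  imports "HOL-Analysis.Analysis"
begin

section \<open>Topological preliminaries\<close>

definition semilocally_simply_connected :: "'a::topological_space set \<Rightarrow> bool" where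
  "semilocally_simply_connected S \<longleftrightarrow>
     (\<forall>x\<in>S. \<exists>U. openin (top_of_set S) U \<and> x \<in> U \<and>
        (\<forall>g. path g \<and> path_image g \<subseteq> U \<and> pathstart g = x \<and> pathfinish g = x
              \<longrightarrow> homotopic_paths S g (\<lambda>_. x)))"

definition paracompact_space :: "'a topology \<Rightarrow> bool" where
  "paracompact_space T \<longleftrightarrow>
     (\<forall>\<U>. (\<forall>U\<in>\<U>. openin T U) \<and> \<Union>\<U> = topspace T \<longrightarrow>
        (\<exists>\<V>. (\<forall>V\<in>\<V>. openin T V) \<and> \<Union>\<V> = topspace T \<and>
              (\<forall>V\<in>\<V>. \<exists>U\<in>\<U>. V \<subseteq> U) \<and>
              (\<forall>x\<in>topspace T. \<exists>W. openin T W \<and> x \<in> W \<and> finite {V\<in>\<V>. V \<inter> W \<noteq> {}})))"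

definition quotient_topology :: "'a topology \<Rightarrow> ('a \<Rightarrow> 'b) \<Rightarrow> 'b topology" where
  "quotient_topology T q =
     topology (\<lambda>W. W \<subseteq> q ` topspace T \<and> openin T {x \<in> topspace T. q x \<in> W})"

lemma openin_quotient_topology:
  "openin (quotient_topology T q) W \<longleftrightarrow>
     W \<subseteq> q ` topspace T \<and> openin T {x \<in> topspace T. q x \<in> W}"
proof -
  let ?L = "\<lambda>W. W \<subseteq> q ` topspace T \<and> openin T {x \<in> topspace T. q x \<in> W}"
  have "istopology ?L"
    unfolding istopology_def
  proof (intro conjI allI impI)
    fix A B
    assume A: "?L A" and B: "?L B"
    have "{x \<in> topspace T. q x \<in> A \<inter> B} =
            {x \<in> topspace T. q x \<in> A} \<inter> {x \<in> topspace T. q x \<in> B}"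
      by blast
    then show "openin T {x \<in> topspace T. q x \<in> A \<inter> B}"
      using A B by auto
    show "A \<inter> B \<subseteq> q ` topspace T"
      using A by blast
  next
    fix \<K>
    assume \<K>: "\<forall>K\<in>\<K>. ?L K"
    have "{x \<in> topspace T. q x \<in> \<Union>\<K>} = (\<Union>K\<in>\<K>. {x \<in> topspace T. q x \<in> K})"
      by blast
    then show "openin T {x \<in> topspace T. q x \<in> \<Union>\<K>}"
      using \<K> by auto
    show "\<Union>\<K> \<subseteq> q ` topspace T"
      using \<K> by blast
  qed
  then show ?thesis
    by (simp add: quotient_topology_def)
qed

lemma topspace_quotient_topology [simp]: "topspace (quotient_topology T q) = q ` topspace T"
proof
  show "topspace (quotient_topology T q) \<subseteq> q ` topspace T"
    using openin_topspace[of "quotient_topology T q"]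
    unfolding openin_quotient_topology by (rule conjunct1)
  have "{x \<in> topspace T. q x \<in> q ` topspace T} = topspace T"
    by blast
  then have "openin (quotient_topology T q) (q ` topspace T)"
    unfolding openin_quotient_topology by simp
  then show "q ` topspace T \<subseteq> topspace (quotient_topology T q)"
    by (rule openin_subset)
qed

lemma quotient_map_quotient_topology: "quotient_map T (quotient_topology T q) q"
  by (auto simp: quotient_map_def openin_quotient_topology)

section \<open>Radon measures\<close>

definition borel_of :: "'a topology \<Rightarrow> 'a measure" where
  "borel_of T = sigma (topspace T) {U. openin T U}"

text \<open>Finite on compact sets, outer regular on Borel sets, inner regular on open sets.\<close>
definition radon_measure :: "'a topology \<Rightarrow> 'a measure \<Rightarrow> bool" where
  "radon_measure T M \<longleftrightarrow>
     sets M = sets (borel_of T) \<and>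
     (\<forall>K. compactin T K \<longrightarrow> emeasure M K < \<infinity>) \<and>
     (\<forall>A\<in>sets M. emeasure M A = (INF U\<in>{U. openin T U \<and> A \<subseteq> U}. emeasure M U)) \<and>
     (\<forall>U. openin T U \<longrightarrow>
        emeasure M U = (SUP K\<in>{K. compactin T K \<and> K \<subseteq> U}. emeasure M K))"

definition measure_support :: "'a topology \<Rightarrow> 'a measure \<Rightarrow> 'a set" where
  "measure_support T M = {x \<in> topspace T. \<forall>U. openin T U \<and> x \<in> U \<longrightarrow> emeasure M U > 0}"

definition fully_supported :: "'a topology \<Rightarrow> 'a measure \<Rightarrow> bool" where
  "fully_supported T M \<longleftrightarrow> measure_support T M = topspace T"

definition Cc :: "'a topology \<Rightarrow> ('a \<Rightarrow> complex) set" where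
  "Cc T = {f. continuous_map T euclidean f \<and>
              compactin T (T closure_of {x \<in> topspace T. f x \<noteq> 0})}"

section \<open>Groupoids and Haar systems\<close>

text \<open>
  Only the data used in the definition of a Haar system are recorded. The unit space is kept as a
  separate space \<open>units\<close> rather than as a set of arrows. The product \<open>gmult \<gamma> \<eta>\<close> is meaningful
  only if \<open>src \<gamma> = rng \<eta>\<close>.
\<close>
record ('g, 'u) tgroupoid =
  arrows :: "'g topology"
  units :: "'u topology"
  rng :: "'g \<Rightarrow> 'u"
  src :: "'g \<Rightarrow> 'u"
  gmult :: "'g \<Rightarrow> 'g \<Rightarrow> 'g"

definition rfibre :: "('g, 'u) tgroupoid \<Rightarrow> 'u \<Rightarrow> 'g set" where
  "rfibre G u = {\<eta> \<in> topspace (arrows G). rng G \<eta> = u}"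

definition isotropy :: "('g, 'u) tgroupoid \<Rightarrow> 'u \<Rightarrow> 'g set" where
  "isotropy G u = {\<eta> \<in> topspace (arrows G). rng G \<eta> = u \<and> src G \<eta> = u}"

definition haar_system :: "('g, 'u) tgroupoid \<Rightarrow> ('u \<Rightarrow> 'g measure) \<Rightarrow> bool" where
  "haar_system G \<alpha> \<longleftrightarrow>
     (\<forall>u\<in>topspace (units G).
        radon_measure (arrows G) (\<alpha> u) \<and> measure_support (arrows G) (\<alpha> u) = rfibre G u) \<and>
     (\<forall>f\<in>Cc (arrows G). (\<lambda>u. \<integral>\<eta>. f \<eta> \<partial>\<alpha> u) \<in> Cc (units G)) \<and>
     (\<forall>\<gamma>\<in>topspace (arrows G). \<forall>f\<in>Cc (arrows G).
        (LINT \<eta>:rfibre G (src G \<gamma>)|\<alpha> (src G \<gamma>). f (gmult G \<gamma> \<eta>)) =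
        (LINT \<eta>:rfibre G (rng G \<gamma>)|\<alpha> (rng G \<gamma>). f \<eta>))"

section \<open>The fundamental groupoid\<close>

text \<open>
  A path is a function on all of \<open>real\<close> of which only the values on \<open>{0..1}\<close> matter. The
  topology below does not separate paths agreeing on \<open>{0..1}\<close>, and such paths are homotopic, so
  passing to homotopy classes yields the quotient of \<open>C([0,1], X)\<close>.
\<close>
definition compact_open_paths :: "(real \<Rightarrow> 'a::topological_space) topology" where
  "compact_open_paths =
     topology_generated_by
       {{g. path g \<and> g ` K \<subseteq> U} |K U. compact K \<and> K \<subseteq> {0..1} \<and> open U}"

lemma topspace_compact_open_paths [simp]:
  "topspace (compact_open_paths :: (real \<Rightarrow> 'a::topological_space) topology) = Collect path"
  (is "topspace ?T = _")
proof
  show "topspace ?T \<subseteq> Collect path"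
    unfolding compact_open_paths_def topology_generated_by_topspace by (rule Union_least) auto
  have "Collect path \<in> {{g :: real \<Rightarrow> 'a. path g \<and> g ` K \<subseteq> U} |K U. compact K \<and> K \<subseteq> {0..1} \<and> open U}"
    by (rule CollectI, rule exI[of _ "{}"], rule exI[of _ UNIV]) simp
  then show "Collect path \<subseteq> topspace ?T"
    unfolding compact_open_paths_def topology_generated_by_topspace by (rule Union_upper)
qed

definition path_class :: "(real \<Rightarrow> 'a::topological_space) \<Rightarrow> (real \<Rightarrow> 'a) set" where
  "path_class g = {h. homotopic_paths UNIV g h}"

definition path_rep :: "(real \<Rightarrow> 'a::topological_space) set \<Rightarrow> real \<Rightarrow> 'a" where
  "path_rep c = (SOME g. g \<in> c)"

text \<open>The library's \<open>d +++ g\<close> runs through \<open>d\<close> first, hence the order in the product.\<close>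
definition fundamental_groupoid :: "((real \<Rightarrow> 'a::topological_space) set, 'a) tgroupoid" where
  "fundamental_groupoid =
     \<lparr> arrows = quotient_topology compact_open_paths path_class,
       units = euclidean,
       rng = (\<lambda>c. pathfinish (path_rep c)),
       src = (\<lambda>c. pathstart (path_rep c)),
       gmult = (\<lambda>c d. path_class (path_rep d +++ path_rep c)) \<rparr>"

lemma homotopic_path_rep: "path g \<Longrightarrow> homotopic_paths UNIV g (path_rep (path_class g))"
  unfolding path_rep_def path_class_def mem_Collect_eq
  by (rule someI[of _ g]) simp

lemma topspace_fundamental_groupoid:
  "topspace (arrows fundamental_groupoid) = path_class ` Collect path"
  by (simp add: fundamental_groupoid_def)

lemma rng_path_class: "path g \<Longrightarrow> rng fundamental_groupoid (path_class g) = pathfinish g"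
  by (simp add: fundamental_groupoid_def homotopic_paths_imp_pathfinish[OF homotopic_path_rep, symmetric])

lemma src_path_class: "path g \<Longrightarrow> src fundamental_groupoid (path_class g) = pathstart g"
  by (simp add: fundamental_groupoid_def homotopic_paths_imp_pathstart[OF homotopic_path_rep, symmetric])

lemma path_class_eq: "homotopic_paths UNIV g h \<Longrightarrow> path_class g = path_class h"
  unfolding path_class_def by (auto intro: homotopic_paths_trans dest: homotopic_paths_sym)

lemma mult_path_class:
  assumes "path g" "path d" "pathstart g = pathfinish d"
  shows "gmult fundamental_groupoid (path_class g) (path_class d) = path_class (d +++ g)"
proof -
  have "homotopic_paths UNIV (d +++ g) (path_rep (path_class d) +++ path_rep (path_class g))"
    by (rule homotopic_paths_join) (use assms homotopic_path_rep in auto)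
  from path_class_eq[OF this] show ?thesis
    by (simp add: fundamental_groupoid_def)
qed

section \<open>The universal cover\<close>

text \<open>
  The universal cover, based at \<open>x\<close>, is the range fibre of the fundamental groupoid over \<open>x\<close>, with
  covering map the source map; the fundamental group at \<open>x\<close> is the isotropy group, acting as the
  group of deck transformations by left multiplication.
\<close>
definition universal_cover :: "'a::topological_space \<Rightarrow> (real \<Rightarrow> 'a) set topology" where
  "universal_cover x = subtopology (arrows fundamental_groupoid) (rfibre fundamental_groupoid x)"

definition pi1_invariant ::
    "'a::topological_space \<Rightarrow> (real \<Rightarrow> 'a) set measure \<Rightarrow> bool" where
  "pi1_invariant x M \<longleftrightarrow>
     (\<forall>\<gamma>\<in>isotropy fundamental_groupoid x. \<forall>A\<in>sets M.
        emeasure M (gmult fundamental_groupoid \<gamma> ` A) = emeasure M A)"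

end

theory Submission
  imports Defs
begin

text \<open>
  The statements are equivalent along the cycle (3), (1), (2), (3). Radon measures are obtained
  throughout from contents on compact sets, so that local data need not be glued globally.

  From a measure \<open>\<nu>\<close> on \<open>X\<close>, the fibre over \<open>u\<close> receives the content
  \<open>K \<mapsto> \<integral> #{c \<in> K. r c = u, s c = y} d\<nu>(y)\<close>. It is visibly unchanged by left multiplication,
  which gives left invariance; continuity in \<open>u\<close> follows by transporting all nearby fibres to a
  fixed one along short paths. A Haar system restricts to an invariant measure on a single fibre,
  since a Radon measure is determined by its integrals of \<open>C\<^sub>c\<close> functions. Finally, an invariant measure
  \<open>\<mu>\<close> on the cover descends to the content \<open>K \<mapsto> sup \<mu>(B)\<close>, where \<open>B\<close> ranges over the relatively compact
  Borel sets over \<open>K\<close> on which the covering map is injective.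
\<close>

section \<open>The groupoid of path classes\<close>

text \<open>Every estimate is therefore made on compact sets, where finitely many charts suffice,
  and is carried to open sets by inner and to Borel sets by outer regularity. The charts rest on one
  observation. Inside a small path connected open set there is, up to homotopy in the whole space,
  exactly one path between two given points. Hence a class near \<open>c\<close> is determined by
  its two ends, the source map is injective near \<open>c\<close> on each range fibre, and
  multiplication by short classes identifies neighbouring fibres. For the descent no global Borel
  section of the covering is constructed; the supremum takes its place. It is finite because deck
  transformations move any competitor over a small base set into one compact sheet, whose mass is
  then a bound.\<close>

abbreviation rr :: "(real \<Rightarrow> 'a::topological_space) set \<Rightarrow> 'a" where
  "rr \<equiv> rng fundamental_groupoid"
abbreviation ss :: "(real \<Rightarrow> 'a::topological_space) set \<Rightarrow> 'a" where
  "ss \<equiv> src fundamental_groupoid"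
abbreviation mul :: "(real \<Rightarrow> 'a::topological_space) set \<Rightarrow> (real \<Rightarrow> 'a) set \<Rightarrow> (real \<Rightarrow> 'a) set"
    (infixl \<open>\<bullet>\<bullet>\<close> 70) where
  "c \<bullet>\<bullet> d \<equiv> gmult fundamental_groupoid c d"
abbreviation Gtop :: "(real \<Rightarrow> 'a::topological_space) set topology" where
  "Gtop \<equiv> arrows fundamental_groupoid"
abbreviation GG :: "(real \<Rightarrow> 'a::topological_space) set set" where
  "GG \<equiv> topspace Gtop"

definition unit_class :: "'a::topological_space \<Rightarrow> (real \<Rightarrow> 'a) set" where
  "unit_class u = path_class (\<lambda>_. u)"

definition inv_class :: "(real \<Rightarrow> 'a::topological_space) set \<Rightarrow> (real \<Rightarrow> 'a) set" where
  "inv_class c = path_class (reversepath (path_rep c))"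

lemma path_class_in [simp, intro]: "path g \<Longrightarrow> path_class g \<in> GG"
  by (simp add: topspace_fundamental_groupoid)

lemma GG_cases:
  assumes "c \<in> GG" obtains g where "path g" "c = path_class g"
  using assms by (auto simp: topspace_fundamental_groupoid)

lemma path_constant [simp]: "path (\<lambda>_. u)"
  by (simp add: path_def)

lemma mult_in [simp, intro]:
  assumes "c \<in> GG" "d \<in> GG" "ss c = rr d"
  shows "c \<bullet>\<bullet> d \<in> GG" "rr (c \<bullet>\<bullet> d) = rr c" "ss (c \<bullet>\<bullet> d) = ss d"
  using assms by (auto elim!: GG_cases simp: mult_path_class rng_path_class src_path_class)

lemma mult_assoc_class:
  assumes "c \<in> GG" "d \<in> GG" "e \<in> GG" "ss c = rr d" "ss d = rr e"
  shows "(c \<bullet>\<bullet> d) \<bullet>\<bullet> e = c \<bullet>\<bullet> (d \<bullet>\<bullet> e)"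
proof -
  obtain p q r where p: "path p" "c = path_class p" and q: "path q" "d = path_class q"
    and r: "path r" "e = path_class r"
    using assms by (meson GG_cases)
  have pq: "pathstart p = pathfinish q" "pathstart q = pathfinish r"
    using assms p q r by (simp_all add: rng_path_class src_path_class)
  have "homotopic_paths UNIV (r +++ (q +++ p)) ((r +++ q) +++ p)"
    by (rule homotopic_paths_assoc) (use p q r pq in auto)
  then show ?thesis
    using p q r pq by (simp add: mult_path_class path_class_eq)
qed

section \<open>Units, inverses and cancellation\<close>

lemma unit_class [simp]: "unit_class u \<in> GG" "rr (unit_class u) = u" "ss (unit_class u) = u"
  by (simp_all add: unit_class_def rng_path_class src_path_class pathstart_def pathfinish_def)

text \<open>Reparametrised copies of one path \<open>p\<close> are composites of \<open>p\<close>
  with paths in the unit interval. The unit and inverse laws in an arbitrary space thus reduce to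
  homotopies of real parameters.\<close>

lemma homotopic_paths_compose_path:
  fixes p :: "real \<Rightarrow> 'a::topological_space"
  assumes "path p" "homotopic_paths {0..1::real} f g"
  shows "homotopic_paths UNIV (p \<circ> f) (p \<circ> g)"
  using assms by (intro homotopic_paths_continuous_image[of "{0..1}"]) (auto simp: path_def)

lemma linepath_01: "linepath 0 1 = (\<lambda>t::real. t)"
  by (auto simp: linepath_def)

lemma path_image_linepath_01: "path_image (linepath 0 (1::real)) \<subseteq> {0..1}"
  by (auto simp: path_image_def linepath_def)

lemma join_const_class:
  assumes "path p"
  shows "path_class (p +++ (\<lambda>_. pathfinish p)) = path_class p"
proof -
  have "homotopic_paths {0..1::real} (linepath 0 1 +++ linepath 1 1) (linepath 0 1)"
    by (rule homotopic_paths_rid') (use path_image_linepath_01 in auto)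
  from homotopic_paths_compose_path[OF assms this]
  show ?thesis
    unfolding path_compose_join linepath_01
    by (intro path_class_eq) (simp add: o_def linepath_refl pathfinish_def)
qed

lemma const_join_class:
  assumes "path p"
  shows "path_class ((\<lambda>_. pathstart p) +++ p) = path_class p"
proof -
  have "homotopic_paths {0..1::real} (linepath 0 0 +++ linepath 0 1) (linepath 0 1)"
    by (rule homotopic_paths_lid') (use path_image_linepath_01 in auto)
  from homotopic_paths_compose_path[OF assms this]
  show ?thesis
    unfolding path_compose_join linepath_01
    by (intro path_class_eq) (simp add: o_def linepath_refl pathstart_def)
qed

lemma join_reverse_class:
  assumes "path p"
  shows "path_class (p +++ reversepath p) = unit_class (pathstart p)"
proof -
  have "homotopic_paths {0..1::real} (linepath 0 1 +++ reversepath (linepath 0 1)) (linepath 0 0)"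
    using homotopic_paths_rinv[OF _ path_image_linepath_01] by simp
  from homotopic_paths_compose_path[OF assms this]
  show ?thesis
    unfolding unit_class_def path_compose_join linepath_01
    by (intro path_class_eq) (simp add: o_def linepath_refl pathstart_def reversepath_def)
qed

lemma reverse_join_class:
  assumes "path p"
  shows "path_class (reversepath p +++ p) = unit_class (pathfinish p)"
  using join_reverse_class[of "reversepath p"] assms by simp

lemma pathstart_const [simp]: "pathstart (\<lambda>_. u) = u"
  and pathfinish_const [simp]: "pathfinish (\<lambda>_. u) = u"
  by (simp_all add: pathstart_def pathfinish_def)

lemma unit_mult:
  assumes "c \<in> GG"
  shows "unit_class (rr c) \<bullet>\<bullet> c = c" "c \<bullet>\<bullet> unit_class (ss c) = c"
proof -
  obtain p where p: "path p" "c = path_class p" using assms by (rule GG_cases)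
  show "unit_class (rr c) \<bullet>\<bullet> c = c" "c \<bullet>\<bullet> unit_class (ss c) = c"
    using p by (simp_all add: unit_class_def rng_path_class src_path_class mult_path_class
        join_const_class const_join_class)
qed

lemma unit_mult' [simp]:
  assumes "c \<in> GG"
  shows "rr c = u \<Longrightarrow> unit_class u \<bullet>\<bullet> c = c" "ss c = u \<Longrightarrow> c \<bullet>\<bullet> unit_class u = c"
  using unit_mult[OF assms] by auto

lemma inv_path_class:
  assumes "path p"
  shows "inv_class (path_class p) = path_class (reversepath p)"
  unfolding inv_class_def
  using homotopic_path_rep[OF assms] homotopic_paths_reversepath homotopic_paths_sym path_class_eq by blast

lemma inv_class [simp]:
  assumes "c \<in> GG"
  shows "inv_class c \<in> GG" "rr (inv_class c) = ss c" "ss (inv_class c) = rr c"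
    "inv_class c \<bullet>\<bullet> c = unit_class (ss c)" "c \<bullet>\<bullet> inv_class c = unit_class (rr c)"
proof -
  obtain p where p: "path p" "c = path_class p" using assms by (rule GG_cases)
  show "inv_class c \<in> GG" "rr (inv_class c) = ss c" "ss (inv_class c) = rr c"
    "inv_class c \<bullet>\<bullet> c = unit_class (ss c)" "c \<bullet>\<bullet> inv_class c = unit_class (rr c)"
    using p by (simp_all add: inv_path_class rng_path_class src_path_class mult_path_class
        join_reverse_class reverse_join_class)
qed

lemma inv_mult_cancel [simp]:
  assumes "c \<in> GG" "d \<in> GG"
  shows "ss c = rr d \<Longrightarrow> inv_class c \<bullet>\<bullet> (c \<bullet>\<bullet> d) = d"
    "rr c = rr d \<Longrightarrow> c \<bullet>\<bullet> (inv_class c \<bullet>\<bullet> d) = d"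
    "ss c = rr d \<Longrightarrow> (c \<bullet>\<bullet> d) \<bullet>\<bullet> inv_class d = c"
    "ss c = ss d \<Longrightarrow> (c \<bullet>\<bullet> inv_class d) \<bullet>\<bullet> d = c"
  using assms by (metis inv_class mult_assoc_class unit_mult)+

lemma mult_left_cancel:
  assumes "c \<in> GG" "d \<in> GG" "e \<in> GG" "ss c = rr d" "ss c = rr e" "c \<bullet>\<bullet> d = c \<bullet>\<bullet> e"
  shows "d = e"
  using assms by (metis inv_mult_cancel(1))

section \<open>Classes of paths in small open sets\<close>

definition classes_in :: "'a::topological_space set \<Rightarrow> (real \<Rightarrow> 'a) set set" where
  "classes_in U = {path_class p |p. path p \<and> path_image p \<subseteq> U}"

lemma classes_in_GG: "a \<in> classes_in U \<Longrightarrow> a \<in> GG"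
  by (auto simp: classes_in_def)

lemma classes_in_mono: "a \<in> classes_in U \<Longrightarrow> U \<subseteq> V \<Longrightarrow> a \<in> classes_in V"
  unfolding classes_in_def by blast

lemma classes_in_ends:
  assumes "a \<in> classes_in U" shows "rr a \<in> U" "ss a \<in> U"
  using assms by (auto simp: classes_in_def rng_path_class src_path_class)

lemma classes_in_mult:
  assumes "a \<in> classes_in U" "b \<in> classes_in U" "ss a = rr b"
  shows "a \<bullet>\<bullet> b \<in> classes_in U"
proof -
  obtain p q where "path p" "path_image p \<subseteq> U" "a = path_class p"
    "path q" "path_image q \<subseteq> U" "b = path_class q"
    using assms by (auto simp: classes_in_def)
  with assms(3) show ?thesis
    unfolding classes_in_def mem_Collect_eq
    by (intro exI[of _ "q +++ p"])
      (simp add: mult_path_class src_path_class rng_path_class path_image_join)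
qed

lemma classes_in_inv:
  assumes "a \<in> classes_in U" shows "inv_class a \<in> classes_in U"
proof -
  obtain p where "path p" "path_image p \<subseteq> U" "a = path_class p"
    using assms by (auto simp: classes_in_def)
  then show ?thesis
    unfolding classes_in_def mem_Collect_eq
    by (intro exI[of _ "reversepath p"]) (simp add: inv_path_class)
qed

lemma classes_in_unit: "u \<in> U \<Longrightarrow> unit_class u \<in> classes_in U"
  unfolding classes_in_def unit_class_def by (auto simp: path_image_def)

text \<open>The sets U, V of the standard basis. \<open>classes_in U\<close> is the image of Pi_1(U)
  in Pi_1(X): representatives stay in \<open>U\<close>, homotopies may leave it. The uniqueness
  clause is the triviality of pi_1(U) -> pi_1(X), stated without a base point so that it can be used
  directly for cancellation.\<close>

definition good_open :: "'a::topological_space set \<Rightarrow> bool" where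
  "good_open U \<longleftrightarrow> open U \<and> path_connected U \<and>
     (\<forall>a\<in>classes_in U. \<forall>b\<in>classes_in U. rr a = rr b \<longrightarrow> ss a = ss b \<longrightarrow> a = b)"

lemma good_openD:
  assumes "good_open U"
  shows "open U" "\<And>a b. a \<in> classes_in U \<Longrightarrow> b \<in> classes_in U \<Longrightarrow> rr a = rr b \<Longrightarrow> ss a = ss b \<Longrightarrow> a = b"
  using assms by (auto simp: good_open_def)

lemma path_connected_class:
  assumes "path_connected U" "u \<in> U" "v \<in> U"
  obtains a where "a \<in> classes_in U" "rr a = u" "ss a = v"
proof -
  obtain p where "path p" "path_image p \<subseteq> U" "pathstart p = v" "pathfinish p = u"
    using assms unfolding path_connected_def by blast
  then show ?thesis
    by (intro that[of "path_class p"]) (auto simp: classes_in_def rng_path_class src_path_class)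
qed

lemma good_open_class:
  assumes "good_open U" "u \<in> U" "v \<in> U"
  obtains a where "a \<in> classes_in U" "rr a = u" "ss a = v"
  using assms path_connected_class unfolding good_open_def by metis

locale covered_space =
  fixes ty :: "'a::t2_space itself"
  assumes lc: "locally compact (UNIV :: 'a set)"
    and lpc: "locally path_connected (UNIV :: 'a set)"
    and slsc: "semilocally_simply_connected (UNIV :: 'a set)"
begin

text \<open>Semilocal simple connectedness kills only the loops at \<open>u\<close>. Two classes in
  \<open>U\<close> with equal ends differ by a loop \<open>?d\<close> at another point; conjugating
  it by a class \<open>e\<close> inside \<open>U\<close> gives a loop at \<open>u\<close>, hence a
  unit, and cancelling \<open>e\<close> makes \<open>?d\<close> trivial.\<close>

lemma good_open_ex:
  fixes u :: 'a
  assumes "open W" "u \<in> W"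
  obtains U where "good_open U" "u \<in> U" "U \<subseteq> W"
proof -
  obtain Q where Q: "open Q" "u \<in> Q"
    and null: "\<And>g. path g \<Longrightarrow> path_image g \<subseteq> Q \<Longrightarrow> pathstart g = u \<Longrightarrow> pathfinish g = u
              \<Longrightarrow> homotopic_paths UNIV g (\<lambda>_. u)"
    using slsc unfolding semilocally_simply_connected_def by (auto simp: Ball_def) metis
  obtain U where U: "open U" "path_connected U" "u \<in> U" "U \<subseteq> W \<inter> Q"
    using lpc Q assms unfolding locally_path_connected
    by (metis IntI UNIV_I open_Int open_openin subtopology_UNIV subset_UNIV)
  have loop: "a = unit_class u" if a: "a \<in> classes_in U" "rr a = u" "ss a = u" for a
  proof -
    obtain p where p: "path p" "path_image p \<subseteq> U" "a = path_class p"
      using a by (auto simp: classes_in_def)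
    then have "homotopic_paths UNIV p (\<lambda>_. u)"
      using a U by (intro null) (auto simp: rng_path_class src_path_class)
    then show ?thesis using p by (simp add: unit_class_def path_class_eq)
  qed
  have "a = b" if ab: "a \<in> classes_in U" "b \<in> classes_in U" "rr a = rr b" "ss a = ss b" for a b
  proof -
    note G = classes_in_GG[OF ab(1)] classes_in_GG[OF ab(2)]
    obtain e where e: "e \<in> classes_in U" "rr e = u" "ss e = rr a"
      using path_connected_class[OF U(2,3)] classes_in_ends ab by metis
    note eG = classes_in_GG[OF e(1)]
    let ?d = "a \<bullet>\<bullet> inv_class b"
    have d: "?d \<in> GG" "rr ?d = rr a" "ss ?d = rr a" using ab G by simp_all
    have "e \<bullet>\<bullet> ?d \<bullet>\<bullet> inv_class e = unit_class u"
      using ab e d G eG by (intro loop classes_in_mult classes_in_inv) simp_all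
    moreover have "e \<bullet>\<bullet> ?d \<bullet>\<bullet> inv_class e \<bullet>\<bullet> e = e \<bullet>\<bullet> ?d"
      using ab e d G eG by (intro inv_mult_cancel(4)) simp_all
    moreover have "unit_class u \<bullet>\<bullet> e = e" using unit_mult(1)[OF eG] e by simp
    moreover have "e \<bullet>\<bullet> unit_class (rr a) = e" using unit_mult(2)[OF eG] e by simp
    ultimately have eq: "e \<bullet>\<bullet> ?d = e \<bullet>\<bullet> unit_class (rr a)"
      by simp
    have "?d = unit_class (rr a)"
      by (rule mult_left_cancel[OF eG d(1) unit_class(1) _ _ eq]) (simp_all only: d e unit_class)
    moreover have "?d \<bullet>\<bullet> b = a" using inv_mult_cancel(4)[OF G] ab by simp
    moreover have "unit_class (rr a) \<bullet>\<bullet> b = b" using unit_mult(1)[OF G(2)] ab by simp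
    ultimately show ?thesis by simp
  qed
  then have "good_open U" using U by (auto simp: good_open_def)
  then show ?thesis using that U by blast
qed

end

section \<open>The topology of the fundamental groupoid\<close>

text \<open>The basic sets N(c,U,V). \<open>U\<close> and \<open>V\<close> are arbitrary here, so
  that \<open>UNIV\<close> can be inserted to leave one end free; goodness is demanded only where
  uniqueness of short classes is used.\<close>

definition nbh :: "(real \<Rightarrow> 'a::topological_space) set \<Rightarrow> 'a set \<Rightarrow> 'a set \<Rightarrow> (real \<Rightarrow> 'a) set set" where
  "nbh c U V = {a \<bullet>\<bullet> c \<bullet>\<bullet> b |a b. a \<in> classes_in U \<and> b \<in> classes_in V \<and> ss a = rr c \<and> ss c = rr b}"

lemma nbhE:
  assumes "d \<in> nbh c U V" "c \<in> GG"
  obtains a b where "d = a \<bullet>\<bullet> c \<bullet>\<bullet> b" "a \<in> classes_in U" "b \<in> classes_in V" "ss a = rr c" "ss c = rr b"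
    "a \<in> GG" "b \<in> GG"
  using assms classes_in_GG unfolding nbh_def by blast

lemma nbhI:
  assumes "a \<in> classes_in U" "b \<in> classes_in V" "ss a = rr c" "ss c = rr b" "d = a \<bullet>\<bullet> c \<bullet>\<bullet> b"
  shows "d \<in> nbh c U V"
  using assms unfolding nbh_def by blast

lemma nbh_props:
  assumes "d \<in> nbh c U V" "c \<in> GG"
  shows "d \<in> GG" "rr d \<in> U" "ss d \<in> V"
  using assms by (auto elim!: nbhE simp: classes_in_ends)

lemma nbh_self:
  assumes "c \<in> GG" "rr c \<in> U" "ss c \<in> V"
  shows "c \<in> nbh c U V"
  by (rule nbhI[OF classes_in_unit[OF assms(2)] classes_in_unit[OF assms(3)]]) (use assms in simp_all)

lemma nbh_mono: "d \<in> nbh c U V \<Longrightarrow> U \<subseteq> U' \<Longrightarrow> V \<subseteq> V' \<Longrightarrow> d \<in> nbh c U' V'"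
  unfolding nbh_def using classes_in_mono by blast

text \<open>Short classes can be composed. Together with \<open>nbh_self\<close> and
  \<open>nbh_sym\<close> this makes membership for fixed \<open>U\<close>, \<open>V\<close> an
  equivalence relation among the classes with range in \<open>U\<close> and source in
  \<open>V\<close>. So \<open>nbh c U V\<close> is a neighbourhood of each of its members, and two
  such sets are equal or disjoint.\<close>

lemma nbh_trans:
  assumes "d \<in> nbh c U V" "e \<in> nbh d U V" "c \<in> GG"
  shows "e \<in> nbh c U V"
proof -
  obtain a b where d: "d = a \<bullet>\<bullet> c \<bullet>\<bullet> b" "a \<in> classes_in U" "b \<in> classes_in V" "ss a = rr c" "ss c = rr b"
    "a \<in> GG" "b \<in> GG"
    using assms nbhE by metis
  obtain a' b' where e: "e = a' \<bullet>\<bullet> d \<bullet>\<bullet> b'" "a' \<in> classes_in U" "b' \<in> classes_in V" "ss a' = rr d" "ss d = rr b'"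
    "a' \<in> GG" "b' \<in> GG"
    using assms nbhE nbh_props by metis
  show ?thesis
    by (rule nbhI[of "a' \<bullet>\<bullet> a" _ "b \<bullet>\<bullet> b'"])
      (use d e assms in \<open>simp_all add: classes_in_mult mult_assoc_class\<close>)
qed

lemma nbh_sym:
  assumes "d \<in> nbh c U V" "c \<in> GG"
  shows "c \<in> nbh d U V"
proof -
  obtain a b where d: "d = a \<bullet>\<bullet> c \<bullet>\<bullet> b" "a \<in> classes_in U" "b \<in> classes_in V" "ss a = rr c" "ss c = rr b"
    "a \<in> GG" "b \<in> GG"
    using assms nbhE by metis
  show ?thesis
    by (rule nbhI[of "inv_class a" _ "inv_class b"])
      (use d assms in \<open>simp_all add: classes_in_inv mult_assoc_class\<close>)
qed

text \<open>In the product the short pieces \<open>b\<close> and \<open>a'\<close> meet in the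
  middle. Their product is a loop class in the good set \<open>V\<close>, hence a unit, and
  disappears.\<close>

lemma nbh_mult:
  assumes "good_open V" "c' \<in> nbh c U V" "d' \<in> nbh d V W" "c \<in> GG" "d \<in> GG" "ss c = rr d" "ss c' = rr d'"
  shows "c' \<bullet>\<bullet> d' \<in> nbh (c \<bullet>\<bullet> d) U W"
proof -
  obtain a b where c: "c' = a \<bullet>\<bullet> c \<bullet>\<bullet> b" "a \<in> classes_in U" "b \<in> classes_in V" "ss a = rr c" "ss c = rr b"
    "a \<in> GG" "b \<in> GG"
    using assms nbhE by metis
  obtain a' b' where d: "d' = a' \<bullet>\<bullet> d \<bullet>\<bullet> b'" "a' \<in> classes_in V" "b' \<in> classes_in W" "ss a' = rr d" "ss d = rr b'"
    "a' \<in> GG" "b' \<in> GG"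
    using assms nbhE by metis
  have ba: "ss b = rr a'" using assms c d by simp
  have "b \<bullet>\<bullet> a' = unit_class (rr d)"
  proof (rule good_openD(2)[OF assms(1)])
    show "b \<bullet>\<bullet> a' \<in> classes_in V" using c d ba by (simp add: classes_in_mult)
    show "unit_class (rr d) \<in> classes_in V"
      using c(3,5) assms(6) classes_in_ends by (metis classes_in_unit)
  qed (use c d ba assms in simp_all)
  then have "b \<bullet>\<bullet> (a' \<bullet>\<bullet> (d \<bullet>\<bullet> b')) = d \<bullet>\<bullet> b'"
    using c d ba assms by (metis mult_assoc_class mult_in unit_mult(1))
  then have "c' \<bullet>\<bullet> d' = a \<bullet>\<bullet> (c \<bullet>\<bullet> d) \<bullet>\<bullet> b'"
    using c d ba assms by (simp add: mult_assoc_class)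
  then show ?thesis
    by (intro nbhI[OF c(2) d(3)]) (use c d assms in simp_all)
qed

section \<open>Paths near a given path in the compact-open topology have classes in its basic
  sets\<close>

lemma openin_compact_open_paths:
  "compact K \<Longrightarrow> K \<subseteq> {0..1} \<Longrightarrow> open U \<Longrightarrow> openin compact_open_paths {g. path g \<and> g ` K \<subseteq> U}"
  unfolding compact_open_paths_def by (rule topology_generated_by_Basis) blast

text \<open>Written as a composite with a path of parameters, so that
  \<open>homotopic_paths_compose_path\<close> applies.\<close>

definition seg_path :: "real \<Rightarrow> real \<Rightarrow> (real \<Rightarrow> 'a::topological_space) \<Rightarrow> real \<Rightarrow> 'a" where
  "seg_path a b g = g \<circ> linepath a b"

lemma linepath_in_01:
  "a \<in> {0..1} \<Longrightarrow> b \<in> {0..1} \<Longrightarrow> path_image (linepath a b) \<subseteq> {0..1::real}"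
  by (simp add: closed_segment_subset)

lemma path_seg_path:
  assumes "path g" "a \<in> {0..1}" "b \<in> {0..1}"
  shows "path (seg_path a b g)"
  unfolding seg_path_def
  by (rule path_continuous_image) (use assms linepath_in_01 in \<open>auto simp: path_def intro: continuous_on_subset\<close>)

lemma seg_path_ends [simp]: "pathstart (seg_path a b g) = g a" "pathfinish (seg_path a b g) = g b"
  by (simp_all add: seg_path_def pathstart_compose pathfinish_compose)

lemma path_image_seg_path: "a \<le> b \<Longrightarrow> path_image (seg_path a b g) = g ` {a..b}"
  by (simp add: seg_path_def path_image_compose closed_segment_eq_real_ivl)

lemma seg_path_01: "seg_path 0 1 g = g"
  by (simp add: seg_path_def linepath_01 o_def)

text \<open>Both sides come from parameter paths from \<open>a\<close> to \<open>c\<close> in the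
  convex set \<open>{0..1}\<close>, which are joined by a straight-line homotopy; no order of
  \<open>a\<close>, \<open>b\<close>, \<open>c\<close> is required.\<close>

lemma path_class_seg_path_join:
  assumes "path g" "a \<in> {0..1}" "b \<in> {0..1}" "c \<in> {0..1}"
  shows "path_class (seg_path b c g) \<bullet>\<bullet> path_class (seg_path a b g) = path_class (seg_path a c g)"
proof -
  have "path_class (seg_path b c g) \<bullet>\<bullet> path_class (seg_path a b g) = path_class (seg_path a b g +++ seg_path b c g)"
    using assms by (intro mult_path_class path_seg_path) auto
  also have "\<dots> = path_class (seg_path a c g)"
  proof (intro path_class_eq)
    have "homotopic_paths {0..1} (linepath a b +++ linepath b c) (linepath a c)"
    proof (rule homotopic_paths_linear)
      fix t :: real assume "t \<in> {0..1}"
      then have "(linepath a b +++ linepath b c) t \<in> path_image (linepath a b +++ linepath b c)"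
        "linepath a c t \<in> path_image (linepath a c)"
        by (auto simp: path_image_def)
      moreover have "path_image (linepath a b +++ linepath b c) \<subseteq> {0..1}"
        by (rule subset_path_image_join) (use linepath_in_01 assms in blast)+
      ultimately have "(linepath a b +++ linepath b c) t \<in> {0..1}" "linepath a c t \<in> {0..1}"
        using linepath_in_01[OF assms(2,4)] by blast+
      then show "closed_segment ((linepath a b +++ linepath b c) t) (linepath a c t) \<subseteq> {0..1}"
        by (simp add: closed_segment_subset)
    qed simp_all
    from homotopic_paths_compose_path[OF assms(1) this]
    show "homotopic_paths UNIV (seg_path a b g +++ seg_path b c g) (seg_path a c g)"
      by (simp add: seg_path_def path_compose_join)
  qed
  finally show ?thesis .
qed

context covered_space
begin

lemma good_open_at:
  fixes u :: 'a
  obtains U where "good_open U" "u \<in> U"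
  using good_open_ex[OF open_UNIV UNIV_I] by metis

text \<open>If \<open>k\<close> is close to \<open>h\<close>, its segment also lies in
  \<open>D\<close>, and its end points can be joined to those of \<open>h\<close> by short classes
  \<open>y\<close>, \<open>z\<close> inside \<open>D\<close>. The segment of \<open>k\<close> and
  the product of \<open>y\<close>, the segment of \<open>h\<close> and \<open>z\<close> then have
  the same ends in the good set \<open>D\<close>, so they are equal.\<close>

lemma seg_path_class_nbh_local:
  fixes h :: "real \<Rightarrow> 'a"
  assumes "path h" "0 \<le> a" "a \<le> b" "b \<le> 1" "good_open D" "h ` {a..b} \<subseteq> D"
    and "open A" "open B" "h a \<in> A" "h b \<in> B"
  obtains Q where "openin compact_open_paths Q" "h \<in> Q"
    "\<And>k. k \<in> Q \<Longrightarrow> path_class (seg_path a b k) \<in> nbh (path_class (seg_path a b h)) B A"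
proof -
  obtain A' where A': "good_open A'" "h a \<in> A'" "A' \<subseteq> A \<inter> D"
    using good_open_ex[of "A \<inter> D" "h a"] assms good_openD(1)
    by (metis IntI atLeastAtMost_iff image_subset_iff open_Int order_refl)
  obtain B' where B': "good_open B'" "h b \<in> B'" "B' \<subseteq> B \<inter> D"
    using good_open_ex[of "B \<inter> D" "h b"] assms good_openD(1)
    by (metis IntI atLeastAtMost_iff image_subset_iff open_Int order_refl)
  define Q where "Q = {g. path g \<and> g ` {a..b} \<subseteq> D} \<inter> ({g. path g \<and> g ` {a} \<subseteq> A'} \<inter> {g. path g \<and> g ` {b} \<subseteq> B'})"
  have "openin compact_open_paths Q"
    unfolding Q_def by (intro openin_Int openin_compact_open_paths)
      (use assms A' B' good_openD(1) in auto)
  moreover have "h \<in> Q" using assms A' B' by (auto simp: Q_def)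
  moreover have "path_class (seg_path a b k) \<in> nbh (path_class (seg_path a b h)) B A" if "k \<in> Q" for k
  proof -
    have k: "path k" "k ` {a..b} \<subseteq> D" "k a \<in> A'" "k b \<in> B'" using that by (auto simp: Q_def)
    let ?h = "path_class (seg_path a b h)" and ?k = "path_class (seg_path a b k)"
    have ab: "a \<in> {0..1}" "b \<in> {0..1}" using assms by auto
    have p: "path (seg_path a b h)" "path (seg_path a b k)" using assms k ab by (auto intro: path_seg_path)
    have inD: "?h \<in> classes_in D" "?k \<in> classes_in D"
      unfolding classes_in_def mem_Collect_eq using p assms k by (metis path_image_seg_path)+
    have e: "rr ?h = h b" "ss ?h = h a" "rr ?k = k b" "ss ?k = k a"
      using p by (simp_all add: rng_path_class src_path_class)
    obtain y where y: "y \<in> classes_in B'" "rr y = k b" "ss y = h b"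
      using good_open_class[OF B'(1) k(4) B'(2)] by metis
    obtain z where z: "z \<in> classes_in A'" "rr z = h a" "ss z = k a"
      using good_open_class[OF A'(1) A'(2) k(3)] by metis
    have yz: "y \<in> classes_in D" "z \<in> classes_in D"
      using y z A' B' classes_in_mono by blast+
    have G: "?h \<in> GG" "y \<in> GG" "z \<in> GG" using inD yz classes_in_GG by blast+
    have "y \<bullet>\<bullet> ?h \<in> classes_in D" using inD yz e y z by (intro classes_in_mult) simp_all
    then have "y \<bullet>\<bullet> ?h \<bullet>\<bullet> z \<in> classes_in D" using inD yz e y z G by (intro classes_in_mult) simp_all
    then have "?k = y \<bullet>\<bullet> ?h \<bullet>\<bullet> z"
      using inD e y z G by (intro good_openD(2)[OF \<open>good_open D\<close>]) simp_all
    then show ?thesis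
      by (rule nbhI[rotated 4]) (use y z A' B' e classes_in_mono in auto)
  qed
  ultimately show ?thesis using that by blast
qed

text \<open>Bisection of the parameter interval replaces an explicit subdivision: short segments lie
  in one good set, and adjacent segments are combined by \<open>nbh_mult\<close>.\<close>

lemma path_class_nbh:
  fixes h :: "real \<Rightarrow> 'a"
  assumes h: "path h" and "open U" "open V" "pathfinish h \<in> U" "pathstart h \<in> V"
  obtains Q where "openin compact_open_paths Q" "h \<in> Q"
    "\<And>k. k \<in> Q \<Longrightarrow> path_class k \<in> nbh (path_class h) U V"
proof -
  \<comment> \<open>The neighbourhoods \<open>A\<close> and \<open>B\<close> of the end points are
    quantified inside \<open>P\<close>: when two segments are joined at \<open>b\<close>, both
    instances must be taken with the same good set \<open>D\<close> around
    \<open>h b\<close>.\<close>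
  define P where "P a b \<longleftrightarrow> (0 \<le> a \<longrightarrow> a \<le> b \<longrightarrow> b \<le> 1 \<longrightarrow>
    (\<forall>A B. open A \<and> open B \<and> h a \<in> A \<and> h b \<in> B \<longrightarrow>
     (\<exists>Q. openin compact_open_paths Q \<and> h \<in> Q \<and>
        (\<forall>k\<in>Q. path_class (seg_path a b k) \<in> nbh (path_class (seg_path a b h)) B A))))" for a b
  have "(0::real) \<le> 1" by simp
  then have "P 0 1"
  proof (induct rule: Bolzano)
    case (trans a b c)
    show ?case
      unfolding P_def
    proof (intro impI allI)
      fix A B assume 0: "0 \<le> a" and "c \<le> 1" and AB: "open A \<and> open B \<and> h a \<in> A \<and> h c \<in> B"
      obtain D where D: "good_open D" "h b \<in> D" by (rule good_open_at[of "h b"])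
      obtain Q1 where Q1: "openin compact_open_paths Q1" "h \<in> Q1"
        "\<And>k. k \<in> Q1 \<Longrightarrow> path_class (seg_path a b k) \<in> nbh (path_class (seg_path a b h)) D A"
        using trans 0 \<open>c \<le> 1\<close> AB D good_openD(1) unfolding P_def by (meson order_trans)
      obtain Q2 where Q2: "openin compact_open_paths Q2" "h \<in> Q2"
        "\<And>k. k \<in> Q2 \<Longrightarrow> path_class (seg_path b c k) \<in> nbh (path_class (seg_path b c h)) B D"
        using trans 0 \<open>c \<le> 1\<close> AB D good_openD(1) unfolding P_def by (meson order_trans)
      have "path_class (seg_path a c k) \<in> nbh (path_class (seg_path a c h)) B A" if "k \<in> Q1 \<inter> Q2" for k
      proof -
        have "path k" using that openin_subset[OF Q1(1)] by auto
        have rng: "a \<in> {0..1}" "b \<in> {0..1}" "c \<in> {0..1}" using 0 trans \<open>c \<le> 1\<close> by auto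
        note ps = path_seg_path[OF \<open>path h\<close> rng(1,2)] path_seg_path[OF \<open>path h\<close> rng(2,3)]
          path_seg_path[OF \<open>path k\<close> rng(1,2)] path_seg_path[OF \<open>path k\<close> rng(2,3)]
        have "path_class (seg_path b c k) \<bullet>\<bullet> path_class (seg_path a b k)
           \<in> nbh (path_class (seg_path b c h) \<bullet>\<bullet> path_class (seg_path a b h)) B A"
          by (rule nbh_mult[OF D(1)]) (use Q1(3)[of k] Q2(3)[of k] that ps in \<open>simp_all add: rng_path_class src_path_class\<close>)
        then show ?thesis
          using path_class_seg_path_join[OF \<open>path h\<close> rng] path_class_seg_path_join[OF \<open>path k\<close> rng] by simp
      qed
      then show "\<exists>Q. openin compact_open_paths Q \<and> h \<in> Q \<and>
        (\<forall>k\<in>Q. path_class (seg_path a c k) \<in> nbh (path_class (seg_path a c h)) B A)"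
        using Q1 Q2 by (intro exI[of _ "Q1 \<inter> Q2"]) auto
    qed
  next
    case (local x)
    obtain D where D: "good_open D" "h x \<in> D" by (rule good_open_at[of "h x"])
    have "continuous_on {0..1} h" using h by (simp add: path_def)
    then obtain d where d: "d > 0" "\<And>y. y \<in> {0..1} \<Longrightarrow> dist y x < d \<Longrightarrow> h y \<in> D"
      using D good_openD(1)[OF D(1)] local unfolding continuous_on_topological
      by (metis atLeastAtMost_iff open_dist dist_commute)
    have "P a b" if "a \<le> x" "x \<le> b" "b - a < d" for a b
      unfolding P_def
    proof (intro impI allI)
      fix A B assume ab: "0 \<le> a" "a \<le> b" "b \<le> 1" and AB: "open A \<and> open B \<and> h a \<in> A \<and> h b \<in> B"
      have "h ` {a..b} \<subseteq> D" using d(2) ab that by (auto simp: dist_real_def)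
      from seg_path_class_nbh_local[OF h ab D(1) this] AB
      show "\<exists>Q. openin compact_open_paths Q \<and> h \<in> Q \<and>
        (\<forall>k\<in>Q. path_class (seg_path a b k) \<in> nbh (path_class (seg_path a b h)) B A)"
        by metis
    qed
    with d(1) show ?case by blast
  qed
  then have "\<exists>Q. openin compact_open_paths Q \<and> h \<in> Q \<and>
      (\<forall>k\<in>Q. path_class (seg_path 0 1 k) \<in> nbh (path_class (seg_path 0 1 h)) U V)"
    using assms(2-5) unfolding P_def pathstart_def pathfinish_def by simp
  then show ?thesis
    using that unfolding seg_path_01 by blast
qed

lemma openin_nbh:
  fixes c :: "(real \<Rightarrow> 'a) set"
  assumes "c \<in> GG" "open U" "open V"
  shows "openin Gtop (nbh c U V)"
proof -
  have "openin compact_open_paths {g. path g \<and> path_class g \<in> nbh c U V}"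
  proof (subst openin_subopen, safe)
    fix h :: "real \<Rightarrow> 'a" assume h: "path h" "path_class h \<in> nbh c U V"
    obtain Q where Q: "openin compact_open_paths Q" "h \<in> Q"
      "\<And>k. k \<in> Q \<Longrightarrow> path_class k \<in> nbh (path_class h) U V"
      using path_class_nbh[OF h(1) assms(2,3)] nbh_props[OF h(2) assms(1)] h(1)
      by (metis rng_path_class src_path_class)
    have "Q \<subseteq> {g. path g \<and> path_class g \<in> nbh c U V}"
      using Q(3) openin_subset[OF Q(1)] nbh_trans[OF h(2) _ assms(1)] by auto
    then show "\<exists>T. openin compact_open_paths T \<and> h \<in> T \<and> T \<subseteq> {g. path g \<and> path_class g \<in> nbh c U V}"
      using Q by blast
  qed
  moreover have "nbh c U V \<subseteq> path_class ` Collect path"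
    using nbh_props(1)[OF _ assms(1)] topspace_fundamental_groupoid by blast
  ultimately show ?thesis
    by (simp add: fundamental_groupoid_def openin_quotient_topology)
qed

end

text \<open>The converse comparison of topologies: an open set of paths absorbs short prolongations
  at both ends. The path is padded with constant pieces beforehand, so that \<open>d\<close> and
  \<open>w\<close> replace these pieces without any reparametrisation of \<open>g\<close>.\<close>

lemma compact_open_join_nbh:
  fixes g :: "real \<Rightarrow> 'a::topological_space"
  assumes "openin compact_open_paths W" "path g"
    and "(\<lambda>_. g 0) +++ (g +++ (\<lambda>_. g 1)) \<in> W"
  shows "\<exists>U V. open U \<and> open V \<and> g 1 \<in> U \<and> g 0 \<in> V \<and>
    (\<forall>d w. path d \<and> path_image d \<subseteq> V \<and> pathfinish d = g 0 \<and>
       path w \<and> path_image w \<subseteq> U \<and> pathstart w = g 1 \<longrightarrow> d +++ (g +++ w) \<in> W)"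
proof -
  define R where "R W U V \<longleftrightarrow> (\<forall>d w. path d \<and> path_image d \<subseteq> V \<and> pathfinish d = g 0 \<and>
       path w \<and> path_image w \<subseteq> U \<and> pathstart w = g 1 \<longrightarrow> d +++ (g +++ w) \<in> W)" for W U V
  have "\<exists>U V. open U \<and> open V \<and> g 1 \<in> U \<and> g 0 \<in> V \<and> R W U V"
    using assms(1)[unfolded compact_open_paths_def openin_topology_generated_by_iff] assms(3)
  proof (induction rule: generate_topology_on.induct)
    case Empty then show ?case by simp
  next
    case (Int A B)
    from Int.IH(1) Int.prems obtain U1 V1 where 1: "open U1" "open V1" "g 1 \<in> U1" "g 0 \<in> V1" "R A U1 V1"
      by (metis IntD1)
    from Int.IH(2) Int.prems obtain U2 V2 where 2: "open U2" "open V2" "g 1 \<in> U2" "g 0 \<in> V2" "R B U2 V2"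
      by (metis IntD2)
    have "R (A \<inter> B) (U1 \<inter> U2) (V1 \<inter> V2)"
      using 1(5) 2(5) unfolding R_def by simp
    with 1 2 show ?case by (intro exI[of _ "U1 \<inter> U2"] exI[of _ "V1 \<inter> V2"]) auto
  next
    case (UN \<K>)
    then obtain k where k: "k \<in> \<K>" "(\<lambda>_. g 0) +++ (g +++ (\<lambda>_. g 1)) \<in> k" by blast
    from UN.IH[OF this] obtain U V where "open U" "open V" "g 1 \<in> U" "g 0 \<in> V" "R k U V" by blast
    moreover from this have "R (\<Union>\<K>) U V" using k unfolding R_def by blast
    ultimately show ?case by blast
  next
    case (Basis S)
    then obtain K Q where S: "S = {g. path g \<and> g ` K \<subseteq> Q}" "K \<subseteq> {0..1}" "open Q" by blast
    \<comment> \<open>If \<open>g 1\<close> is outside \<open>Q\<close>, the hypothesis on the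
      padded path keeps \<open>K\<close> away from the parameters of the last constant piece, so
      \<open>w\<close> needs no restriction there. The same applies to \<open>V\<close> and the
      first piece.\<close>
    define U where "U = (if g 1 \<in> Q then Q else UNIV)"
    define V where "V = (if g 0 \<in> Q then Q else UNIV)"
    have *: "((\<lambda>_. g 0) +++ (g +++ (\<lambda>_. g 1))) t \<in> Q" if "t \<in> K" for t
      using Basis(2) that S by auto
    have "d +++ (g +++ w) \<in> S"
      if d: "path d \<and> path_image d \<subseteq> V \<and> pathfinish d = g 0 \<and>
         path w \<and> path_image w \<subseteq> U \<and> pathstart w = g 1" for d w
    proof -
      have "path (d +++ (g +++ w))" 
        using d \<open>path g\<close> by (intro path_join_imp) (simp_all, simp_all add: pathstart_def pathfinish_def)
      moreover have "(d +++ (g +++ w)) t \<in> Q" if "t \<in> K" for t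
      proof -
        have t: "t \<in> {0..1}" using that S by auto
        have dV: "d s \<in> V" if "s \<in> {0..1}" for s using d that by (auto simp: path_image_def)
        have wU: "w s \<in> U" if "s \<in> {0..1}" for s using d that by (auto simp: path_image_def)
        show ?thesis
          \<comment> \<open>The iterated join runs through \<open>d\<close> at \<open>2 * t\<close>
            on the first half, then through \<open>g\<close> up to parameter 3/4, then through
            \<open>w\<close>; these are the arguments supplied here.\<close>
          using *[OF that] t dV[of "2 * t"] wU[of "2 * (2 * t - 1) - 1"]
          by (auto simp: joinpaths_def U_def V_def split: if_splits)
      qed
      ultimately show ?thesis using S by auto
    qed
    then show ?case
      using S by (intro exI[of _ U] exI[of _ V]) (auto simp: U_def V_def R_def)
  qed
  then show ?thesis unfolding R_def .
qed

section \<open>Local sections of the pair of range and source, and the topology derived from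
  them\<close>

definition transport :: "'a::topological_space set \<Rightarrow> 'a \<Rightarrow> 'a \<Rightarrow> (real \<Rightarrow> 'a) set" where
  "transport U u v = (THE a. a \<in> classes_in U \<and> rr a = u \<and> ss a = v)"

lemma transport:
  assumes "good_open U" "u \<in> U" "v \<in> U"
  shows "transport U u v \<in> classes_in U" "rr (transport U u v) = u" "ss (transport U u v) = v"
    "transport U u v \<in> GG"
proof -
  have "\<exists>!a. a \<in> classes_in U \<and> rr a = u \<and> ss a = v"
    using good_open_class[OF assms] good_openD(2)[OF assms(1)] by metis
  from theI'[OF this] show "transport U u v \<in> classes_in U" "rr (transport U u v) = u" "ss (transport U u v) = v"
    by (auto simp: transport_def)
  then show "transport U u v \<in> GG" using classes_in_GG by blast
qed

lemma transport_eq: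
  assumes "good_open U" "a \<in> classes_in U"
  shows "transport U (rr a) (ss a) = a"
  using good_openD(2)[OF assms(1)] assms transport classes_in_ends by metis

text \<open>For good \<open>U\<close> and \<open>V\<close>, with the ends of \<open>c\<close> in
  them, this is the inverse of (range, source) on \<open>nbh c U V\<close>: \<open>c\<close> is
  prolonged at both ends by the unique short classes. It plays the part of an evenly covered
  chart.\<close>

definition chart_section :: "(real \<Rightarrow> 'a::topological_space) set \<Rightarrow> 'a set \<Rightarrow> 'a set \<Rightarrow> 'a \<times> 'a \<Rightarrow> (real \<Rightarrow> 'a) set" where
  "chart_section c U V = (\<lambda>(u, v). transport U u (rr c) \<bullet>\<bullet> c \<bullet>\<bullet> transport V (ss c) v)"

lemma chart_section:
  assumes "c \<in> GG" "good_open U" "good_open V" "rr c \<in> U" "ss c \<in> V" "u \<in> U" "v \<in> V"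
  shows "chart_section c U V (u, v) \<in> nbh c U V" "rr (chart_section c U V (u, v)) = u"
    "ss (chart_section c U V (u, v)) = v" "chart_section c U V (u, v) \<in> GG"
proof -
  show 1: "chart_section c U V (u, v) \<in> nbh c U V"
    unfolding chart_section_def prod.case
    by (rule nbhI[of "transport U u (rr c)" _ "transport V (ss c) v"]) (use assms in \<open>simp_all add: transport\<close>)
  then show "chart_section c U V (u, v) \<in> GG" using assms(1) nbh_props by blast
  show "rr (chart_section c U V (u, v)) = u" "ss (chart_section c U V (u, v)) = v"
    unfolding chart_section_def prod.case using assms by (simp_all add: transport)
qed

lemma chart_section_eq:
  assumes "c \<in> GG" "good_open U" "good_open V" "d \<in> nbh c U V"
  shows "chart_section c U V (rr d, ss d) = d"
proof -
  obtain a b where d: "d = a \<bullet>\<bullet> c \<bullet>\<bullet> b" "a \<in> classes_in U" "b \<in> classes_in V" "ss a = rr c" "ss c = rr b"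
    "a \<in> GG" "b \<in> GG"
    using assms nbhE by metis
  then have "rr d = rr a" "ss d = ss b" using assms by simp_all
  then show ?thesis
    using d transport_eq[OF assms(2) d(2)] transport_eq[OF assms(3) d(3)] by (simp add: chart_section_def)
qed

context covered_space
begin

lemma nbh_base:
  fixes c :: "(real \<Rightarrow> 'a) set"
  assumes "openin Gtop W" "c \<in> W" "open U0" "open V0" "rr c \<in> U0" "ss c \<in> V0"
  obtains U V where "good_open U" "good_open V" "U \<subseteq> U0" "V \<subseteq> V0" "rr c \<in> U" "ss c \<in> V" "nbh c U V \<subseteq> W"
proof -
  have cG: "c \<in> GG" using assms openin_subset by blast
  then obtain g where g: "path g" "c = path_class g" by (rule GG_cases)
  have e: "rr c = g 1" "ss c = g 0" using g by (simp_all add: rng_path_class src_path_class pathstart_def pathfinish_def)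
  \<comment> \<open>Padding by constants leaves the class unchanged but puts the representative into
    the form required by \<open>compact_open_join_nbh\<close>.\<close>
  let ?g = "(\<lambda>_. g 0) +++ (g +++ (\<lambda>_. g 1))"
  have g01: "g 0 = pathstart g" "g 1 = pathfinish g" by (simp_all add: pathstart_def pathfinish_def)
  have pg: "path ?g" unfolding g01 using g by (intro path_join_imp) simp_all
  have "path_class ?g = c \<bullet>\<bullet> unit_class (ss c)"
  proof -
    have "path_class ?g = path_class (g +++ (\<lambda>_. g 1)) \<bullet>\<bullet> path_class (\<lambda>_. g 0)"
      unfolding g01 using g by (intro mult_path_class[symmetric] path_join_imp) simp_all
    also have "path_class (g +++ (\<lambda>_. g 1)) = c"
      using join_const_class[OF g(1)] g by (simp add: pathfinish_def)
    finally show ?thesis by (simp add: unit_class_def e)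
  qed
  then have "path_class ?g \<in> W" using assms(2) cG by simp
  moreover have "openin compact_open_paths {g. path g \<and> path_class g \<in> W}"
    using assms(1) by (simp add: fundamental_groupoid_def openin_quotient_topology)
  ultimately obtain U V where UV: "open U" "open V" "g 1 \<in> U" "g 0 \<in> V"
    "\<And>d w. path d \<Longrightarrow> path_image d \<subseteq> V \<Longrightarrow> pathfinish d = g 0 \<Longrightarrow>
       path w \<Longrightarrow> path_image w \<subseteq> U \<Longrightarrow> pathstart w = g 1 \<Longrightarrow> path_class (d +++ (g +++ w)) \<in> W"
    using compact_open_join_nbh[of "{g. path g \<and> path_class g \<in> W}" g] pg g(1) by auto
  obtain U' where U': "good_open U'" "rr c \<in> U'" "U' \<subseteq> U \<inter> U0"
    using good_open_ex[of "U \<inter> U0" "rr c"] UV assms e by auto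
  obtain V' where V': "good_open V'" "ss c \<in> V'" "V' \<subseteq> V \<inter> V0"
    using good_open_ex[of "V \<inter> V0" "ss c"] UV assms e by auto
  have "nbh c U' V' \<subseteq> W"
  proof
    fix d assume "d \<in> nbh c U' V'"
    then obtain a b where d: "d = a \<bullet>\<bullet> c \<bullet>\<bullet> b" "a \<in> classes_in U'" "b \<in> classes_in V'" "ss a = rr c" "ss c = rr b"
      using nbhE cG by metis
    obtain w where w: "path w" "path_image w \<subseteq> U'" "a = path_class w" using d by (auto simp: classes_in_def)
    obtain p where p: "path p" "path_image p \<subseteq> V'" "b = path_class p" using d by (auto simp: classes_in_def)
    have ends: "pathstart w = g 1" "pathfinish p = g 0"
      using d w p e by (simp_all add: rng_path_class src_path_class)
    then have gw: "pathfinish g = pathstart w" "pathfinish p = pathstart g"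
      by (simp_all add: pathstart_def pathfinish_def)
    have "path_class (p +++ (g +++ w)) \<in> W"
      by (rule UV(5)) (use w p ends U' V' in auto)
    moreover have "d = path_class (p +++ (g +++ w))"
      using d(1) w p g gw by (simp add: mult_path_class)
    ultimately show "d \<in> W" by simp
  qed
  with that U' V' show ?thesis by blast
qed

lemma continuous_rng_src:
  "continuous_map Gtop euclidean (rr :: (real \<Rightarrow> 'a) set \<Rightarrow> 'a)"
  "continuous_map Gtop euclidean (ss :: (real \<Rightarrow> 'a) set \<Rightarrow> 'a)"
proof -
  have "\<exists>T. openin Gtop T \<and> c \<in> T \<and> T \<subseteq> {c \<in> GG. rr c \<in> W}"
    if "open W" "c \<in> GG" "rr c \<in> W" for W :: "'a set" and c
    using openin_nbh[of c W UNIV] nbh_self[of c W UNIV] nbh_props[of _ c W UNIV] that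
    by (intro exI[of _ "nbh c W UNIV"]) auto
  then have "openin Gtop {c \<in> GG. rr c \<in> W}" if "open W" for W :: "'a set"
    by (subst openin_subopen) (use that in simp)
  then show "continuous_map Gtop euclidean (rr :: (real \<Rightarrow> 'a) set \<Rightarrow> 'a)"
    by (simp add: continuous_map)
  have "\<exists>T. openin Gtop T \<and> c \<in> T \<and> T \<subseteq> {c \<in> GG. ss c \<in> W}"
    if "open W" "c \<in> GG" "ss c \<in> W" for W :: "'a set" and c
    using openin_nbh[of c UNIV W] nbh_self[of c UNIV W] nbh_props[of _ c UNIV W] that
    by (intro exI[of _ "nbh c UNIV W"]) auto
  then have "openin Gtop {c \<in> GG. ss c \<in> W}" if "open W" for W :: "'a set"
    by (subst openin_subopen) (use that in simp)
  then show "continuous_map Gtop euclidean (ss :: (real \<Rightarrow> 'a) set \<Rightarrow> 'a)"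
    by (simp add: continuous_map)
qed

text \<open>Around a point \<open>?d\<close> of its image the section through \<open>c\<close>
  agrees with the section through \<open>?d\<close>, since both invert (range, source) on
  \<open>nbh c U V\<close>. The latter section has its values in an arbitrarily small basic
  set.\<close>

lemma continuous_chart_section:
  fixes c :: "(real \<Rightarrow> 'a) set"
  assumes "c \<in> GG" "good_open U" "good_open V" "rr c \<in> U" "ss c \<in> V"
  shows "continuous_map (top_of_set (U \<times> V)) Gtop (chart_section c U V)"
  unfolding continuous_map
proof (intro conjI allI impI)
  show "chart_section c U V ` topspace (top_of_set (U \<times> V)) \<subseteq> GG"
    using chart_section[OF assms] by auto
  fix W assume W: "openin Gtop (W :: (real \<Rightarrow> 'a) set set)"
  show "openin (top_of_set (U \<times> V)) {x \<in> topspace (top_of_set (U \<times> V)). chart_section c U V x \<in> W}"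
  proof (subst openin_subopen, intro ballI)
    fix x assume "x \<in> {x \<in> topspace (top_of_set (U \<times> V)). chart_section c U V x \<in> W}"
    then obtain u v where x: "x = (u, v)" "u \<in> U" "v \<in> V" "chart_section c U V (u, v) \<in> W" by auto
    let ?d = "chart_section c U V (u, v)"
    note d = chart_section[OF assms x(2,3)]
    obtain U1 V1 where 1: "good_open U1" "good_open V1" "U1 \<subseteq> U" "V1 \<subseteq> V" "rr ?d \<in> U1" "ss ?d \<in> V1" "nbh ?d U1 V1 \<subseteq> W"
      using nbh_base[OF W x(4), of U V] good_openD(1) assms d x by metis
    have "chart_section c U V (u1, v1) \<in> W" if "u1 \<in> U1" "v1 \<in> V1" for u1 v1
    proof -
      note e = chart_section[OF d(4) 1(1,2,5,6) that]
      have "chart_section ?d U1 V1 (u1, v1) \<in> nbh c U V"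
        using nbh_trans[OF d(1) _ assms(1)] nbh_mono[OF e(1) 1(3,4)] by blast
      from chart_section_eq[OF assms(1-3) this]
      have "chart_section c U V (u1, v1) = chart_section ?d U1 V1 (u1, v1)" using e by simp
      then show ?thesis using e 1(7) by auto
    qed
    then have "U1 \<times> V1 \<subseteq> {x \<in> topspace (top_of_set (U \<times> V)). chart_section c U V x \<in> W}"
      using 1 by auto
    moreover have "openin (top_of_set (U \<times> V)) (U1 \<times> V1)"
      using 1 by (intro open_subset open_Times good_openD(1)) auto
    ultimately show "\<exists>T. openin (top_of_set (U \<times> V)) T \<and> x \<in> T \<and>
       T \<subseteq> {x \<in> topspace (top_of_set (U \<times> V)). chart_section c U V x \<in> W}"
      using 1 x d by (intro exI[of _ "U1 \<times> V1"]) auto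
  qed
qed

text \<open>Classes with different ends are separated by the range or the source. For equal ends, if
  the two basic sets for the same \<open>U\<close>, \<open>V\<close> met, \<open>c\<close> would lie
  in the basic set of \<open>d\<close>, where a class is determined by its ends.\<close>

lemma Hausdorff_Gtop: "Hausdorff_space (Gtop :: (real \<Rightarrow> 'a) set topology)"
  unfolding Hausdorff_space_def
proof (intro allI impI)
  fix c d assume cd: "c \<in> (GG :: (real \<Rightarrow> 'a) set set) \<and> d \<in> GG \<and> c \<noteq> d"
  show "\<exists>U V. openin Gtop U \<and> openin Gtop V \<and> c \<in> U \<and> d \<in> V \<and> disjnt U V"
  proof (cases "rr c = rr d \<and> ss c = ss d")
    case False
    then obtain f where f: "f \<in> {rr, ss}" "f c \<noteq> f d" by blast
    then have cont: "continuous_map Gtop euclidean f" using continuous_rng_src by auto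
    obtain U V where UV: "open U" "open V" "f c \<in> U" "f d \<in> V" "U \<inter> V = {}"
      using hausdorff[OF f(2)] by metis
    show ?thesis
      using UV cd openin_continuous_map_preimage[OF cont]
      by (intro exI[of _ "{x \<in> GG. f x \<in> U}"] exI[of _ "{x \<in> GG. f x \<in> V}"]) (auto simp: disjnt_iff)
  next
    case True
    obtain U where U: "good_open U" "rr c \<in> U" by (rule good_open_at[of "rr c"])
    obtain V where V: "good_open V" "ss c \<in> V" by (rule good_open_at[of "ss c"])
    have "e \<notin> nbh d U V" if e: "e \<in> nbh c U V" for e
    proof
      assume e': "e \<in> nbh d U V"
      have cG: "c \<in> GG" and dG: "d \<in> GG" using cd by auto
      have "c \<in> nbh d U V"
        by (rule nbh_trans[OF e' nbh_sym[OF e cG] dG])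
      from chart_section_eq[OF dG U(1) V(1) this]
      have "chart_section d U V (rr c, ss c) = c" .
      moreover have "chart_section d U V (rr d, ss d) = d"
        by (rule chart_section_eq[OF dG U(1) V(1) nbh_self[OF dG]]) (use U V True in simp_all)
      ultimately show False using True cd by metis
    qed
    then have "disjnt (nbh c U V) (nbh d U V)" by (auto simp: disjnt_iff)
    moreover have "openin Gtop (nbh c U V)" "openin Gtop (nbh d U V)"
      using cd U V good_openD(1) by (auto intro!: openin_nbh)
    moreover have "c \<in> nbh c U V" "d \<in> nbh d U V"
      using cd U V True by (auto intro!: nbh_self)
    ultimately show ?thesis by blast
  qed
qed

lemma compact_nbhd_ex:
  fixes u :: 'a
  assumes "open W" "u \<in> W"
  obtains U K where "open U" "compact K" "u \<in> U" "U \<subseteq> K" "K \<subseteq> W"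
  using lc assms unfolding locally_def by (metis UNIV_I open_openin subtopology_UNIV)

text \<open>The section carries a product of compact neighbourhoods of the two ends to a compact
  set, which contains a basic set because the section recovers each of its members from its
  ends.\<close>

lemma locally_compact_Gtop: "locally_compact_space (Gtop :: (real \<Rightarrow> 'a) set topology)"
  unfolding locally_compact_space_def
proof
  fix c assume c: "c \<in> (GG :: (real \<Rightarrow> 'a) set set)"
  obtain U where U: "good_open U" "rr c \<in> U" by (rule good_open_at[of "rr c"])
  obtain V where V: "good_open V" "ss c \<in> V" by (rule good_open_at[of "ss c"])
  obtain U1 K where U1: "open U1" "compact K" "rr c \<in> U1" "U1 \<subseteq> K" "K \<subseteq> U"
    using compact_nbhd_ex[OF good_openD(1)] U by metis
  obtain V1 L where V1: "open V1" "compact L" "ss c \<in> V1" "V1 \<subseteq> L" "L \<subseteq> V"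
    using compact_nbhd_ex[OF good_openD(1)] V by metis
  let ?s = "chart_section c U V"
  have "compactin (top_of_set (U \<times> V)) (K \<times> L)"
    using U1 V1 by (auto simp: compactin_subtopology intro!: compact_Times)
  then have "compactin Gtop (?s ` (K \<times> L))"
    using image_compactin[OF _ continuous_chart_section] c U V by blast
  moreover have "nbh c U1 V1 \<subseteq> ?s ` (K \<times> L)"
  proof
    fix d assume d: "d \<in> nbh c U1 V1"
    then have "d = ?s (rr d, ss d)"
      using chart_section_eq[OF c U(1) V(1)] nbh_mono U1 V1 by (metis order_trans)
    then show "d \<in> ?s ` (K \<times> L)" using nbh_props[OF d c] U1 V1 by blast
  qed
  ultimately show "\<exists>U K. openin Gtop U \<and> compactin Gtop K \<and> c \<in> U \<and> U \<subseteq> K"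
    using openin_nbh c U1 V1 nbh_self by metis
qed

lemma continuous_gmult:
  "continuous_map (subtopology (prod_topology Gtop Gtop) {(c, d). ss c = rr d}) Gtop
     (\<lambda>(c :: (real \<Rightarrow> 'a) set, d). c \<bullet>\<bullet> d)"
  (is "continuous_map ?T _ _")
  unfolding continuous_map
proof (intro conjI allI impI)
  show "(\<lambda>(c, d). c \<bullet>\<bullet> d) ` topspace ?T \<subseteq> GG" by auto
  fix W assume W: "openin Gtop (W :: (real \<Rightarrow> 'a) set set)"
  show "openin ?T {x \<in> topspace ?T. (case x of (c, d) \<Rightarrow> c \<bullet>\<bullet> d) \<in> W}"
  proof (subst openin_subopen, intro ballI)
    fix x assume "x \<in> {x \<in> topspace ?T. (case x of (c, d) \<Rightarrow> c \<bullet>\<bullet> d) \<in> W}"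
    then obtain c d where x: "x = (c, d)" "c \<in> GG" "d \<in> GG" "ss c = rr d" "c \<bullet>\<bullet> d \<in> W" by auto
    obtain U V where UV: "good_open U" "good_open V" "rr (c \<bullet>\<bullet> d) \<in> U" "ss (c \<bullet>\<bullet> d) \<in> V" "nbh (c \<bullet>\<bullet> d) U V \<subseteq> W"
      using nbh_base[OF W x(5), of UNIV UNIV] by auto
    obtain D where D: "good_open D" "ss c \<in> D" by (rule good_open_at[of "ss c"])
    let ?N = "(nbh c U D \<times> nbh d D V) \<inter> {(c, d). ss c = rr d}"
    have "openin ?T ?N"
      using openin_nbh[OF x(2) good_openD(1)[OF UV(1)] good_openD(1)[OF D(1)]]
        openin_nbh[OF x(3) good_openD(1)[OF D(1)] good_openD(1)[OF UV(2)]]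
      by (intro openin_subtopology_Int) (simp add: openin_prod_Times_iff)
    moreover have "x \<in> ?N" using x UV D by (auto simp: nbh_self)
    moreover have "?N \<subseteq> {x \<in> topspace ?T. (case x of (c, d) \<Rightarrow> c \<bullet>\<bullet> d) \<in> W}"
    proof
      fix y assume "y \<in> ?N"
      then obtain c' d' where y: "y = (c', d')" "c' \<in> nbh c U D" "d' \<in> nbh d D V" "ss c' = rr d'" by auto
      have "c' \<bullet>\<bullet> d' \<in> W"
        using nbh_mult[OF D(1) y(2,3) x(2-4) y(4)] UV(5) by blast
      then show "y \<in> {x \<in> topspace ?T. (case x of (c, d) \<Rightarrow> c \<bullet>\<bullet> d) \<in> W}"
        using y nbh_props(1)[OF y(2) x(2)] nbh_props(1)[OF y(3) x(3)] by simp
    qed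
    ultimately show "\<exists>N. openin ?T N \<and> x \<in> N \<and> N \<subseteq> {x \<in> topspace ?T. (case x of (c, d) \<Rightarrow> c \<bullet>\<bullet> d) \<in> W}"
      by blast
  qed
qed

lemma closedin_rfibre: "closedin Gtop (rfibre fundamental_groupoid (u :: 'a))"
  using closedin_continuous_map_preimage[OF continuous_rng_src(1), of "{u}"]
  by (simp add: rfibre_def)

lemma continuous_left_mult:
  fixes c :: "(real \<Rightarrow> 'a) set"
  assumes c: "c \<in> GG"
  shows "continuous_map (subtopology Gtop (rfibre fundamental_groupoid (ss c))) Gtop (\<lambda>d. c \<bullet>\<bullet> d)"
proof -
  have "continuous_map (subtopology Gtop (rfibre fundamental_groupoid (ss c)))
     (subtopology (prod_topology Gtop Gtop) {(c, d). ss c = rr d}) (\<lambda>d. (c, d))"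
    using c by (auto simp: continuous_map_in_subtopology continuous_map_pairwise o_def rfibre_def
        continuous_map_from_subtopology)
  from continuous_map_compose[OF this continuous_gmult] show ?thesis by (simp add: o_def)
qed

lemma homeomorphic_left_mult:
  fixes c :: "(real \<Rightarrow> 'a) set"
  assumes c: "c \<in> GG"
  shows "homeomorphic_maps (subtopology Gtop (rfibre fundamental_groupoid (ss c)))
     (subtopology Gtop (rfibre fundamental_groupoid (rr c))) (\<lambda>d. c \<bullet>\<bullet> d) (\<lambda>d. inv_class c \<bullet>\<bullet> d)"
  using continuous_left_mult[OF c] continuous_left_mult[of "inv_class c"] c
  by (auto simp: homeomorphic_maps_def continuous_map_in_subtopology rfibre_def)

end

section \<open>Radon measures\<close>

lemma space_borel_of [simp]: "space (borel_of T) = topspace T"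
  unfolding borel_of_def by (intro space_measure_of) (auto dest: openin_subset)

lemma sets_borel_of: "sets (borel_of T) = sigma_sets (topspace T) {U. openin T U}"
  unfolding borel_of_def by (intro sets_measure_of) (auto dest: openin_subset)

lemma borel_of_open [intro]: "openin T U \<Longrightarrow> U \<in> sets (borel_of T)"
  by (simp add: sets_borel_of)

lemma borel_of_closed [intro]: "closedin T C \<Longrightarrow> C \<in> sets (borel_of T)"
  using sets.compl_sets[OF borel_of_open[of T "topspace T - C"]]
  by (simp add: closedin_def double_diff)

lemma measurable_borel_ofI:
  assumes "f \<in> space M \<rightarrow> topspace T" "\<And>U. openin T U \<Longrightarrow> f -` U \<inter> space M \<in> sets M"
  shows "f \<in> measurable M (borel_of T)"
  unfolding borel_of_def
  by (rule measurable_measure_of) (use assms in \<open>auto dest: openin_subset\<close>)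

lemma radon_measureD:
  assumes "radon_measure T M"
  shows "sets M = sets (borel_of T)" "space M = topspace T"
    "\<And>K. compactin T K \<Longrightarrow> emeasure M K < \<infinity>"
    "\<And>A. A \<in> sets (borel_of T) \<Longrightarrow> emeasure M A = (INF U\<in>{U. openin T U \<and> A \<subseteq> U}. emeasure M U)"
    "\<And>U. openin T U \<Longrightarrow> emeasure M U = (SUP K\<in>{K. compactin T K \<and> K \<subseteq> U}. emeasure M K)"
    "\<And>U. openin T U \<Longrightarrow> U \<in> sets M" "\<And>C. closedin T C \<Longrightarrow> C \<in> sets M"
proof -
  show 1: "sets M = sets (borel_of T)" using assms by (simp add: radon_measure_def)
  from sets_eq_imp_space_eq[OF this] show "space M = topspace T" by simp
qed (use assms in \<open>auto simp: radon_measure_def\<close>)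

lemma radon_measure_unique:
  assumes M: "radon_measure T M" and N: "radon_measure T N"
    and eq: "\<And>U. openin T U \<Longrightarrow> emeasure M U = emeasure N U"
  shows "M = N"
proof (rule measure_eqI)
  show "sets M = sets N" using radon_measureD(1)[OF M] radon_measureD(1)[OF N] by simp
  fix A assume "A \<in> sets M"
  then show "emeasure M A = emeasure N A"
    using radon_measureD(1,4)[OF M] radon_measureD(4)[OF N] eq by (auto intro: INF_cong)
qed

section \<open>From a content on compact sets to a Radon measure\<close>

lemma locally_compact_Hausdorff_nbhd:
  assumes "Hausdorff_space T" "locally_compact_space T" "openin T W" "p \<in> W"
  obtains U C where "openin T U" "compactin T C" "p \<in> U" "U \<subseteq> C" "C \<subseteq> W"
  using locally_compact_imp_neighbourhood_base[OF assms(2)] locally_compact_Hausdorff_imp_regular_space assms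
  unfolding neighbourhood_base_of by metis

lemma compactin_pointwise_subcover:
  assumes "compactin T K" "\<And>c. c \<in> K \<Longrightarrow> openin T (Q c) \<and> c \<in> Q c"
  obtains P where "finite P" "P \<subseteq> K" "K \<subseteq> \<Union>(Q ` P)"
proof -
  have "\<exists>\<F>. finite \<F> \<and> \<F> \<subseteq> Q ` K \<and> K \<subseteq> \<Union>\<F>"
    by (rule compactinD[OF assms(1)]) (use assms(2) in auto)
  then obtain \<F> where \<F>: "finite \<F>" "\<F> \<subseteq> Q ` K" "K \<subseteq> \<Union>\<F>" by blast
  from finite_subset_image[OF \<F>(1,2)] obtain P where "P \<subseteq> K" "finite P" "\<F> = Q ` P" by blast
  then show ?thesis using that \<F>(3) by blast
qed

text \<open>Regularity of \<open>cont\<close> is not among the axioms, so the measure obtained may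
  exceed \<open>cont\<close> on compact sets. Its values are therefore prescribed on open sets
  only.\<close>

locale radon_content =
  fixes T :: "'a topology" and cont :: "'a set \<Rightarrow> ennreal"
  assumes Hausdorff: "Hausdorff_space T" and lc: "locally_compact_space T"
    and mono: "compactin T K \<Longrightarrow> compactin T L \<Longrightarrow> K \<subseteq> L \<Longrightarrow> cont K \<le> cont L"
    and subadd: "compactin T K \<Longrightarrow> compactin T L \<Longrightarrow> cont (K \<union> L) \<le> cont K + cont L"
    and add: "compactin T K \<Longrightarrow> compactin T L \<Longrightarrow> K \<inter> L = {} \<Longrightarrow> cont K + cont L \<le> cont (K \<union> L)"
    and fin: "compactin T K \<Longrightarrow> cont K < \<infinity>"
begin

definition on_open :: "'a set \<Rightarrow> ennreal" where
  "on_open U = (SUP K\<in>{K. compactin T K \<and> K \<subseteq> U}. cont K)"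

definition outer :: "'a set \<Rightarrow> ennreal" where
  "outer A = (INF U\<in>{U. openin T U \<and> A \<subseteq> U}. on_open U)"

lemma cont_empty: "cont {} = 0"
proof -
  have "cont {} + cont {} \<le> cont {}" using add[of "{}" "{}"] by simp
  moreover have "cont {} < \<infinity>" using fin[of "{}"] by simp
  ultimately show ?thesis by (cases "cont {}") (auto simp flip: ennreal_plus)
qed

lemma cont_UN_le:
  assumes "finite I" "\<And>i. i \<in> I \<Longrightarrow> compactin T (F i)"
  shows "cont (\<Union>i\<in>I. F i) \<le> (\<Sum>i\<in>I. cont (F i))"
  using assms
proof (induction I rule: finite_induct)
  case (insert i I)
  have "compactin T (\<Union>i\<in>I. F i)" using insert by (intro compactin_Union) auto
  then have "cont (F i \<union> (\<Union>i\<in>I. F i)) \<le> cont (F i) + cont (\<Union>i\<in>I. F i)"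
    using insert by (intro subadd) auto
  also have "\<dots> \<le> cont (F i) + (\<Sum>i\<in>I. cont (F i))" using insert by (intro add_left_mono) auto
  finally show ?case using insert by simp
qed (simp add: cont_empty)

lemma on_open_mono: "U \<subseteq> V \<Longrightarrow> on_open U \<le> on_open V"
  unfolding on_open_def by (rule SUP_subset_mono) auto

lemma cont_le_on_open: "compactin T K \<Longrightarrow> K \<subseteq> U \<Longrightarrow> cont K \<le> on_open U"
  unfolding on_open_def by (rule SUP_upper) auto

lemma outer_open: "openin T U \<Longrightarrow> outer U = on_open U"
  unfolding outer_def by (rule antisym) (auto intro: INF_lower INF_greatest on_open_mono)

lemma outer_mono: "A \<subseteq> B \<Longrightarrow> outer A \<le> outer B"
  unfolding outer_def by (rule INF_superset_mono) auto

lemma outer_le: "openin T U \<Longrightarrow> A \<subseteq> U \<Longrightarrow> outer A \<le> on_open U"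
  unfolding outer_def by (rule INF_lower) auto

text \<open>Each point of a compact \<open>K\<close> has a compact neighbourhood inside a single
  \<open>W n\<close>. Finitely many of them cut \<open>K\<close> into compact pieces
  \<open>F i \<subseteq> W i\<close>, and finite subadditivity of the content suffices.\<close>

lemma on_open_UN_le:
  assumes W: "\<And>n. openin T (W n)"
  shows "on_open (\<Union>n::nat. W n) \<le> (\<Sum>n. on_open (W n))"
  unfolding on_open_def[of "\<Union>n. W n"]
proof (rule SUP_least, clarify)
  fix K assume K: "compactin T K" "K \<subseteq> (\<Union>n. W n)"
  have "\<exists>n U C. openin T U \<and> compactin T C \<and> p \<in> U \<and> U \<subseteq> C \<and> C \<subseteq> W n" if "p \<in> K" for p
    using that K(2) locally_compact_Hausdorff_nbhd[OF Hausdorff lc W] by (metis UN_iff subsetD)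
  then obtain n U C where UC: "\<And>p. p \<in> K \<Longrightarrow> openin T (U p) \<and> compactin T (C p) \<and> p \<in> U p \<and> U p \<subseteq> C p \<and> C p \<subseteq> W (n p)"
    by metis
  obtain P where P: "finite P" "P \<subseteq> K" "K \<subseteq> \<Union>(U ` P)"
    by (rule compactin_pointwise_subcover[OF K(1), of U]) (use UC in auto)
  define F where "F i = K \<inter> (\<Union>p\<in>{p\<in>P. n p = i}. C p)" for i
  have F: "compactin T (F i)" "F i \<subseteq> W i" for i
  proof -
    have "compactin T (\<Union>p\<in>{p\<in>P. n p = i}. C p)"
      using P UC by (intro compactin_Union) auto
    then show "compactin T (F i)" unfolding F_def using K(1) Hausdorff by (intro compactin_Int) 
    show "F i \<subseteq> W i" unfolding F_def using P UC by blast
  qed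
  have "K = (\<Union>i\<in>n ` P. F i)"
  proof
    show "K \<subseteq> (\<Union>i\<in>n ` P. F i)"
    proof
      fix x assume "x \<in> K"
      then obtain p where "p \<in> P" "x \<in> U p" using P(3) by auto
      then have "x \<in> F (n p)" using UC[of p] P(2) \<open>x \<in> K\<close> unfolding F_def by auto
      then show "x \<in> (\<Union>i\<in>n ` P. F i)" using \<open>p \<in> P\<close> by blast
    qed
  qed (auto simp: F_def)
  then have "cont K \<le> (\<Sum>i\<in>n ` P. cont (F i))"
    using cont_UN_le[of "n ` P" F] F P by simp
  also have "\<dots> \<le> (\<Sum>i\<in>n ` P. on_open (W i))"
    by (intro sum_mono cont_le_on_open F)
  also have "\<dots> \<le> (\<Sum>n. on_open (W n))"
    using P by (intro sum_le_suminf) auto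
  finally show "cont K \<le> (\<Sum>n. on_open (W n))" .
qed

lemma outer_countably_subadditive: "countably_subadditive (Pow (topspace T)) outer"
  unfolding countably_subadditive_def
proof (intro allI impI)
  fix A :: "nat \<Rightarrow> 'a set"
  show "outer (\<Union>i. A i) \<le> (\<Sum>i. outer (A i))"
  proof (rule ennreal_le_epsilon)
    fix e :: real assume e: "0 < e" and top: "(\<Sum>i. outer (A i)) < top"
    have "\<exists>U\<in>{U. openin T U \<and> A i \<subseteq> U}. on_open U < outer (A i) + ennreal (e * (1/2) ^ Suc i)" for i
    proof (rule INF_approx_ennreal)
      show "outer (A i) \<noteq> \<infinity>" using ennreal_suminf_lessD[OF top, of i] by simp
    qed (use e outer_def in auto)
    then obtain U where U: "\<And>i. openin T (U i)" "\<And>i. A i \<subseteq> U i"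
      "\<And>i. on_open (U i) < outer (A i) + ennreal (e * (1/2) ^ Suc i)"
      by simp metis
    have half: "ennreal (e * (1/2) ^ Suc i) = ennreal e * ennreal ((1/2) ^ Suc i)" for i
      by (rule ennreal_mult) (use e in auto)
    have "outer (\<Union>i. A i) \<le> on_open (\<Union>i. U i)" using U by (intro outer_le) auto
    also have "\<dots> \<le> (\<Sum>i. on_open (U i))" by (rule on_open_UN_le[OF U(1)])
    also have "\<dots> \<le> (\<Sum>n. outer (A n) + ennreal e * ennreal ((1/2) ^ Suc n))"
      by (intro suminf_le less_imp_le[OF U(3)[unfolded half]] summableI)
    also have "\<dots> = (\<Sum>n. outer (A n)) + (\<Sum>n. ennreal e * ennreal ((1/2) ^ Suc n))"
      by (rule suminf_add[symmetric]) auto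
    also have "\<dots> = (\<Sum>n. outer (A n)) + e"
      unfolding ennreal_suminf_cmult
      by (subst suminf_ennreal_eq[OF zero_le_power power_half_series]) auto
    finally show "outer (\<Union>i. A i) \<le> (\<Sum>n. outer (A n)) + e" .
  qed
qed

lemma outer_empty: "outer {} = 0"
  by (simp add: outer_open on_open_def cont_empty compactin_empty cong: conj_cong)

lemma outer_space: "outer_measure_space (Pow (topspace T)) outer"
  unfolding outer_measure_space_def
  by (simp add: outer_countably_subadditive positive_def outer_empty increasing_def outer_mono)

lemma outer_Un_le:
  assumes "A \<subseteq> topspace T" "B \<subseteq> topspace T" "A \<inter> B = {}"
  shows "outer (A \<union> B) \<le> outer A + outer B"
proof -
  have "subadditive (Pow (topspace T)) outer"
    by (rule ring_of_sets.countably_subadditive_subadditive[OF ring_of_sets_Pow _ outer_countably_subadditive])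
      (simp add: positive_def outer_empty)
  then show ?thesis using assms by (simp add: subadditive_def)
qed

text \<open>Inside an open \<open>W\<close> containing \<open>X\<close>, exhaust
  \<open>W \<inter> U\<close> by compact \<open>K\<close> and then the open set \<open>W - K\<close>
  by compact \<open>L\<close>. The two are disjoint, so superadditivity bounds the sum of their
  contents by \<open>on_open W\<close>. The part \<open>X - U\<close> lies in \<open>W - K\<close>
  whatever \<open>K\<close> is.\<close>

lemma open_in_lambda:
  assumes U: "openin T U"
  shows "U \<in> lambda_system (topspace T) (Pow (topspace T)) outer"
proof -
  have "outer (X \<inter> U) + outer (X - U) = outer X" if X: "X \<subseteq> topspace T" for X
  proof (rule antisym)
    have "outer ((X \<inter> U) \<union> (X - U)) \<le> outer (X \<inter> U) + outer (X - U)"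
      using X by (intro outer_Un_le) auto
    then show "outer X \<le> outer (X \<inter> U) + outer (X - U)"
      by (simp add: Int_Diff_Un)
    show "outer (X \<inter> U) + outer (X - U) \<le> outer X"
      unfolding outer_def[of X]
    proof (rule INF_greatest, clarify)
      fix W assume W: "openin T W" "X \<subseteq> W"
      have "cont K + on_open (W - K) \<le> on_open W" if K: "compactin T K" "K \<subseteq> W \<inter> U" for K
      proof -
        have "cont K + cont L \<le> on_open W" if L: "compactin T L" "L \<subseteq> W - K" for L
        proof -
          have "cont K + cont L \<le> cont (K \<union> L)" using K L by (intro add) auto
          also have "\<dots> \<le> on_open W" using K L by (intro cont_le_on_open compactin_Un) auto
          finally show ?thesis .
        qed
        moreover have "{L. compactin T L \<and> L \<subseteq> W - K} \<noteq> {}"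
          using compactin_empty by blast
        ultimately show ?thesis
          unfolding on_open_def[of "W - K"] by (subst ennreal_SUP_add_right) (auto intro: SUP_least)
      qed
      moreover have "outer (X - U) \<le> on_open (W - K)" if K: "compactin T K" "K \<subseteq> W \<inter> U" for K
      proof (rule outer_le)
        show "openin T (W - K)" using W K compactin_imp_closedin[OF Hausdorff] by blast
      qed (use W K in blast)
      ultimately have *: "cont K + outer (X - U) \<le> on_open W" if "compactin T K" "K \<subseteq> W \<inter> U" for K
        using that by (meson add_left_mono order_trans)
      have ne: "{K. compactin T K \<and> K \<subseteq> W \<inter> U} \<noteq> {}"
        using compactin_empty by blast
      have "outer (X \<inter> U) + outer (X - U) \<le> on_open (W \<inter> U) + outer (X - U)"
        using W U by (intro add_right_mono outer_le) auto
      also have "\<dots> = (SUP K\<in>{K. compactin T K \<and> K \<subseteq> W \<inter> U}. cont K + outer (X - U))"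
        unfolding on_open_def using ennreal_SUP_add_left[OF ne] by metis
      also have "\<dots> \<le> on_open W" using * by (auto intro: SUP_least)
      finally show "outer (X \<inter> U) + outer (X - U) \<le> on_open W" .
    qed
  qed
  then show ?thesis
    using openin_subset[OF U] by (simp add: algebra.lambda_system_eq[OF algebra_Pow])
qed

theorem radon_measure_exists:
  obtains M where "radon_measure T M"
    "\<And>U. openin T U \<Longrightarrow> emeasure M U = (SUP K\<in>{K. compactin T K \<and> K \<subseteq> U}. cont K)"
proof -
  let ?L = "lambda_system (topspace T) (Pow (topspace T)) outer"
  have L: "measure_space (topspace T) ?L outer"
    using sigma_algebra.caratheodory_lemma[OF sigma_algebra_Pow outer_space] .
  then have "sigma_sets (topspace T) {U. openin T U} \<subseteq> ?L"
    using open_in_lambda by (intro sigma_algebra.sigma_sets_subset) (auto simp: measure_space_def)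
  then have ms: "measure_space (topspace T) (sigma_sets (topspace T) {U. openin T U}) outer"
    using openin_subset by (intro measure_down[OF L sigma_algebra_sigma_sets]) auto
  define M where "M = measure_of (topspace T) {U. openin T U} outer"
  have sub: "{U. openin T U} \<subseteq> Pow (topspace T)" using openin_subset by auto
  have sets: "sets M = sets (borel_of T)"
    unfolding M_def sets_borel_of by (rule sets_measure_of[OF sub])
  have em: "emeasure M A = outer A" if "A \<in> sets (borel_of T)" for A
  proof (rule emeasure_measure_of[OF M_def sub])
    show "A \<in> sets M" using that sets by simp
    show "positive (sets M) outer" "countably_additive (sets M) outer"
      using ms unfolding measure_space_def sets sets_borel_of by auto
  qed
  have em_open: "emeasure M U = on_open U" if "openin T U" for U
    using em[OF borel_of_open[OF that]] outer_open[OF that] by simp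
  have K_sets: "K \<in> sets (borel_of T)" if "compactin T K" for K
    using compactin_imp_closedin[OF Hausdorff that] by blast
  \<comment> \<open>This one-sided estimate suffices for inner regularity: the value on an open set
    is a supremum of contents, each at most the measure of a compact subset.\<close>
  have cont_le: "cont K \<le> emeasure M K" if "compactin T K" for K
    unfolding em[OF K_sets[OF that]] outer_def using that by (auto intro!: INF_greatest cont_le_on_open)
  have "radon_measure T M"
    unfolding radon_measure_def
  proof (intro conjI ballI allI impI)
    show "sets M = sets (borel_of T)" by (rule sets)
  next
    fix K assume K: "compactin T K"
    \<comment> \<open>Since the measure of \<open>K\<close> may exceed \<open>cont K\<close>,
      finiteness is read off from a larger compact set \<open>C\<close> with an open set in
      between.\<close>
    obtain U C where UC: "openin T U" "compactin T C" "K \<subseteq> U" "U \<subseteq> C"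
      using K lc Hausdorff locally_compact_space_compact_closed_compact by metis
    have "emeasure M K \<le> emeasure M U" using UC sets by (intro emeasure_mono) auto
    also have "\<dots> = on_open U" by (rule em_open[OF UC(1)])
    also have "\<dots> \<le> cont C" unfolding on_open_def using UC by (auto intro!: SUP_least mono)
    also have "\<dots> < \<infinity>" by (rule fin[OF UC(2)])
    finally show "emeasure M K < \<infinity>" .
  next
    fix A assume "A \<in> sets M"
    then show "emeasure M A = (INF U\<in>{U. openin T U \<and> A \<subseteq> U}. emeasure M U)"
      using em[of A] em_open sets unfolding outer_def by (auto intro!: INF_cong)
  next
    fix U assume U: "openin T U"
    show "emeasure M U = (SUP K\<in>{K. compactin T K \<and> K \<subseteq> U}. emeasure M K)"
    proof (rule antisym)
      show "emeasure M U \<le> (SUP K\<in>{K. compactin T K \<and> K \<subseteq> U}. emeasure M K)"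
        unfolding em_open[OF U] on_open_def using cont_le by (intro SUP_mono) auto
      show "(SUP K\<in>{K. compactin T K \<and> K \<subseteq> U}. emeasure M K) \<le> emeasure M U"
        using U sets by (auto intro!: SUP_least emeasure_mono)
    qed
  qed
  then show ?thesis using that em_open unfolding on_open_def by blast
qed

end

section \<open>Measures concentrated on closed sets and their transfer\<close>

lemma radon_null_outside_support:
  assumes M: "radon_measure T M" and E: "measure_support T M = E" "closedin T E"
  shows "emeasure M (topspace T - E) = 0"
proof -
  have U: "openin T (topspace T - E)" using E by auto
  \<comment> \<open>The null open sets may form an uncountable family. Inner regularity reduces the
    claim to compact sets, which finitely many of them cover.\<close>
  have "emeasure M K = 0" if K: "compactin T K" "K \<subseteq> topspace T - E" for K
  proof -
    have "\<exists>V. openin T V \<and> p \<in> V \<and> emeasure M V = 0" if "p \<in> K" for p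
      using that K E unfolding measure_support_def by (auto simp: zero_less_iff_neq_zero)
    then obtain V where V: "\<And>p. p \<in> K \<Longrightarrow> openin T (V p) \<and> p \<in> V p \<and> emeasure M (V p) = 0"
      by metis
    obtain P where P: "finite P" "P \<subseteq> K" "K \<subseteq> \<Union>(V ` P)"
      by (rule compactin_pointwise_subcover[OF K(1), of V]) (use V in auto)
    have VM: "V p \<in> sets M" if "p \<in> P" for p using V P that radon_measureD(6)[OF M] by blast
    have "emeasure M K \<le> emeasure M (\<Union>p\<in>P. V p)" using P VM by (intro emeasure_mono) auto
    also have "\<dots> \<le> (\<Sum>p\<in>P. emeasure M (V p))"
      using VM P by (intro emeasure_subadditive_finite) auto
    also have "\<dots> = 0" using V P by (intro sum.neutral) auto
    finally show ?thesis by simp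
  qed
  then show ?thesis unfolding radon_measureD(5)[OF M U] by (auto intro!: SUP_eq_const simp: bot_ennreal)
qed

lemma radon_Int_full:
  assumes M: "radon_measure T M" and null: "emeasure M (topspace T - E) = 0" and E: "closedin T E"
    and W: "openin T W"
  shows "emeasure M (W \<inter> E) = emeasure M W"
proof -
  have WM: "W \<in> sets M" and EM: "E \<in> sets M" and oM: "topspace T - E \<in> sets M"
    using W E radon_measureD(6,7)[OF M] by blast+
  have "emeasure M (W - E) \<le> emeasure M (topspace T - E)"
    using openin_subset[OF W] oM by (intro emeasure_mono) auto
  then have "emeasure M (W - E) = 0" using null by simp
  moreover have "emeasure M W = emeasure M (W \<inter> E) + emeasure M (W - E)"
    using WM EM by (subst plus_emeasure) (auto simp: Int_Diff_Un)
  ultimately show ?thesis by simp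
qed

text \<open>A homeomorphism between closed subsets pushes a measure concentrated on one of them to
  the other ambient space and preserves all regularity. It serves both for left multiplication
  between range fibres and for passing from a fibre in the groupoid to the fibre as a space of its
  own.\<close>

lemma radon_transfer:
  assumes M: "radon_measure T M" and null: "emeasure M (topspace T - E) = 0" and E: "closedin T E"
    and E': "closedin T' E'"
    and hom: "homeomorphic_maps (subtopology T E) (subtopology T' E') h h'"
    and T': "Hausdorff_space T'"
  defines "N \<equiv> distr (restrict_space M E) (borel_of T') h"
  shows "radon_measure T' N" "h \<in> measurable (restrict_space M E) (borel_of T')"
    "\<And>B. B \<in> sets (borel_of T') \<Longrightarrow> emeasure N B = emeasure M (h -` B \<inter> E)"
    "\<And>B. B \<in> sets (borel_of T') \<Longrightarrow> h -` B \<inter> E \<in> sets M"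
    "\<And>U. openin T' U \<Longrightarrow> \<exists>W. openin T W \<and> h -` U \<inter> E = W \<inter> E"
    "\<And>W. openin T W \<Longrightarrow> \<exists>U. openin T' U \<and> h -` U \<inter> E = W \<inter> E"
proof -
  have ET: "E \<subseteq> topspace T" "E' \<subseteq> topspace T'" using E E' closedin_subset by auto
  have EM: "E \<in> sets M" using E radon_measureD(7)[OF M] by blast
  have oM: "topspace T - E \<in> sets M" using E radon_measureD(6)[OF M] by blast
  have tE: "topspace (subtopology T E) = E" "topspace (subtopology T' E') = E'" using ET by auto
  note sp = radon_measureD(2)[OF M]
  have ch: "continuous_map (subtopology T E) (subtopology T' E') h"
    and ch': "continuous_map (subtopology T' E') (subtopology T E) h'"
    and hh: "\<And>x. x \<in> E \<Longrightarrow> h' (h x) = x" "\<And>y. y \<in> E' \<Longrightarrow> h (h' y) = y"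
    using hom tE by (auto simp: homeomorphic_maps_def)
  have hE: "\<And>x. x \<in> E \<Longrightarrow> h x \<in> E'" "\<And>y. y \<in> E' \<Longrightarrow> h' y \<in> E"
    using continuous_map_image_subset_topspace[OF ch] continuous_map_image_subset_topspace[OF ch'] tE by auto
  show pre: "\<exists>W. openin T W \<and> h -` U \<inter> E = W \<inter> E" if "openin T' U" for U
  proof -
    have "openin (subtopology T E) {x \<in> topspace (subtopology T E). h x \<in> U \<inter> E'}"
      using that by (intro openin_continuous_map_preimage[OF ch] openin_subtopology_Int)
    then obtain W where W: "openin T W" "{x \<in> E. h x \<in> U \<inter> E'} = W \<inter> E"
      unfolding openin_subtopology tE by auto
    moreover have "h -` U \<inter> E = {x \<in> E. h x \<in> U \<inter> E'}" using hE by auto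
    ultimately show ?thesis by auto
  qed
  show img: "\<exists>U. openin T' U \<and> h -` U \<inter> E = W \<inter> E" if "openin T W" for W
  proof -
    have "openin (subtopology T' E') {x \<in> topspace (subtopology T' E'). h' x \<in> W \<inter> E}"
      using that by (intro openin_continuous_map_preimage[OF ch'] openin_subtopology_Int)
    then obtain U where U: "openin T' U" "{x \<in> E'. h' x \<in> W \<inter> E} = U \<inter> E'"
      unfolding openin_subtopology tE by auto
    have "x \<in> W \<longleftrightarrow> h x \<in> U" if "x \<in> E" for x
      using U(2) hE(1)[of x] hh(1)[OF that] that by (metis (mono_tags, lifting) Int_iff mem_Collect_eq)
    then show ?thesis using U by (intro exI[of _ U]) auto
  qed
  have spE: "space (restrict_space M E) = E" using ET sp by (auto simp: space_restrict_space)
  show meas: "h \<in> measurable (restrict_space M E) (borel_of T')"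
  proof (rule measurable_borel_ofI)
    show "h \<in> space (restrict_space M E) \<rightarrow> topspace T'" using spE hE ET by auto
    fix U assume U: "openin T' U"
    obtain W where W: "openin T W" "h -` U \<inter> E = W \<inter> E" using pre[OF U] by blast
    then have "W \<in> sets M" using radon_measureD(6)[OF M] by blast
    then show "h -` U \<inter> space (restrict_space M E) \<in> sets (restrict_space M E)"
      unfolding spE W(2) sets_restrict_space by (auto simp: Int_commute)
  qed
  show preM: "h -` B \<inter> E \<in> sets M" if "B \<in> sets (borel_of T')" for B
    using measurable_sets[OF meas that] EM unfolding spE by (simp add: sets_restrict_space_iff)
  show eN: "emeasure N B = emeasure M (h -` B \<inter> E)" if "B \<in> sets (borel_of T')" for B
    unfolding N_def using that meas EM spE
    by (simp add: emeasure_distr emeasure_restrict_space)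
  have setsN: "sets N = sets (borel_of T')" by (simp add: N_def)
  have K_sets: "K \<in> sets (borel_of T')" if "compactin T' K" for K
    using compactin_imp_closedin[OF T' that] by blast
  note openE = radon_Int_full[OF M null E]
  show "radon_measure T' N"
    unfolding radon_measure_def
  proof (intro conjI ballI allI impI)
    show "sets N = sets (borel_of T')" by (rule setsN)
  next
    fix K assume K: "compactin T' K"
    have "compactin (subtopology T' E') (K \<inter> E')"
      using K E' by (simp add: compactin_subtopology Int_commute closed_Int_compactin)
    from image_compactin[OF this ch'] have "compactin T (h' ` (K \<inter> E'))"
      by (simp add: compactin_subtopology)
    moreover have "h -` K \<inter> E = h' ` (K \<inter> E')" using hE hh by force
    ultimately show "emeasure N K < \<infinity>" using eN[OF K_sets[OF K]] radon_measureD(3)[OF M] by simp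
  next
    fix A assume "A \<in> sets N"
    then have A: "A \<in> sets (borel_of T')" using setsN by simp
    have eq: "emeasure N A = (INF U\<in>{U. openin T U \<and> h -` A \<inter> E \<subseteq> U}. emeasure M U)"
      unfolding eN[OF A] by (rule radon_measureD(4)[OF M]) (use preM[OF A] radon_measureD(1)[OF M] in simp)
    show "emeasure N A = (INF U\<in>{U. openin T' U \<and> A \<subseteq> U}. emeasure N U)"
    proof (rule antisym)
      show "emeasure N A \<le> (INF U\<in>{U. openin T' U \<and> A \<subseteq> U}. emeasure N U)"
        using setsN by (auto intro!: INF_greatest emeasure_mono)
      show "(INF U\<in>{U. openin T' U \<and> A \<subseteq> U}. emeasure N U) \<le> emeasure N A"
      proof (rule ord_le_eq_trans[OF INF_greatest eq[symmetric]])
        fix W assume "W \<in> {U. openin T U \<and> h -` A \<inter> E \<subseteq> U}"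
        then have W: "openin T W" "h -` A \<inter> E \<subseteq> W" by auto
        obtain U0 where U0: "openin T' U0" "h -` U0 \<inter> E = W \<inter> E" using img[OF W(1)] by blast
        \<comment> \<open>The complement of \<open>E'\<close> has no mass under \<open>N\<close>.
          Adding it makes \<open>U\<close> contain also the points of \<open>A\<close> outside
          \<open>E'\<close>, which the preimage does not see.\<close>
        define U where "U = U0 \<union> (topspace T' - E')"
        have U: "openin T' U" unfolding U_def using U0 E' by auto
        have "A \<subseteq> U"
        proof
          fix a assume a: "a \<in> A"
          have aT: "a \<in> topspace T'" using a sets.sets_into_space[OF A] by auto
          show "a \<in> U"
          proof (cases "a \<in> E'")
            case True
            then have "h' a \<in> h -` A \<inter> E" using a hE hh by auto
            then have "h' a \<in> W \<inter> E" using W by blast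
            then have "h (h' a) \<in> U0" unfolding U0(2)[symmetric] by blast
            then show ?thesis using True hh by (simp add: U_def)
          qed (use aT in \<open>simp add: U_def\<close>)
        qed
        then have "(INF U\<in>{U. openin T' U \<and> A \<subseteq> U}. emeasure N U) \<le> emeasure N U"
          using U by (intro INF_lower) auto
        also have "\<dots> = emeasure M (h -` U \<inter> E)" using eN U by blast
        also have "h -` U \<inter> E = W \<inter> E" using U0(2) hE by (auto simp: U_def)
        also have "emeasure M (W \<inter> E) \<le> emeasure M W"
          using W radon_measureD(6)[OF M] by (intro emeasure_mono) auto
        finally show "(INF U\<in>{U. openin T' U \<and> A \<subseteq> U}. emeasure N U) \<le> emeasure M W" .
      qed
    qed
  next
    fix U assume U: "openin T' U"
    obtain W where W: "openin T W" "h -` U \<inter> E = W \<inter> E" using pre[OF U] by blast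
    show "emeasure N U = (SUP K\<in>{K. compactin T' K \<and> K \<subseteq> U}. emeasure N K)"
    proof (rule antisym)
      show "(SUP K\<in>{K. compactin T' K \<and> K \<subseteq> U}. emeasure N K) \<le> emeasure N U"
        using U setsN by (auto intro!: SUP_least emeasure_mono)
      have "emeasure N U = emeasure M W" using eN[of U] U W openE by auto
      also have "\<dots> = (SUP K\<in>{K. compactin T K \<and> K \<subseteq> W}. emeasure M K)" by (rule radon_measureD(5)[OF M W(1)])
      also have "\<dots> \<le> (SUP K\<in>{K. compactin T' K \<and> K \<subseteq> U}. emeasure N K)"
      proof (rule SUP_least, clarify)
        fix K assume K: "compactin T K" "K \<subseteq> W"
        have "compactin (subtopology T E) (K \<inter> E)"
          using K E by (simp add: compactin_subtopology Int_commute closed_Int_compactin)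
        from image_compactin[OF this ch] have c: "compactin T' (h ` (K \<inter> E))"
          by (simp add: compactin_subtopology)
        \<comment> \<open>Besides injectivity this yields measurability: \<open>T\<close> is not
          taken to be Hausdorff, and \<open>K \<inter> E\<close> is Borel as the preimage of a
          compact set in the Hausdorff space \<open>T'\<close>.\<close>
        have inj: "h -` h ` (K \<inter> E) \<inter> E = K \<inter> E"
        proof
          show "h -` h ` (K \<inter> E) \<inter> E \<subseteq> K \<inter> E" using hh(1) by (auto, metis)
        qed auto
        have Uk: "h ` (K \<inter> E) \<subseteq> U" using K W by blast
        have "emeasure M K \<le> emeasure M ((K \<inter> E) \<union> (topspace T - E))"
          using inj preM[OF K_sets[OF c]] oM compactin_subset_topspace[OF K(1)]
          by (intro emeasure_mono) auto
        also have "\<dots> \<le> emeasure M (K \<inter> E) + emeasure M (topspace T - E)"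
          using inj preM[OF K_sets[OF c]] oM by (intro emeasure_subadditive) auto
        also have "\<dots> = emeasure N (h ` (K \<inter> E))" using null eN[OF K_sets[OF c]] inj by simp
        also have "\<dots> \<le> (SUP K\<in>{K. compactin T' K \<and> K \<subseteq> U}. emeasure N K)"
          using c Uk by (intro SUP_upper) auto
        finally show "emeasure M K \<le> (SUP K\<in>{K. compactin T' K \<and> K \<subseteq> U}. emeasure N K)" .
      qed
      finally show "emeasure N U \<le> (SUP K\<in>{K. compactin T' K \<and> K \<subseteq> U}. emeasure N K)" .
    qed
  qed
qed

section \<open>Test functions of compact support and uniqueness of Radon measures\<close>

lemma continuous_map_borel_measurable:
  fixes f :: "'a \<Rightarrow> 'b::topological_space"
  assumes "continuous_map T euclidean f" "sets M = sets (borel_of T)"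
  shows "f \<in> borel_measurable M"
proof (rule borel_measurableI)
  fix S :: "'b set" assume "open S"
  then have "openin T {x \<in> topspace T. f x \<in> S}"
    using openin_continuous_map_preimage[OF assms(1)] by simp
  moreover have "space M = topspace T" using sets_eq_imp_space_eq[OF assms(2)] by simp
  ultimately show "f -` S \<inter> space M \<in> sets M"
    unfolding assms(2) by (auto simp: vimage_def Int_def conj_commute intro!: borel_of_open)
qed

lemma Cc_borel_measurable: "f \<in> Cc T \<Longrightarrow> f \<in> borel_measurable (borel_of T)"
  by (rule continuous_map_borel_measurable) (auto simp: Cc_def)

lemma CcE:
  assumes "f \<in> Cc T" "Hausdorff_space T"
  obtains C B where "continuous_map T euclidean f" "compactin T C" "closedin T C" "0 \<le> B"
    "\<And>x. x \<in> topspace T \<Longrightarrow> x \<notin> C \<Longrightarrow> f x = 0" "\<And>x. x \<in> topspace T \<Longrightarrow> norm (f x) \<le> B"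
proof -
  define C where "C = T closure_of {x \<in> topspace T. f x \<noteq> 0}"
  have f: "continuous_map T euclidean f" "compactin T C" using assms(1) by (auto simp: Cc_def C_def)
  have z: "f x = 0" if "x \<in> topspace T" "x \<notin> C" for x
    using that closure_of_subset[of "{x \<in> topspace T. f x \<noteq> 0}" T] unfolding C_def by blast
  have "compact (f ` C)" using image_compactin[OF f(2,1)] by simp
  then obtain B where B: "\<And>x. x \<in> C \<Longrightarrow> norm (f x) \<le> B"
    using compact_imp_bounded bounded_iff by (metis imageI)
  have "norm (f x) \<le> max B 0" if "x \<in> topspace T" for x
    using B[of x] z[OF that] by (cases "x \<in> C") auto
  then show ?thesis
    using that[OF f compactin_imp_closedin[OF assms(2) f(2)], of "max B 0"] z by simp
qed

lemma radon_integrable_compact_support: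
  fixes f :: "'a \<Rightarrow> complex"
  assumes M: "radon_measure T M" and f: "f \<in> borel_measurable M" and C: "compactin T C" "closedin T C"
    and z: "\<And>x. x \<in> topspace T \<Longrightarrow> x \<notin> C \<Longrightarrow> f x = 0" and B: "\<And>x. x \<in> topspace T \<Longrightarrow> norm (f x) \<le> B"
  shows "integrable M f"
proof (rule integrableI_bounded_set[of C _ _ B])
  show "C \<in> sets M" using C radon_measureD(7)[OF M] by blast
  show "emeasure M C < \<infinity>" using C radon_measureD(3)[OF M] by blast
  show "AE x in M. x \<in> C \<longrightarrow> norm (f x) \<le> B" using B radon_measureD(2)[OF M] by auto
  show "AE x in M. x \<notin> C \<longrightarrow> f x = 0" using z radon_measureD(2)[OF M] by auto
qed (use f in auto)

lemma radon_integrable_Cc: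
  assumes "radon_measure T M" "Hausdorff_space T" "f \<in> Cc T"
  shows "integrable M f"
  using CcE[OF assms(3,2)] radon_integrable_compact_support[OF assms(1)]
    continuous_map_borel_measurable radon_measureD(1)[OF assms(1)] by metis

lemma Urysohn_Cc:
  assumes H: "Hausdorff_space T" and L: "locally_compact_space T" and K: "compactin T K" and W: "openin T W" "K \<subseteq> W"
  obtains g where "continuous_map T euclidean g" "\<And>x. x \<in> topspace T \<Longrightarrow> 0 \<le> g x \<and> g x \<le> (1::real)"
    "\<And>x. x \<in> K \<Longrightarrow> g x = 1" "\<And>x. x \<in> topspace T \<Longrightarrow> x \<notin> W \<Longrightarrow> g x = 0"
    "(\<lambda>x. complex_of_real (g x)) \<in> Cc T"
proof -
  obtain U C where UC: "openin T U" "compactin T C" "closedin T C" "K \<subseteq> U" "U \<subseteq> C"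
    using K L H locally_compact_space_compact_closed_compact by metis
  \<comment> \<open>Vanishing off \<open>W\<close> alone would not give compact support; the
    function is also cut off outside \<open>U\<close>, which lies in the compact set
    \<open>C\<close>.\<close>
  define S where "S = topspace T - U \<inter> W"
  have S: "closedin T S" "disjnt K S" using UC W by (auto simp: S_def disjnt_iff)
  obtain g :: "'a \<Rightarrow> real" where g: "continuous_map T (top_of_set {0..1}) g" "g ` S \<subseteq> {0}" "g ` K \<subseteq> {1}"
    using Urysohn_completely_regular_compact_closed[OF zero_le_one locally_compact_regular_imp_completely_regular_space[OF L] K S] H
    by metis
  have cg: "continuous_map T euclidean g" using g(1) continuous_map_into_fulltopology by blast
  have g0: "g x = 0" if "x \<in> topspace T" "x \<notin> U \<inter> W" for x using that g(2) by (auto simp: S_def)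
  have "continuous_map T euclidean (complex_of_real \<circ> g)"
    by (rule continuous_map_compose[OF cg]) (auto intro: continuous_intros)
  moreover have "T closure_of {x \<in> topspace T. complex_of_real (g x) \<noteq> 0} \<subseteq> C"
    using UC g0 by (intro closure_of_minimal) auto
  then have "compactin T (T closure_of {x \<in> topspace T. complex_of_real (g x) \<noteq> 0})"
    using UC by (intro closed_compactin[OF UC(2)]) auto
  ultimately have "(\<lambda>x. complex_of_real (g x)) \<in> Cc T" by (simp add: Cc_def o_def)
  moreover have "0 \<le> g x \<and> g x \<le> 1" if "x \<in> topspace T" for x
    using continuous_map_image_subset_topspace[OF g(1)] that by auto
  ultimately show ?thesis using that[OF cg] g0 g(3) by auto
qed

text \<open>A Urysohn function lies between the indicators of \<open>K\<close> and of
  \<open>W\<close>, so equality of integrals compares the mass of \<open>K\<close> under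
  \<open>M\<close> with that of \<open>W\<close> under \<open>N\<close>; inner regularity removes
  \<open>K\<close>.\<close>

lemma radon_le_of_integrals:
  assumes M: "radon_measure T M" and N: "radon_measure T N" and H: "Hausdorff_space T" and L: "locally_compact_space T"
    and eq: "\<And>f. f \<in> Cc T \<Longrightarrow> (\<integral>x. f x \<partial>M) = (\<integral>x. f x \<partial>N)" and W: "openin T W"
  shows "emeasure M W \<le> emeasure N W"
  unfolding radon_measureD(5)[OF M W]
proof (rule SUP_least, clarify)
  fix K assume K: "compactin T K" "K \<subseteq> W"
  obtain g where g: "continuous_map T euclidean g" "\<And>x. x \<in> topspace T \<Longrightarrow> 0 \<le> g x \<and> g x \<le> (1::real)"
    "\<And>x. x \<in> K \<Longrightarrow> g x = 1" "\<And>x. x \<in> topspace T \<Longrightarrow> x \<notin> W \<Longrightarrow> g x = 0"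
    "(\<lambda>x. complex_of_real (g x)) \<in> Cc T"
    using Urysohn_Cc[OF H L K(1) W K(2)] by metis
  have KM: "K \<in> sets M" using compactin_imp_closedin[OF H K(1)] radon_measureD(7)[OF M] by blast
  have WN: "W \<in> sets N" using W radon_measureD(6)[OF N] by blast
  have int: "integrable M g" "integrable N g"
    using radon_integrable_Cc[OF M H g(5)] radon_integrable_Cc[OF N H g(5)]
    by (auto dest: integrable_Re)
  have eq': "(\<integral>x. g x \<partial>M) = (\<integral>x. g x \<partial>N)"
    using eq[OF g(5)] by simp
  have "emeasure M K = (\<integral>\<^sup>+ x. indicator K x \<partial>M)" using KM by simp
  also have "\<dots> \<le> (\<integral>\<^sup>+ x. ennreal (g x) \<partial>M)"
    using g(2,3) radon_measureD(2)[OF M] by (intro nn_integral_mono) (auto simp: indicator_def)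
  also have "\<dots> = ennreal (\<integral>x. g x \<partial>M)"
    using g(2) radon_measureD(2)[OF M] by (intro nn_integral_eq_integral int) auto
  also have "\<dots> = ennreal (\<integral>x. g x \<partial>N)" by (simp only: eq')
  also have "\<dots> = (\<integral>\<^sup>+ x. ennreal (g x) \<partial>N)"
    using g(2) radon_measureD(2)[OF N] by (intro nn_integral_eq_integral[symmetric] int) auto
  also have "\<dots> \<le> (\<integral>\<^sup>+ x. indicator W x \<partial>N)"
    using g(2,4) radon_measureD(2)[OF N] by (intro nn_integral_mono) (auto simp: indicator_def)
  also have "\<dots> = emeasure N W" using WN by simp
  finally show "emeasure M K \<le> emeasure N W" .
qed

lemma radon_measure_eq_of_integrals:
  assumes "radon_measure T M" "radon_measure T N" "Hausdorff_space T" "locally_compact_space T"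
    and "\<And>f. f \<in> Cc T \<Longrightarrow> (\<integral>x. f x \<partial>M) = (\<integral>x. f x \<partial>N)"
  shows "M = N"
  by (rule radon_measure_unique[OF assms(1,2)])
    (use assms in \<open>auto intro!: antisym radon_le_of_integrals\<close>)

section \<open>Lifting a measure along the source map\<close>

abbreviation fib :: "'a::topological_space \<Rightarrow> (real \<Rightarrow> 'a) set set" where
  "fib u \<equiv> rfibre fundamental_groupoid u"

lemma in_fib [simp]: "c \<in> fib u \<longleftrightarrow> c \<in> GG \<and> rr c = u"
  by (simp add: rfibre_def)

lemma radon_integral_concentrated:
  fixes f :: "'b \<Rightarrow> complex"
  assumes M: "radon_measure T M" and null: "emeasure M (topspace T - E) = 0" and E: "closedin T E"
    and f: "f \<in> borel_measurable M"
  shows "(\<integral>x. f x \<partial>M) = (LINT x:E|M. f x)"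
  unfolding set_lebesgue_integral_def
proof (rule integral_cong_AE)
  have EM: "E \<in> sets M" and oM: "topspace T - E \<in> sets M"
    using E radon_measureD(6,7)[OF M] by blast+
  show "f \<in> borel_measurable M" by fact
  show "(\<lambda>x. indicator E x *\<^sub>R f x) \<in> borel_measurable M" using EM f by measurable
  have "AE x in M. x \<notin> topspace T - E" using null oM by (intro AE_not_in) (simp add: null_sets_def)
  moreover have "AE x in M. x \<in> topspace T" using radon_measureD(2)[OF M] by (intro AE_I2) simp
  ultimately show "AE x in M. f x = indicator E x *\<^sub>R f x"
    by eventually_elim (auto simp: indicator_def)
qed

section \<open>Counting the classes of a set over a given source\<close>

definition fcount :: "'a::topological_space \<Rightarrow> (real \<Rightarrow> 'a) set set \<Rightarrow> 'a \<Rightarrow> ennreal" where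
  "fcount u K y = emeasure (count_space UNIV) {c \<in> K. rr c = u \<and> ss c = y}"

text \<open>Stated with sums, since counts may be infinite in \<open>ennreal\<close> and differences
  would be unsafe.\<close>

lemma fcount_Un_Int: "fcount u (K \<union> L) y + fcount u (K \<inter> L) y = fcount u K y + fcount u L y"
proof -
  have eqs: "{c \<in> K \<union> L. rr c = u \<and> ss c = y} = {c \<in> K. rr c = u \<and> ss c = y} \<union> {c \<in> L. rr c = u \<and> ss c = y}"
    "{c \<in> K \<inter> L. rr c = u \<and> ss c = y} = {c \<in> K. rr c = u \<and> ss c = y} \<inter> {c \<in> L. rr c = u \<and> ss c = y}"
    by auto
  show ?thesis unfolding fcount_def eqs by (rule emeasure_Un_Int[symmetric]) simp_all
qed

lemma fcount_mono: "K \<subseteq> L \<Longrightarrow> fcount u K y \<le> fcount u L y"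
  unfolding fcount_def by (rule emeasure_mono) auto

lemma fcount_ge_1:
  assumes "c \<in> K" "rr c = u" "ss c = y" shows "1 \<le> fcount u K y"
proof -
  have "(1::ennreal) = emeasure (count_space UNIV) {c}" by simp
  also have "\<dots> \<le> fcount u K y" unfolding fcount_def by (rule emeasure_mono) (use assms in auto)
  finally show ?thesis .
qed

lemma fcount_eq_0:
  assumes "\<And>c. c \<in> K \<Longrightarrow> rr c = u \<Longrightarrow> ss c = y \<Longrightarrow> False"
  shows "fcount u K y = 0"
proof -
  have *: "{c \<in> K. rr c = u \<and> ss c = y} = {}" using assms by blast
  show ?thesis unfolding fcount_def * by simp
qed

lemma fcount_inj:
  assumes "inj_on ss (K \<inter> fib u)" "K \<subseteq> GG"
  shows "fcount u K = indicator (ss ` (K \<inter> fib u))"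
proof
  fix y
  show "fcount u K y = indicator (ss ` (K \<inter> fib u)) y"
  proof (cases "y \<in> ss ` (K \<inter> fib u)")
    case True
    then obtain c where c: "c \<in> K \<inter> fib u" "ss c = y" by blast
    have "d = c" if "d \<in> K" "rr d = u" "ss d = y" for d
    proof (rule inj_onD[OF assms(1)])
      show "d \<in> K \<inter> fib u" using that assms(2) by simp blast
    qed (use c that in simp_all)
    then have *: "{c \<in> K. rr c = u \<and> ss c = y} = {c}"
      using c by (intro subset_antisym subsetI) simp_all
    show ?thesis unfolding fcount_def * using True by simp
  next
    case False
    then have "fcount u K y = 0" using assms(2) by (intro fcount_eq_0) auto
    then show ?thesis using False by simp
  qed
qed

text \<open>Left multiplication maps one range fibre injectively into the other and does not move
  sources. This is the pointwise origin of left invariance.\<close>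

lemma fcount_mult:
  assumes c: "c \<in> GG" and K: "K \<subseteq> GG"
  shows "fcount (rr c) ((\<lambda>d. c \<bullet>\<bullet> d) ` (K \<inter> fib (ss c))) y = fcount (ss c) K y"
proof -
  let ?A = "{d \<in> K. rr d = ss c \<and> ss d = y}"
  have *: "{d \<in> (\<lambda>d. c \<bullet>\<bullet> d) ` (K \<inter> fib (ss c)). rr d = rr c \<and> ss d = y} = (\<lambda>d. c \<bullet>\<bullet> d) ` ?A"
    using c K by (auto simp: subset_eq)
  have inj: "inj_on (\<lambda>d. c \<bullet>\<bullet> d) ?A"
  proof (rule inj_onI)
    fix d e assume d: "d \<in> ?A" and e: "e \<in> ?A" and eq: "c \<bullet>\<bullet> d = c \<bullet>\<bullet> e"
    from d K have d': "d \<in> GG" "rr d = ss c" by blast+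
    from e K have e': "e \<in> GG" "rr e = ss c" by blast+
    show "d = e" by (rule mult_left_cancel[OF c d'(1) e'(1) d'(2)[symmetric] e'(2)[symmetric] eq])
  qed
  show ?thesis
    unfolding fcount_def * by (simp only: emeasure_count_space subset_UNIV card_image[OF inj] finite_image_iff[OF inj])
qed

context covered_space
begin

lemma inj_src_nbh:
  fixes c :: "(real \<Rightarrow> 'a) set"
  assumes "c \<in> GG" "good_open U" "good_open V" shows "inj_on ss (nbh c U V \<inter> fib u)"
proof (rule inj_onI)
  fix d e assume "d \<in> nbh c U V \<inter> fib u" "e \<in> nbh c U V \<inter> fib u" "ss d = ss e"
  then have "chart_section c U V (rr d, ss d) = d" "chart_section c U V (rr d, ss d) = e"
    using chart_section_eq[OF assms, of d] chart_section_eq[OF assms, of e] by simp_all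
  then show "d = e" by simp
qed

lemma compactin_GG: "compactin Gtop (K :: (real \<Rightarrow> 'a) set set) \<Longrightarrow> K \<subseteq> GG"
  by (rule compactin_subset_topspace)

lemma compactin_Int_fib:
  "compactin Gtop (K :: (real \<Rightarrow> 'a) set set) \<Longrightarrow> compactin (subtopology Gtop (fib u)) (K \<inter> fib u)"
  using closed_Int_compactin[OF closedin_rfibre, of K u]
  by (simp add: compactin_subtopology Int_commute)

lemma compactin_Int_fib': 
  "compactin Gtop (K :: (real \<Rightarrow> 'a) set set) \<Longrightarrow> compactin Gtop (K \<inter> fib u)"
  using compactin_Int_fib by (simp add: compactin_subtopology)

lemma compactin_left_mult:
  fixes c :: "(real \<Rightarrow> 'a) set"
  assumes "c \<in> GG" "compactin Gtop K"
  shows "compactin Gtop ((\<lambda>d. c \<bullet>\<bullet> d) ` (K \<inter> fib (ss c)))"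
  using image_compactin[OF compactin_Int_fib[OF assms(2)] continuous_left_mult[OF assms(1)]] .

text \<open>Both measurability and finiteness reduce by inclusion-exclusion to compact sets on which
  the covering map is injective.\<close>

lemma fcount_finite_union:
  fixes F :: "'i \<Rightarrow> (real \<Rightarrow> 'a) set set"
  assumes nu: "radon_measure (euclidean :: 'a topology) \<nu>"
    and "finite I" "\<And>i. i \<in> I \<Longrightarrow> compactin Gtop (F i)" "\<And>i. i \<in> I \<Longrightarrow> inj_on ss (F i \<inter> fib u)"
  shows "fcount u (\<Union>i\<in>I. F i) \<in> borel_measurable \<nu> \<and> (\<forall>y. fcount u (\<Union>i\<in>I. F i) y < \<infinity>)
    \<and> (\<integral>\<^sup>+y. fcount u (\<Union>i\<in>I. F i) y \<partial>\<nu>) < \<infinity>"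
  using assms(2-)
proof (induction I arbitrary: F rule: finite_induct)
  case empty
  have "fcount u {} = (\<lambda>_. 0)" by (intro ext fcount_eq_0) simp
  then show ?case by simp
next
  case (insert i I)
  \<comment> \<open>\<open>?J\<close> is the overlap of the old union with the new piece, written as
    a union over the same index set \<open>I\<close>. The induction hypothesis thus covers it too,
    which is why \<open>F\<close> is kept arbitrary.\<close>
  let ?K = "\<Union>i\<in>I. F i" and ?J = "\<Union>j\<in>I. F j \<inter> F i"
  have K: "fcount u ?K \<in> borel_measurable \<nu>" "\<And>y. fcount u ?K y < \<infinity>" "(\<integral>\<^sup>+y. fcount u ?K y \<partial>\<nu>) < \<infinity>"
    using insert.IH[of F] insert.prems by auto
  have "fcount u ?J \<in> borel_measurable \<nu> \<and> (\<forall>y. fcount u ?J y < \<infinity>) \<and> (\<integral>\<^sup>+y. fcount u ?J y \<partial>\<nu>) < \<infinity>"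
  proof (rule insert.IH)
    fix j assume j: "j \<in> I"
    show "compactin Gtop (F j \<inter> F i)"
      by (rule compactin_Int[OF Hausdorff_Gtop]) (use insert.prems(1) j in auto)
    show "inj_on ss (F j \<inter> F i \<inter> fib u)"
      by (rule inj_on_subset[OF insert.prems(2)[of j]]) (use j in auto)
  qed
  then have J: "fcount u ?J \<in> borel_measurable \<nu>" "\<And>y. fcount u ?J y < \<infinity>" by auto
  have Fi: "compactin Gtop (F i)" "inj_on ss (F i \<inter> fib u)" using insert.prems by auto
  let ?S = "ss ` (F i \<inter> fib u)"
  have L: "fcount u (F i) = indicator ?S" using fcount_inj Fi compactin_GG by blast
  have cS: "compact ?S"
    using image_compactin[OF compactin_Int_fib'[OF Fi(1)] continuous_rng_src(2)] by simp
  then have S: "?S \<in> sets \<nu>" "emeasure \<nu> ?S < \<infinity>"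
    using radon_measureD(3,7)[OF nu] by (auto simp: compact_imp_closed)
  have JI: "?J = ?K \<inter> F i" by (simp only: UN_extend_simps)
  \<comment> \<open>Solving inclusion-exclusion for the union requires the count over
    \<open>?J\<close> to be finite; pointwise finiteness is carried through the induction for this
    subtraction.\<close>
  have eq: "fcount u (?K \<union> F i) y = fcount u ?K y + indicator ?S y - fcount u ?J y" for y
  proof -
    have "fcount u (?K \<union> F i) y + fcount u ?J y = fcount u ?K y + indicator ?S y"
      using fcount_Un_Int[of u ?K "F i" y] L JI by simp
    then show ?thesis using J(2)[of y] by (metis ennreal_add_diff_cancel_right infinity_ennreal_def less_irrefl)
  qed
  have le: "fcount u (?K \<union> F i) y \<le> fcount u ?K y + indicator ?S y" for y
    unfolding eq by (rule diff_le_self_ennreal)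
  have 1: "fcount u (?K \<union> F i) \<in> borel_measurable \<nu>"
    unfolding eq[abs_def] using K(1) J(1) S by measurable
  have 2: "fcount u (?K \<union> F i) y < \<infinity>" for y
    using le[of y] K(2)[of y] by (auto simp: indicator_def intro: order_le_less_trans split: if_splits)
  have "(\<integral>\<^sup>+y. fcount u (?K \<union> F i) y \<partial>\<nu>) \<le> (\<integral>\<^sup>+y. fcount u ?K y + indicator ?S y \<partial>\<nu>)"
    by (intro nn_integral_mono le)
  moreover have "\<dots> = (\<integral>\<^sup>+y. fcount u ?K y \<partial>\<nu>) + emeasure \<nu> ?S"
    using K(1) S by (subst nn_integral_add) auto
  moreover have "\<dots> < \<infinity>" using K(3) S by simp
  ultimately have "(\<integral>\<^sup>+y. fcount u (?K \<union> F i) y \<partial>\<nu>) < \<infinity>" by (simp only: order_le_less_trans)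
  with 1 2 have "fcount u (?K \<union> F i) \<in> borel_measurable \<nu> \<and> (\<forall>y. fcount u (?K \<union> F i) y < \<infinity>) \<and>
    (\<integral>\<^sup>+y. fcount u (?K \<union> F i) y \<partial>\<nu>) < \<infinity>" by blast
  moreover have "(\<Union>i\<in>insert i I. F i) = ?K \<union> F i" by blast
  ultimately show ?case by (simp only: simp_thms)
qed

text \<open>Finitely many compact sets inside basic sets cover \<open>K\<close>, and on a fixed
  range fibre the source map is injective on each of them.\<close>

lemma fcount_compact:
  assumes nu: "radon_measure (euclidean :: 'a topology) \<nu>" and K: "compactin Gtop K"
  shows "fcount u K \<in> borel_measurable \<nu>" "(\<integral>\<^sup>+y. fcount u K y \<partial>\<nu>) < \<infinity>"
proof -
  have "\<exists>Q C. openin Gtop Q \<and> compactin Gtop C \<and> c \<in> Q \<and> Q \<subseteq> C \<and> inj_on ss (C \<inter> fib u)" if "c \<in> K" for c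
  proof -
    have c: "c \<in> GG" using that compactin_GG[OF K] by blast
    obtain U where U: "good_open U" "rr c \<in> U" by (rule good_open_at[of "rr c"])
    obtain V where V: "good_open V" "ss c \<in> V" by (rule good_open_at[of "ss c"])
    obtain Q C where "openin Gtop Q" "compactin Gtop C" "c \<in> Q" "Q \<subseteq> C" "C \<subseteq> nbh c U V"
      using locally_compact_Hausdorff_nbhd[OF Hausdorff_Gtop locally_compact_Gtop
          openin_nbh[OF c good_openD(1)[OF U(1)] good_openD(1)[OF V(1)]] nbh_self[OF c U(2) V(2)]] by metis
    moreover have "inj_on ss (C \<inter> fib u)"
      by (rule inj_on_subset[OF inj_src_nbh[OF c U(1) V(1)]]) (use calculation in blast)
    ultimately show ?thesis by blast
  qed
  then obtain Q C where QC: "\<And>c. c \<in> K \<Longrightarrow> openin Gtop (Q c) \<and> compactin Gtop (C c) \<and> c \<in> Q c \<and> Q c \<subseteq> C c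
      \<and> inj_on ss (C c \<inter> fib u)"
    by metis
  obtain P where P: "finite P" "P \<subseteq> K" "K \<subseteq> \<Union>(Q ` P)"
    by (rule compactin_pointwise_subcover[OF K, of Q]) (use QC in auto)
  have "K = (\<Union>c\<in>P. K \<inter> C c)"
  proof
    show "K \<subseteq> (\<Union>c\<in>P. K \<inter> C c)"
    proof
      fix x assume x: "x \<in> K"
      then obtain c where "c \<in> P" "x \<in> Q c" using P(3) by auto
      then show "x \<in> (\<Union>c\<in>P. K \<inter> C c)" using x QC[of c] P(2) by auto
    qed
  qed auto
  moreover have "compactin Gtop (K \<inter> C c)" if "c \<in> P" for c
    by (rule compactin_Int[OF Hausdorff_Gtop K]) (use QC[of c] that P(2) in auto)
  moreover have "inj_on ss (K \<inter> C c \<inter> fib u)" if "c \<in> P" for c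
    by (rule inj_on_subset[of _ "C c \<inter> fib u"]) (use QC[of c] that P(2) in auto)
  ultimately show "fcount u K \<in> borel_measurable \<nu>" "(\<integral>\<^sup>+y. fcount u K y \<partial>\<nu>) < \<infinity>"
    using fcount_finite_union[OF nu P(1), of "\<lambda>c. K \<inter> C c" u] by auto
qed

end

section \<open>The measures on the range fibres\<close>

locale base_measure = covered_space ty for ty :: "'a::t2_space itself" +
  fixes \<nu> :: "'a measure"
  assumes radon_base: "radon_measure (euclidean :: 'a topology) \<nu>"
    and full_base: "fully_supported (euclidean :: 'a topology) \<nu>"
begin

definition lift_content :: "'a \<Rightarrow> (real \<Rightarrow> 'a) set set \<Rightarrow> ennreal" where
  "lift_content u K = (\<integral>\<^sup>+y. fcount u K y \<partial>\<nu>)"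

lemma radon_content_lift: "radon_content Gtop (lift_content u)"
proof
  fix K L :: "(real \<Rightarrow> 'a) set set" assume KL: "compactin Gtop K" "compactin Gtop L"
  note mK = fcount_compact(1)[OF radon_base KL(1)] and mL = fcount_compact(1)[OF radon_base KL(2)]
  have le: "fcount u (K \<union> L) y \<le> fcount u K y + fcount u L y" for y
    using fcount_Un_Int[of u K L y] by (metis le_iff_add)
  have "lift_content u (K \<union> L) \<le> (\<integral>\<^sup>+y. fcount u K y + fcount u L y \<partial>\<nu>)"
    unfolding lift_content_def by (intro nn_integral_mono le)
  then show "lift_content u (K \<union> L) \<le> lift_content u K + lift_content u L"
    unfolding lift_content_def using mK mL by (simp add: nn_integral_add)
  assume "K \<inter> L = {}"
  then have "fcount u K y + fcount u L y = fcount u (K \<union> L) y" for y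
    using fcount_Un_Int[of u K L y] fcount_eq_0[of "K \<inter> L" u y] by simp
  then show "lift_content u K + lift_content u L \<le> lift_content u (K \<union> L)"
    unfolding lift_content_def using mK mL by (simp flip: nn_integral_add)
qed (auto simp: lift_content_def Hausdorff_Gtop locally_compact_Gtop fcount_compact(2)[OF radon_base, unfolded infinity_ennreal_def]
      intro!: nn_integral_mono fcount_mono)

definition lift_measure :: "'a \<Rightarrow> (real \<Rightarrow> 'a) set measure" where
  "lift_measure u = (SOME M. radon_measure Gtop M \<and>
     (\<forall>W. openin Gtop W \<longrightarrow> emeasure M W = (SUP K\<in>{K. compactin Gtop K \<and> K \<subseteq> W}. lift_content u K)))"

lemma lift_measure:
  "radon_measure Gtop (lift_measure u)"
  "openin Gtop W \<Longrightarrow> emeasure (lift_measure u) W = (SUP K\<in>{K. compactin Gtop K \<and> K \<subseteq> W}. lift_content u K)"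
proof -
  have "\<exists>M. radon_measure Gtop M \<and>
     (\<forall>W. openin Gtop W \<longrightarrow> emeasure M W = (SUP K\<in>{K. compactin Gtop K \<and> K \<subseteq> W}. lift_content u K))"
    using radon_content.radon_measure_exists[OF radon_content_lift] by metis
  from someI_ex[OF this] show "radon_measure Gtop (lift_measure u)"
    "openin Gtop W \<Longrightarrow> emeasure (lift_measure u) W = (SUP K\<in>{K. compactin Gtop K \<and> K \<subseteq> W}. lift_content u K)"
    unfolding lift_measure_def by blast+
qed

lemma lift_measure_null: "emeasure (lift_measure u) (GG - fib u) = 0"
proof -
  have "lift_content u K = 0" if "K \<subseteq> GG - fib u" for K
  proof -
    have "fcount u K y = 0" for y using that by (intro fcount_eq_0) auto
    then show ?thesis by (simp add: lift_content_def)
  qed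
  moreover have "openin Gtop (GG - fib u)" using closedin_rfibre by blast
  ultimately show ?thesis by (subst lift_measure(2)) (auto intro!: SUP_eq_const simp: bot_ennreal)
qed

text \<open>\<open>W\<close> contains a compact sheet \<open>?K\<close> in the fibre over
  \<open>u\<close> that lies over a neighbourhood of the source of \<open>c\<close>. Its count is at
  least 1 on \<open>V1\<close>, so its content is at least the positive mass of
  \<open>V1\<close>.\<close>

lemma lift_measure_pos:
  assumes W: "openin Gtop W" "c \<in> W" and u: "rr c = u"
  shows "emeasure (lift_measure u) W > 0"
proof -
  have c: "c \<in> GG" using W openin_subset by blast
  obtain U V where UV: "good_open U" "good_open V" "rr c \<in> U" "ss c \<in> V" "nbh c U V \<subseteq> W"
    using nbh_base[OF W, of UNIV UNIV] by auto
  obtain V1 L where V1: "open V1" "compact L" "ss c \<in> V1" "V1 \<subseteq> L" "L \<subseteq> V"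
    using compact_nbhd_ex[OF good_openD(1)] UV by metis
  let ?K = "chart_section c U V ` ({u} \<times> L)"
  have "compactin (top_of_set (U \<times> V)) ({u} \<times> L)"
    using UV V1 u by (auto simp: compactin_subtopology intro!: compact_Times)
  from image_compactin[OF this continuous_chart_section[OF c UV(1-4)]]
  have K: "compactin Gtop ?K" .
  have uU: "u \<in> U" using UV u by simp
  have "chart_section c U V (u, y) \<in> W" if "y \<in> L" for y
    using chart_section(1)[OF c UV(1-4) uU] that UV(5) V1(5) by blast
  then have KW: "?K \<subseteq> W" by blast
  have "0 < emeasure \<nu> V1"
    using full_base V1 unfolding fully_supported_def measure_support_def by auto
  also have "emeasure \<nu> V1 = (\<integral>\<^sup>+y. indicator V1 y \<partial>\<nu>)"
    using V1 radon_measureD(6)[OF radon_base] by simp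
  also have "\<dots> \<le> lift_content u ?K"
    unfolding lift_content_def
  proof (intro nn_integral_mono)
    fix y
    show "indicator V1 y \<le> fcount u ?K y"
    proof (cases "y \<in> V1")
      case True
      then have yV: "y \<in> V" and yL: "y \<in> L" using V1 by auto
      have "1 \<le> fcount u ?K y"
        using chart_section(2,3)[OF c UV(1-4) uU yV] yL
        by (intro fcount_ge_1[of "chart_section c U V (u, y)"]) auto
      then show ?thesis using True by simp
    qed simp
  qed
  also have "\<dots> \<le> emeasure (lift_measure u) W"
    unfolding lift_measure(2)[OF W(1)] using K KW by (intro SUP_upper) auto
  finally show ?thesis .
qed

lemma lift_measure_support: "measure_support Gtop (lift_measure u) = fib u"
proof
  show "measure_support Gtop (lift_measure u) \<subseteq> fib u"
  proof
    fix c assume c: "c \<in> measure_support Gtop (lift_measure u)"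
    show "c \<in> fib u"
    proof (rule ccontr)
      assume "c \<notin> fib u"
      then have "c \<in> GG - fib u" using c by (simp add: measure_support_def)
      moreover have "openin Gtop (GG - fib u)" using closedin_rfibre by blast
      ultimately have "emeasure (lift_measure u) (GG - fib u) > 0"
        using c unfolding measure_support_def by blast
      then show False by (simp add: lift_measure_null)
    qed
  qed
  show "fib u \<subseteq> measure_support Gtop (lift_measure u)"
    using lift_measure_pos by (auto simp: measure_support_def)
qed

lemma lift_content_mult:
  assumes "c \<in> GG" "compactin Gtop K"
  shows "lift_content (rr c) ((\<lambda>d. c \<bullet>\<bullet> d) ` (K \<inter> fib (ss c))) = lift_content (ss c) K"
  using fcount_mult[OF assms(1) compactin_GG[OF assms(2)]] by (simp add: lift_content_def)

text \<open>Both sides are Radon, so open sets suffice, where each value is a supremum of contents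
  of compact sets. Translation by \<open>c\<close>, and back by its inverse, matches the two
  families with equal contents.\<close>

lemma lift_measure_mult:
  assumes c: "c \<in> GG"
  shows "lift_measure (rr c) = distr (restrict_space (lift_measure (ss c)) (fib (ss c))) (borel_of Gtop) (\<lambda>d. c \<bullet>\<bullet> d)"
    (is "_ = ?N")
proof (rule radon_measure_unique[OF lift_measure(1)])
  note tr = radon_transfer[OF lift_measure(1) lift_measure_null closedin_rfibre closedin_rfibre
      homeomorphic_left_mult[OF c] Hausdorff_Gtop]
  show "radon_measure Gtop ?N" by (rule tr(1))
  fix U :: "(real \<Rightarrow> 'a) set set" assume U: "openin Gtop U"
  obtain W where W: "openin Gtop W" "(\<lambda>d. c \<bullet>\<bullet> d) -` U \<inter> fib (ss c) = W \<inter> fib (ss c)"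
    using tr(5)[OF U] by blast
  have "emeasure ?N U = emeasure (lift_measure (ss c)) W"
    using tr(3)[OF borel_of_open[OF U]] W(2) radon_Int_full[OF lift_measure(1) lift_measure_null closedin_rfibre W(1)]
    by simp
  also have "\<dots> = (SUP K\<in>{K. compactin Gtop K \<and> K \<subseteq> W}. lift_content (ss c) K)"
    by (rule lift_measure(2)[OF W(1)])
  also have "\<dots> = (SUP K\<in>{K. compactin Gtop K \<and> K \<subseteq> U}. lift_content (rr c) K)"
  proof (rule antisym)
    show "(SUP K\<in>{K. compactin Gtop K \<and> K \<subseteq> W}. lift_content (ss c) K)
       \<le> (SUP K\<in>{K. compactin Gtop K \<and> K \<subseteq> U}. lift_content (rr c) K)"
    proof (rule SUP_least)
      fix K assume "K \<in> {K. compactin Gtop K \<and> K \<subseteq> W}"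
      then have K: "compactin Gtop K" "K \<subseteq> W" by auto
      have "(\<lambda>d. c \<bullet>\<bullet> d) ` (K \<inter> fib (ss c)) \<subseteq> U" using K(2) W(2) by blast
      then show "lift_content (ss c) K \<le> (SUP K\<in>{K. compactin Gtop K \<and> K \<subseteq> U}. lift_content (rr c) K)"
        unfolding lift_content_mult[OF c K(1), symmetric]
        using compactin_left_mult[OF c K(1)] by (intro SUP_upper) auto
    qed
    show "(SUP K\<in>{K. compactin Gtop K \<and> K \<subseteq> U}. lift_content (rr c) K)
       \<le> (SUP K\<in>{K. compactin Gtop K \<and> K \<subseteq> W}. lift_content (ss c) K)"
    proof (rule SUP_least)
      fix K assume "K \<in> {K. compactin Gtop K \<and> K \<subseteq> U}"
      then have K: "compactin Gtop K" "K \<subseteq> U" by auto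
      let ?L = "(\<lambda>d. inv_class c \<bullet>\<bullet> d) ` (K \<inter> fib (rr c))"
      have i: "inv_class c \<in> GG" "rr (inv_class c) = ss c" "ss (inv_class c) = rr c" using c by simp_all
      have "?L \<subseteq> (\<lambda>d. c \<bullet>\<bullet> d) -` U \<inter> fib (ss c)" using K(2) c by auto
      then have "?L \<subseteq> W" using W(2) by blast
      moreover have "compactin Gtop ?L" using compactin_left_mult[OF i(1) K(1)] unfolding i .
      moreover have "lift_content (ss c) ?L = lift_content (rr c) K"
        using lift_content_mult[OF i(1) K(1)] unfolding i .
      ultimately show "lift_content (rr c) K \<le> (SUP K\<in>{K. compactin Gtop K \<and> K \<subseteq> W}. lift_content (ss c) K)"
        by (metis (mono_tags, lifting) SUP_upper mem_Collect_eq)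
    qed
  qed
  also have "\<dots> = emeasure (lift_measure (rr c)) U" by (rule lift_measure(2)[OF U, symmetric])
  finally show "emeasure (lift_measure (rr c)) U = emeasure ?N U" by simp
qed

lemma lift_measure_integral_mult:
  fixes f :: "(real \<Rightarrow> 'a) set \<Rightarrow> complex"
  assumes c: "c \<in> GG" and f: "f \<in> borel_measurable (borel_of Gtop)"
  shows "(\<integral>d. f d \<partial>lift_measure (rr c)) =
    (\<integral>d. f (c \<bullet>\<bullet> d) \<partial>restrict_space (lift_measure (ss c)) (fib (ss c)))"
proof -
  note tr = radon_transfer[OF lift_measure(1) lift_measure_null closedin_rfibre closedin_rfibre
      homeomorphic_left_mult[OF c] Hausdorff_Gtop]
  show ?thesis unfolding lift_measure_mult[OF c] by (rule integral_distr[OF tr(2) f])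
qed

lemma integral_restrict_fib:
  fixes g :: "(real \<Rightarrow> 'a) set \<Rightarrow> complex"
  shows "(\<integral>d. g d \<partial>restrict_space (lift_measure u) (fib u)) = (LINT d:fib u|lift_measure u. g d)"
  unfolding set_lebesgue_integral_def
  using radon_measureD(7)[OF lift_measure(1) closedin_rfibre]
  by (intro integral_restrict_space) (auto intro: sets.Int)

lemma Cc_borel_measurable_lift: "f \<in> Cc Gtop \<Longrightarrow> f \<in> borel_measurable (lift_measure u)"
  by (rule continuous_map_borel_measurable) (auto simp: Cc_def radon_measureD(1)[OF lift_measure(1)])

lemma lift_measure_integral_fib:
  assumes "f \<in> Cc Gtop"
  shows "(\<integral>d. f d \<partial>lift_measure u) = (LINT d:fib u|lift_measure u. f d)"
  by (rule radon_integral_concentrated[OF lift_measure(1) lift_measure_null closedin_rfibre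
        Cc_borel_measurable_lift[OF assms]])

lemma lift_measure_invariant:
  assumes "c \<in> GG" "f \<in> Cc Gtop"
  shows "(LINT d:fib (ss c)|lift_measure (ss c). f (c \<bullet>\<bullet> d)) = (LINT d:fib (rr c)|lift_measure (rr c). f d)"
  using lift_measure_integral_mult[OF assms(1) Cc_borel_measurable[OF assms(2)]]
    integral_restrict_fib lift_measure_integral_fib[OF assms(2)] by metis

end

section \<open>Continuity of the Haar integrals\<close>

context covered_space
begin

text \<open>This is the chart section of the unit class at \<open>u0\<close> with its first
  coordinate frozen; its left factor is then a unit.\<close>

lemma continuous_transport:
  assumes U: "good_open U" "u0 \<in> (U :: 'a set)"
  shows "continuous_map (top_of_set U) Gtop (\<lambda>v. transport U u0 v)"
proof -
  have 1: "unit_class u0 \<in> GG" "rr (unit_class u0) \<in> U" "ss (unit_class u0) \<in> U" using U by simp_all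
  have "continuous_map (top_of_set U) (top_of_set (U \<times> U)) (\<lambda>v. (u0, v))"
    using U by (auto intro!: continuous_intros)
  from continuous_map_compose[OF this continuous_chart_section[OF 1(1) U(1) U(1) 1(2,3)]]
  have "continuous_map (top_of_set U) Gtop (chart_section (unit_class u0) U U \<circ> (\<lambda>v. (u0, v)))" .
  moreover have "(chart_section (unit_class u0) U U \<circ> (\<lambda>v. (u0, v))) v = transport U u0 v"
    if "v \<in> topspace (top_of_set U)" for v
  proof -
    have v: "v \<in> U" using that by simp
    have "transport U u0 u0 = unit_class u0"
      using transport_eq[OF U(1) classes_in_unit[OF U(2)]] by simp
    then show ?thesis
      using transport[OF U v] by (simp add: chart_section_def)
  qed
  ultimately show ?thesis by (rule continuous_map_eq)
qed

lemma transport_inverse: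
  assumes U: "good_open U" "u \<in> U" "v \<in> (U :: 'a set)" and d: "d \<in> GG" "rr d = v"
  shows "transport U v u \<bullet>\<bullet> (transport U u v \<bullet>\<bullet> d) = d"
proof -
  note a = transport[OF U] and b = transport[OF U(1,3,2)]
  have "transport U v u \<bullet>\<bullet> transport U u v = unit_class v"
    by (rule good_openD(2)[OF U(1)])
      (use a b classes_in_unit[OF U(3)] in \<open>simp_all add: classes_in_mult\<close>)
  moreover have "transport U v u \<bullet>\<bullet> (transport U u v \<bullet>\<bullet> d) = transport U v u \<bullet>\<bullet> transport U u v \<bullet>\<bullet> d"
    using mult_assoc_class[OF b(4) a(4) d(1)] a b d by simp
  ultimately show ?thesis using d by simp
qed

text \<open>The part of a compact set over all ranges in \<open>K\<close> is gathered into the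
  single fibre over \<open>u0\<close>. This yields one compact set that controls all nearby fibres
  at once.\<close>

lemma compactin_transport_back:
  fixes C :: "(real \<Rightarrow> 'a) set set"
  assumes U: "good_open U" "u0 \<in> U" and K: "compact K" "K \<subseteq> U" and C: "compactin Gtop C"
  shows "compactin Gtop ((\<lambda>c. transport U u0 (rr c) \<bullet>\<bullet> c) ` {c \<in> C. rr c \<in> K})"
proof -
  let ?S = "{c \<in> GG. rr c \<in> U}"
  let ?P = "subtopology (prod_topology Gtop Gtop) {(c, d). ss c = rr d}"
  have "continuous_map (subtopology Gtop ?S) (top_of_set U) rr"
    using continuous_rng_src(1)
    by (auto simp: continuous_map_in_subtopology continuous_map_from_subtopology)
  from continuous_map_compose[OF this continuous_transport[OF U]]
  have "continuous_map (subtopology Gtop ?S) Gtop (\<lambda>c. transport U u0 (rr c))" by (simp add: o_def)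
  moreover have "continuous_map (subtopology Gtop ?S) Gtop (\<lambda>c. c)"
    by (simp add: continuous_map_from_subtopology)
  ultimately have "continuous_map (subtopology Gtop ?S) (prod_topology Gtop Gtop) (\<lambda>c. (transport U u0 (rr c), c))"
    by (simp add: continuous_map_pairwise o_def)
  then have "continuous_map (subtopology Gtop ?S) ?P (\<lambda>c. (transport U u0 (rr c), c))"
    using transport(3)[OF U] by (auto simp: continuous_map_in_subtopology)
  from continuous_map_compose[OF this continuous_gmult]
  have cont: "continuous_map (subtopology Gtop ?S) Gtop (\<lambda>c. transport U u0 (rr c) \<bullet>\<bullet> c)"
    by (simp add: o_def)
  have "closedin Gtop {c \<in> GG. rr c \<in> K}"
    using closedin_continuous_map_preimage[OF continuous_rng_src(1), of K] K(1)
    by (simp add: compact_imp_closed)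
  from closed_Int_compactin[OF this C]
  have "compactin Gtop ({c \<in> GG. rr c \<in> K} \<inter> C)" .
  moreover have "{c \<in> GG. rr c \<in> K} \<inter> C = {c \<in> C. rr c \<in> K}"
    using compactin_GG[OF C] by blast
  ultimately have "compactin (subtopology Gtop ?S) {c \<in> C. rr c \<in> K}"
    using K(2) compactin_GG[OF C] by (auto simp: compactin_subtopology)
  from image_compactin[OF this cont] show ?thesis .
qed

text \<open>For \<open>u\<close> in a small good set \<open>A\<close> the short class from
  \<open>u0\<close> to \<open>u\<close> is the same in \<open>A\<close> as in \<open>U\<close>.
  Multiplying \<open>d\<close> by it stays inside \<open>nbh c A V\<close>, on which
  \<open>f\<close> varies from \<open>f c\<close> by less than e/2.\<close>

lemma transport_nearby:
  fixes f :: "(real \<Rightarrow> 'a) set \<Rightarrow> complex"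
  assumes f: "continuous_map Gtop euclidean f" and U: "good_open U" "u0 \<in> U" and c: "c \<in> GG" "rr c = u0"
    and e: "e > 0"
  obtains A N where "open A" "u0 \<in> A" "A \<subseteq> U" "openin Gtop N" "c \<in> N"
    "\<And>u d. u \<in> A \<Longrightarrow> d \<in> N \<Longrightarrow> d \<in> fib u0 \<Longrightarrow> norm (f (transport U u u0 \<bullet>\<bullet> d) - f d) < e"
proof -
  let ?W = "{d \<in> GG. f d \<in> ball (f c) (e/2)}"
  have "openin Gtop ?W" using openin_continuous_map_preimage[OF f, of "ball (f c) (e/2)"] by simp
  moreover have "c \<in> ?W" using c e by simp
  ultimately obtain A V where AV: "good_open A" "good_open V" "A \<subseteq> U" "rr c \<in> A" "ss c \<in> V" "nbh c A V \<subseteq> ?W"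
    using nbh_base[of ?W c U UNIV] good_openD(1)[OF U(1)] U(2) c by auto
  have "norm (f (transport U u u0 \<bullet>\<bullet> d) - f d) < e" if u: "u \<in> A" and d: "d \<in> nbh c A V" "d \<in> fib u0" for u d
  proof -
    have u0: "u0 \<in> A" using AV c by simp
    note t = transport[OF AV(1) u u0]
    have dd: "d \<in> GG" "rr d = u0" "ss d \<in> V" using d nbh_props[OF d(1) c(1)] by simp_all
    have "transport U (rr (transport A u u0)) (ss (transport A u u0)) = transport A u u0"
      using transport_eq[OF U(1) classes_in_mono[OF t(1) AV(3)]] .
    then have eq: "transport U u u0 = transport A u u0" using t by simp
    have "transport A u u0 \<bullet>\<bullet> d \<in> nbh d A V"
      by (rule nbhI[OF t(1) classes_in_unit[OF dd(3)]]) (use t dd in simp_all)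
    then have "transport U u u0 \<bullet>\<bullet> d \<in> nbh c A V"
      unfolding eq by (rule nbh_trans[OF d(1) _ c(1)])
    then have "dist (f c) (f (transport U u u0 \<bullet>\<bullet> d)) < e/2" using AV(6) by auto
    moreover have "dist (f c) (f d) < e/2" using AV(6) d by auto
    ultimately have "dist (f (transport U u u0 \<bullet>\<bullet> d)) (f d) < e"
      using dist_triangle_half_l dist_commute by metis
    then show ?thesis by (simp add: dist_norm)
  qed
  then show ?thesis
    using that[OF good_openD(1)[OF AV(1)] _ AV(3) openin_nbh[OF c(1) good_openD(1)[OF AV(1)] good_openD(1)[OF AV(2)]]]
      nbh_self[OF c(1) AV(4,5)] AV(4) c(2) by blast
qed

end

context base_measure
begin

text \<open>By left invariance every nearby integral becomes an integral over the fibre at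
  \<open>u0\<close>, of the function sending \<open>d\<close> to \<open>f\<close> at
  \<open>\<tau> u\<close> times \<open>d\<close>. These integrands vanish off a common compact set
  \<open>D\<close> and converge uniformly on it.\<close>

lemma lift_integral_continuous_at:
  fixes f :: "(real \<Rightarrow> 'a) set \<Rightarrow> complex"
  assumes f: "f \<in> Cc Gtop" and e: "e > 0"
  obtains A where "open A" "u0 \<in> A"
    "\<And>u. u \<in> A \<Longrightarrow> norm ((\<integral>c. f c \<partial>lift_measure u) - (\<integral>c. f c \<partial>lift_measure u0)) < e"
proof -
  obtain C B where C: "continuous_map Gtop euclidean f" "compactin Gtop C" "closedin Gtop C" "0 \<le> B"
    "\<And>c. c \<in> GG \<Longrightarrow> c \<notin> C \<Longrightarrow> f c = 0" "\<And>c. c \<in> GG \<Longrightarrow> norm (f c) \<le> B"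
    using CcE[OF f Hausdorff_Gtop] by metis
  obtain U where U: "good_open U" "u0 \<in> U" by (rule good_open_at[of u0])
  obtain U1 K where U1: "open U1" "compact K" "u0 \<in> U1" "U1 \<subseteq> K" "K \<subseteq> U"
    using compact_nbhd_ex[OF good_openD(1)[OF U(1)] U(2)] by metis
  define \<tau> where "\<tau> u = transport U u u0" for u
  define D where "D = (\<lambda>c. transport U u0 (rr c) \<bullet>\<bullet> c) ` {c \<in> C. rr c \<in> K}"
  have D: "compactin Gtop D"
    unfolding D_def by (rule compactin_transport_back[OF U U1(2,5) C(2)])
  have tau: "\<tau> u \<in> GG" "rr (\<tau> u) = u" "ss (\<tau> u) = u0" if "u \<in> U" for u
    using transport[OF U(1) that U(2)] by (simp_all add: \<tau>_def)
  have Dfib: "D \<subseteq> fib u0"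
  proof
    fix d assume "d \<in> D"
    then obtain c where c: "c \<in> C" "rr c \<in> K" "d = transport U u0 (rr c) \<bullet>\<bullet> c" by (auto simp: D_def)
    have "rr c \<in> U" "c \<in> GG" using c U1 compactin_GG[OF C(2)] by auto
    then show "d \<in> fib u0" using c transport[OF U \<open>rr c \<in> U\<close>] by simp
  qed
  \<comment> \<open>A nonzero value puts the product into the support \<open>C\<close> over a range
    in \<open>K\<close>; transporting it back recovers \<open>d\<close> as a member of
    \<open>D\<close>.\<close>
  have off: "f (\<tau> u \<bullet>\<bullet> d) = 0" if u: "u \<in> K" and d: "d \<in> fib u0" "d \<notin> D" for u d
  proof (rule ccontr)
    assume nz: "f (\<tau> u \<bullet>\<bullet> d) \<noteq> 0"
    have uU: "u \<in> U" using u U1 by auto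
    have G: "\<tau> u \<bullet>\<bullet> d \<in> GG" "rr (\<tau> u \<bullet>\<bullet> d) = u" using tau[OF uU] d by simp_all
    then have "\<tau> u \<bullet>\<bullet> d \<in> {c \<in> C. rr c \<in> K}" using C(5) nz u by auto
    moreover have "d = transport U u0 (rr (\<tau> u \<bullet>\<bullet> d)) \<bullet>\<bullet> (\<tau> u \<bullet>\<bullet> d)"
      unfolding G(2) unfolding \<tau>_def using transport_inverse[OF U(1) uU U(2), of d] d by simp
    ultimately have "d \<in> D" unfolding D_def by blast
    then show False using d by blast
  qed
  have tau0: "\<tau> u0 = unit_class u0"
    using transport_eq[OF U(1) classes_in_unit[OF U(2)]] by (simp add: \<tau>_def)
  define R where "R = restrict_space (lift_measure u0) (fib u0)"
  have fibM: "fib u0 \<in> sets (lift_measure u0)"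
    using radon_measureD(7)[OF lift_measure(1) closedin_rfibre] .
  have DM: "D \<in> sets (lift_measure u0)"
    using radon_measureD(7)[OF lift_measure(1) compactin_imp_closedin[OF Hausdorff_Gtop D]] .
  have spR: "space R = fib u0"
    unfolding R_def using sets.sets_into_space[OF fibM] by (auto simp: space_restrict_space)
  have DR: "D \<in> sets R" unfolding R_def using DM Dfib fibM by (simp add: sets_restrict_space_iff)
  have eR: "emeasure R D < \<infinity>"
    unfolding R_def using DM Dfib fibM radon_measureD(3)[OF lift_measure(1) D]
    by (simp add: emeasure_restrict_space)
  have I: "(\<integral>c. f c \<partial>lift_measure u) = (\<integral>d. f (\<tau> u \<bullet>\<bullet> d) \<partial>R)" if "u \<in> U" for u
    using lift_measure_integral_mult[OF tau(1)[OF that] Cc_borel_measurable[OF f]] tau[OF that] by (simp add: R_def)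
  have int: "integrable R (\<lambda>d. f (\<tau> u \<bullet>\<bullet> d))" if u: "u \<in> K" for u
  proof (rule integrableI_bounded_set[of D _ _ B])
    have uU: "u \<in> U" using u U1 by auto
    note t = tau[OF uU]
    have "(\<lambda>d. \<tau> u \<bullet>\<bullet> d) \<in> measurable R (borel_of Gtop)"
      using radon_transfer(2)[OF lift_measure(1) lift_measure_null closedin_rfibre closedin_rfibre
        homeomorphic_left_mult[OF t(1)] Hausdorff_Gtop] t unfolding R_def by simp
    from measurable_compose[OF this Cc_borel_measurable[OF f]]
    show "(\<lambda>d. f (\<tau> u \<bullet>\<bullet> d)) \<in> borel_measurable R" .
    show "AE d in R. d \<in> D \<longrightarrow> norm (f (\<tau> u \<bullet>\<bullet> d)) \<le> B"
    proof (rule AE_I2, rule impI)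
      fix d assume "d \<in> space R"
      then show "norm (f (\<tau> u \<bullet>\<bullet> d)) \<le> B" using t by (intro C(6)) (simp add: spR)
    qed
    show "AE d in R. d \<notin> D \<longrightarrow> f (\<tau> u \<bullet>\<bullet> d) = 0"
      by (rule AE_I2) (use off[OF u] spR in blast)
  qed (use DR eR in auto)
  define m where "m = measure R D"
  have m: "m \<ge> 0" by (simp add: m_def)
  \<comment> \<open>The summand 1 keeps the quotient defined and the final inequality strict even
    when \<open>D\<close> has measure 0.\<close>
  define e' where "e' = e / (m + 1)"
  have e': "e' > 0" "e' * m < e" using e m by (auto simp: e'_def field_simps)
  have "\<exists>A N. open A \<and> u0 \<in> A \<and> A \<subseteq> U \<and> openin Gtop N \<and> c \<in> N \<and>
    (\<forall>u d. u \<in> A \<longrightarrow> d \<in> N \<longrightarrow> d \<in> fib u0 \<longrightarrow> norm (f (\<tau> u \<bullet>\<bullet> d) - f d) < e')" if "c \<in> D" for c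
  proof -
    have c: "c \<in> GG" "rr c = u0" using that Dfib by auto
    show ?thesis unfolding \<tau>_def by (rule transport_nearby[OF C(1) U c e'(1)]) blast
  qed
  then obtain A N where AN: "\<And>c. c \<in> D \<Longrightarrow> open (A c) \<and> u0 \<in> A c \<and> A c \<subseteq> U \<and> openin Gtop (N c) \<and> c \<in> N c \<and>
    (\<forall>u d. u \<in> A c \<longrightarrow> d \<in> N c \<longrightarrow> d \<in> fib u0 \<longrightarrow> norm (f (\<tau> u \<bullet>\<bullet> d) - f d) < e')"
    by metis
  obtain P where P: "finite P" "P \<subseteq> D" "D \<subseteq> \<Union>(N ` P)"
    by (rule compactin_pointwise_subcover[OF D, of N]) (use AN in auto)
  \<comment> \<open>The factor \<open>U1\<close> keeps \<open>u\<close> inside \<open>K\<close>,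
    where the integrands are known to vanish off \<open>D\<close>; the finite intersection gives
    closeness on all of \<open>D\<close>.\<close>
  define A0 where "A0 = U1 \<inter> (\<Inter>c\<in>P. A c)"
  have A0: "open A0" "u0 \<in> A0"
    unfolding A0_def using U1 AN P by (auto intro!: open_Int open_INT)
  have "norm ((\<integral>c. f c \<partial>lift_measure u) - (\<integral>c. f c \<partial>lift_measure u0)) < e" if u: "u \<in> A0" for u
  proof -
    have uK: "u \<in> K" and u0K: "u0 \<in> K" using u U1 by (auto simp: A0_def)
    have uU: "u \<in> U" using uK U1 by auto
    have le: "norm (f (\<tau> u \<bullet>\<bullet> d) - f (\<tau> u0 \<bullet>\<bullet> d)) \<le> e' * indicator D d" if d: "d \<in> space R" for d
    proof (cases "d \<in> D")
      case True
      then obtain c where c: "c \<in> P" "d \<in> N c" using P(3) by auto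
      have "u \<in> A c" using u c by (auto simp: A0_def)
      moreover have "\<tau> u0 \<bullet>\<bullet> d = d" using d tau0 by (simp add: spR)
      ultimately show ?thesis using AN[of c] c P(2) d True spR by (auto intro!: less_imp_le)
    next
      case False
      then show ?thesis using off[OF uK _ False] off[OF u0K _ False] d spR by simp
    qed
    have "(\<integral>c. f c \<partial>lift_measure u) - (\<integral>c. f c \<partial>lift_measure u0)
       = (\<integral>d. f (\<tau> u \<bullet>\<bullet> d) - f (\<tau> u0 \<bullet>\<bullet> d) \<partial>R)"
      unfolding I[OF uU] I[OF U(2)] by (rule Bochner_Integration.integral_diff[OF int[OF uK] int[OF u0K], symmetric])
    also have "norm \<dots> \<le> (\<integral>d. norm (f (\<tau> u \<bullet>\<bullet> d) - f (\<tau> u0 \<bullet>\<bullet> d)) \<partial>R)"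
      by (rule integral_norm_bound)
    also have "\<dots> \<le> (\<integral>d. e' * indicator D d \<partial>R)"
      using DR eR by (intro integral_mono le integrable_norm Bochner_Integration.integrable_diff int uK u0K
          integrable_mult_right) (auto intro!: integrable_real_indicator)
    also have "\<dots> = e' * m" using DR by (simp add: m_def)
    also have "\<dots> < e" by (rule e'(2))
    finally show ?thesis .
  qed
  then show ?thesis using that A0 by blast
qed

lemma lift_integral_Cc:
  fixes f :: "(real \<Rightarrow> 'a) set \<Rightarrow> complex"
  assumes f: "f \<in> Cc Gtop"
  shows "(\<lambda>u. \<integral>c. f c \<partial>lift_measure u) \<in> Cc euclidean"
proof -
  let ?I = "\<lambda>u. \<integral>c. f c \<partial>lift_measure u"
  have "continuous_on UNIV ?I"
    unfolding continuous_on_eq_continuous_at[OF open_UNIV] isCont_def tendsto_iff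
  proof (intro ballI allI impI)
    fix u0 and e :: real assume "0 < e"
    then obtain A where A: "open A" "u0 \<in> A" "\<And>u. u \<in> A \<Longrightarrow> norm (?I u - ?I u0) < e"
      using lift_integral_continuous_at[OF f] by metis
    then show "\<forall>\<^sub>F u in at u0. dist (?I u) (?I u0) < e"
      unfolding eventually_at_topological dist_norm by blast
  qed
  moreover obtain C where C: "compactin Gtop C" "\<And>c. c \<in> GG \<Longrightarrow> c \<notin> C \<Longrightarrow> f c = 0"
    using CcE[OF f Hausdorff_Gtop] by metis
  have cK: "compact (rr ` C)" using image_compactin[OF C(1) continuous_rng_src(1)] by simp
  have "?I u = 0" if "u \<notin> rr ` C" for u
  proof -
    have "indicator (fib u) c *\<^sub>R f c = 0" for c
      using C(2)[of c] that by (auto simp: indicator_def)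
    then show ?thesis
      unfolding lift_measure_integral_fib[OF f] set_lebesgue_integral_def by (simp only: integral_zero)
  qed
  then have "closure {u. ?I u \<noteq> 0} \<subseteq> rr ` C"
    using cK by (intro closure_minimal compact_imp_closed) auto
  then have "compact (closure {u. ?I u \<noteq> 0})"
    using cK compact_Int_closed[OF cK closed_closure] by (metis inf.absorb2)
  ultimately show ?thesis by (simp add: Cc_def)
qed

theorem haar_system_lift_measure: "haar_system (fundamental_groupoid :: ((real \<Rightarrow> 'a) set, 'a) tgroupoid) lift_measure"
proof -
  have u: "units (fundamental_groupoid :: ((real \<Rightarrow> 'a) set, 'a) tgroupoid) = euclidean"
    by (simp add: fundamental_groupoid_def)
  show ?thesis
    unfolding haar_system_def u
    using lift_measure(1) lift_measure_support lift_integral_Cc lift_measure_invariant by blast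
qed

end

section \<open>Invariant measures on the universal cover\<close>

lemma continuous_map_measurable:
  assumes "continuous_map T T' h"
  shows "h \<in> measurable (borel_of T) (borel_of T')"
proof (rule measurable_borel_ofI)
  show "h \<in> space (borel_of T) \<rightarrow> topspace T'"
    using continuous_map_image_subset_topspace[OF assms] by auto
  fix U assume "openin T' U"
  then have "openin T {x \<in> topspace T. h x \<in> U}" by (rule openin_continuous_map_preimage[OF assms])
  moreover have "h -` U \<inter> space (borel_of T) = {x \<in> topspace T. h x \<in> U}" by auto
  ultimately show "h -` U \<inter> space (borel_of T) \<in> sets (borel_of T)" by auto
qed

lemma isotropy_iff: "c \<in> isotropy fundamental_groupoid x \<longleftrightarrow> c \<in> GG \<and> rr c = x \<and> ss c = x"
  by (simp add: isotropy_def)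

lemma topspace_universal_cover [simp]: "topspace (universal_cover x) = fib x"
  by (auto simp: universal_cover_def)

context covered_space
begin

lemma universal_cover_Hausdorff: "Hausdorff_space (universal_cover (x :: 'a))"
  unfolding universal_cover_def by (rule Hausdorff_space_subtopology[OF Hausdorff_Gtop])

lemma homeomorphic_deck:
  assumes "c \<in> isotropy fundamental_groupoid (x :: 'a)"
  shows "homeomorphic_maps (universal_cover x) (universal_cover x) (\<lambda>d. c \<bullet>\<bullet> d) (\<lambda>d. inv_class c \<bullet>\<bullet> d)"
  using homeomorphic_left_mult[of c] assms by (simp add: isotropy_iff universal_cover_def)

text \<open>The image under a deck transformation is the preimage under its inverse, hence
  Borel.\<close>

lemma deck_image:
  assumes c: "c \<in> isotropy fundamental_groupoid (x :: 'a)" and A: "A \<in> sets (borel_of (universal_cover x))"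
  shows "(\<lambda>d. c \<bullet>\<bullet> d) ` A \<in> sets (borel_of (universal_cover x))" "(\<lambda>d. c \<bullet>\<bullet> d) ` A \<subseteq> fib x"
    "(\<lambda>d. c \<bullet>\<bullet> d) -` ((\<lambda>d. c \<bullet>\<bullet> d) ` A) \<inter> fib x = A"
proof -
  have AY: "A \<subseteq> fib x" using sets.sets_into_space[OF A] by simp
  have cc: "c \<in> GG" "rr c = x" "ss c = x" using c by (auto simp: isotropy_iff)
  have inv: "inv_class c \<bullet>\<bullet> (c \<bullet>\<bullet> d) = d" "c \<bullet>\<bullet> (inv_class c \<bullet>\<bullet> d) = d" "c \<bullet>\<bullet> d \<in> fib x" "inv_class c \<bullet>\<bullet> d \<in> fib x"
    if "d \<in> fib x" for d
    using that cc by simp_all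
  have eq: "(\<lambda>d. c \<bullet>\<bullet> d) ` A = (\<lambda>d. inv_class c \<bullet>\<bullet> d) -` A \<inter> fib x"
  proof (intro subset_antisym subsetI)
    fix e assume "e \<in> (\<lambda>d. c \<bullet>\<bullet> d) ` A"
    then obtain d where d: "d \<in> A" "e = c \<bullet>\<bullet> d" by blast
    then have "d \<in> fib x" using AY by blast
    from inv[OF this] d show "e \<in> (\<lambda>d. inv_class c \<bullet>\<bullet> d) -` A \<inter> fib x" by simp
  next
    fix e assume e: "e \<in> (\<lambda>d. inv_class c \<bullet>\<bullet> d) -` A \<inter> fib x"
    then have "e = c \<bullet>\<bullet> (inv_class c \<bullet>\<bullet> e)" using inv(2)[of e] by (metis IntD2)
    then show "e \<in> (\<lambda>d. c \<bullet>\<bullet> d) ` A" using e by blast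
  qed
  have "(\<lambda>d. inv_class c \<bullet>\<bullet> d) \<in> measurable (borel_of (universal_cover x)) (borel_of (universal_cover x))"
    by (rule continuous_map_measurable) (use homeomorphic_deck[OF c] in \<open>simp add: homeomorphic_maps_def\<close>)
  from measurable_sets[OF this A] show "(\<lambda>d. c \<bullet>\<bullet> d) ` A \<in> sets (borel_of (universal_cover x))"
    unfolding eq by simp
  show "(\<lambda>d. c \<bullet>\<bullet> d) ` A \<subseteq> fib x" unfolding eq by blast
  show "(\<lambda>d. c \<bullet>\<bullet> d) -` ((\<lambda>d. c \<bullet>\<bullet> d) ` A) \<inter> fib x = A"
  proof (intro subset_antisym subsetI)
    fix e assume e: "e \<in> (\<lambda>d. c \<bullet>\<bullet> d) -` ((\<lambda>d. c \<bullet>\<bullet> d) ` A) \<inter> fib x"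
    then obtain d where d: "d \<in> A" "c \<bullet>\<bullet> e = c \<bullet>\<bullet> d" by blast
    have "e = d" using inv(1)[of e] inv(1)[of d] d AY e by (metis IntD2 subsetD)
    then show "e \<in> A" using d by simp
  qed (use AY in blast)
qed

text \<open>For an isotropy element \<open>c\<close> range and source coincide, so left invariance
  of the Haar system compares integrals over the single fibre at \<open>x\<close>, and says that
  pushing forward by \<open>c\<close> preserves all of them.\<close>

theorem haar_system_imp_invariant_measure:
  fixes x :: 'a
  assumes haar: "haar_system (fundamental_groupoid :: ((real \<Rightarrow> 'a) set, 'a) tgroupoid) \<alpha>"
  shows "\<exists>\<mu>. radon_measure (universal_cover x) \<mu> \<and> fully_supported (universal_cover x) \<mu> \<and> pi1_invariant x \<mu>"
proof -
  have u: "units (fundamental_groupoid :: ((real \<Rightarrow> 'a) set, 'a) tgroupoid) = euclidean"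
    by (simp add: fundamental_groupoid_def)
  define M where "M = \<alpha> x"
  have M: "radon_measure Gtop M" "measure_support Gtop M = fib x"
    using haar unfolding haar_system_def u M_def by auto
  have invar: "(LINT d:fib x|M. f (c \<bullet>\<bullet> d)) = (LINT d:fib x|M. f d)"
    if "c \<in> isotropy fundamental_groupoid x" "f \<in> Cc Gtop" for c and f :: "(real \<Rightarrow> 'a) set \<Rightarrow> complex"
    using haar that unfolding haar_system_def M_def isotropy_iff by metis
  note null = radon_null_outside_support[OF M closedin_rfibre]
  let ?Y = "universal_cover x"
  have id: "homeomorphic_maps (subtopology Gtop (fib x)) (subtopology ?Y (fib x)) (\<lambda>d. d) (\<lambda>d. d)"
    by (simp add: universal_cover_def subtopology_subtopology homeomorphic_maps_def)
  have cl: "closedin ?Y (fib x)" by (metis closedin_topspace topspace_universal_cover)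
  define \<mu> where "\<mu> = distr (restrict_space M (fib x)) (borel_of ?Y) (\<lambda>d. d)"
  note tr = radon_transfer[OF M(1) null closedin_rfibre cl id universal_cover_Hausdorff, folded \<mu>_def]
  have em: "emeasure \<mu> B = emeasure M B" "B \<in> sets M" if "B \<in> sets (borel_of ?Y)" for B
  proof -
    have "B \<subseteq> fib x" using sets.sets_into_space[OF that] by simp
    then have "(\<lambda>d. d) -` B \<inter> fib x = B" by blast
    then show "emeasure \<mu> B = emeasure M B" "B \<in> sets M" using tr(3,4)[OF that] by simp_all
  qed
  have "measure_support ?Y \<mu> = fib x"
  proof
    show "fib x \<subseteq> measure_support ?Y \<mu>"
    proof
      fix c assume c: "c \<in> fib x"
      have "emeasure \<mu> W > 0" if W: "openin ?Y W" "c \<in> W" for W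
      proof -
        obtain W' where W': "openin Gtop W'" "W = W' \<inter> fib x"
          using W(1) unfolding universal_cover_def openin_subtopology by blast
        have "emeasure \<mu> W = emeasure M W'"
          using em(1)[OF borel_of_open[OF W(1)]] W' radon_Int_full[OF M(1) null closedin_rfibre W'(1)] by simp
        moreover have "c \<in> measure_support Gtop M" using c M(2) by simp
        ultimately show ?thesis using W W' unfolding measure_support_def by auto
      qed
      then show "c \<in> measure_support ?Y \<mu>" using c by (simp add: measure_support_def)
    qed
  qed (auto simp: measure_support_def)
  then have full: "fully_supported ?Y \<mu>" by (simp add: fully_supported_def)
  have "emeasure \<mu> ((\<lambda>d. c \<bullet>\<bullet> d) ` A) = emeasure \<mu> A"
    if c: "c \<in> isotropy fundamental_groupoid x" and A: "A \<in> sets \<mu>" for c A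
  proof -
    have cc: "c \<in> GG" "rr c = x" "ss c = x" using c by (auto simp: isotropy_iff)
    have A': "A \<in> sets (borel_of ?Y)" using A by (simp add: \<mu>_def)
    \<comment> \<open>The comparison takes place on the whole groupoid, where the Haar identity
      supplies its test functions; functions on the fibre then need not be extended.\<close>
    define N where "N = distr (restrict_space M (fib x)) (borel_of Gtop) (\<lambda>d. c \<bullet>\<bullet> d)"
    note trN = radon_transfer[OF M(1) null closedin_rfibre closedin_rfibre
        homeomorphic_left_mult[OF cc(1), unfolded cc] Hausdorff_Gtop, folded N_def]
    have "N = M"
    proof (rule radon_measure_eq_of_integrals[OF trN(1) M(1) Hausdorff_Gtop locally_compact_Gtop])
      fix f :: "(real \<Rightarrow> 'a) set \<Rightarrow> complex" assume f: "f \<in> Cc Gtop"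
      have fb: "f \<in> borel_measurable (borel_of Gtop)" "f \<in> borel_measurable M"
        using f radon_measureD(1)[OF M(1)] by (auto simp: Cc_def intro!: continuous_map_borel_measurable)
      have "(\<integral>d. f d \<partial>N) = (\<integral>d. f (c \<bullet>\<bullet> d) \<partial>restrict_space M (fib x))"
        unfolding N_def by (rule integral_distr[OF trN(2) fb(1)])
      also have "\<dots> = (LINT d:fib x|M. f (c \<bullet>\<bullet> d))"
        unfolding set_lebesgue_integral_def using radon_measureD(7)[OF M(1) closedin_rfibre]
        by (intro integral_restrict_space) (auto intro: sets.Int)
      also have "\<dots> = (LINT d:fib x|M. f d)" by (rule invar[OF c f])
      also have "\<dots> = (\<integral>d. f d \<partial>M)"
        by (rule radon_integral_concentrated[OF M(1) null closedin_rfibre fb(2), symmetric])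
      finally show "(\<integral>d. f d \<partial>N) = (\<integral>d. f d \<partial>M)" .
    qed
    note img = deck_image[OF c A']
    have "emeasure \<mu> ((\<lambda>d. c \<bullet>\<bullet> d) ` A) = emeasure N ((\<lambda>d. c \<bullet>\<bullet> d) ` A)"
      using em(1)[OF img(1)] \<open>N = M\<close> by simp
    also have "\<dots> = emeasure M ((\<lambda>d. c \<bullet>\<bullet> d) -` ((\<lambda>d. c \<bullet>\<bullet> d) ` A) \<inter> fib x)"
      by (rule trN(3)) (use em(2)[OF img(1)] radon_measureD(1)[OF M(1)] in simp)
    also have "\<dots> = emeasure \<mu> A" unfolding img(3) by (rule em(1)[OF A', symmetric])
    finally show ?thesis .
  qed
  then have "pi1_invariant x \<mu>" unfolding pi1_invariant_def by blast
  with tr(1) full show ?thesis by blast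
qed

end

section \<open>Descent of an invariant measure to the base\<close>

locale invariant_cover_measure = covered_space ty for ty :: "'a::t2_space itself" +
  fixes x :: 'a and \<mu> :: "(real \<Rightarrow> 'a) set measure"
  assumes connected: "path_connected (UNIV :: 'a set)"
    and radon: "radon_measure (universal_cover x) \<mu>"
    and full: "fully_supported (universal_cover x) \<mu>"
    and invariant: "pi1_invariant x \<mu>"
begin

text \<open>Images of partial Borel sections of the covering. The compact envelope \<open>C\<close>
  guarantees that finitely many deck transformations suffice to carry the part over a small base set
  into one sheet.\<close>

definition transversal :: "(real \<Rightarrow> 'a) set set \<Rightarrow> bool" where
  "transversal B \<longleftrightarrow> B \<in> sets \<mu> \<and> (\<exists>C. compactin (universal_cover x) C \<and> B \<subseteq> C) \<and> inj_on ss B"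

definition base_content :: "'a set \<Rightarrow> ennreal" where
  "base_content K = (SUP B\<in>{B. transversal B \<and> ss ` B \<subseteq> K}. emeasure \<mu> B)"

lemma transversal_sets: "transversal B \<Longrightarrow> B \<in> sets \<mu>" "transversal B \<Longrightarrow> B \<subseteq> fib x"
  using sets.sets_into_space radon_measureD(2)[OF radon] by (auto simp: transversal_def)

lemma transversal_subset: "transversal B \<Longrightarrow> A \<in> sets \<mu> \<Longrightarrow> A \<subseteq> B \<Longrightarrow> transversal A"
  unfolding transversal_def by (meson inj_on_subset order_trans)

lemma emeasure_deck:
  assumes "c \<in> isotropy fundamental_groupoid x" "A \<in> sets \<mu>"
  shows "emeasure \<mu> ((\<lambda>d. c \<bullet>\<bullet> d) ` A) = emeasure \<mu> A"
  using invariant assms by (simp add: pi1_invariant_def)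

lemma continuous_src_cover: "continuous_map (universal_cover x) euclidean ss"
  unfolding universal_cover_def by (rule continuous_map_from_subtopology[OF continuous_rng_src(2)])

lemma src_preimage_sets: "compact K \<Longrightarrow> ss -` K \<inter> fib x \<in> sets \<mu>"
proof -
  assume "compact K"
  then have "closedin (universal_cover x) {c \<in> topspace (universal_cover x). ss c \<in> K}"
    by (intro closedin_continuous_map_preimage[OF continuous_src_cover]) (simp add: compact_imp_closed)
  moreover have "{c \<in> topspace (universal_cover x). ss c \<in> K} = ss -` K \<inter> fib x" by auto
  ultimately show ?thesis using radon_measureD(7)[OF radon] by metis
qed

lemma transversal_Int:
  assumes "transversal B" "compact K" shows "transversal (B \<inter> ss -` K)"
proof (rule transversal_subset[OF assms(1)])
  have "B \<inter> ss -` K = B \<inter> (ss -` K \<inter> fib x)" using transversal_sets(2)[OF assms(1)] by blast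
  then show "B \<inter> ss -` K \<in> sets \<mu>"
    using transversal_sets(1)[OF assms(1)] src_preimage_sets[OF assms(2)] by simp
qed blast

text \<open>Surjectivity of the covering map, from path connectedness.\<close>

lemma cover_point:
  obtains c where "c \<in> fib x" "ss c = y"
  using path_connected_class[OF connected UNIV_I UNIV_I, of x y] classes_in_GG by (metis in_fib)

text \<open>Deck transformations move the pieces of a transversal over an evenly covered set into one
  sheet; injectivity keeps the moved pieces disjoint.\<close>

lemma transversal_into_sheet:
  assumes "finite P"
    and Z: "inj_on ss Z" "Z \<in> sets \<mu>"
    and deck: "\<And>p. p \<in> P \<Longrightarrow> N p \<in> sets \<mu> \<and> g p \<in> isotropy fundamental_groupoid x \<and> (\<lambda>d. g p \<bullet>\<bullet> d) ` (N p) \<subseteq> Z"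
    and B: "B \<in> sets \<mu>" "inj_on ss B" "B \<subseteq> \<Union>(N ` P)"
  shows "\<exists>Z'\<in>sets \<mu>. Z' \<subseteq> Z \<and> emeasure \<mu> Z' = emeasure \<mu> B \<and> ss ` Z' = ss ` B"
  using assms(1) deck B
proof (induction P arbitrary: B rule: finite_induct)
  case empty
  then have "B = {}" by simp
  then show ?case by (intro bexI[of _ "{}"]) auto
next
  case (insert p P)
  let ?B1 = "B \<inter> N p" and ?B2 = "B - N p"
  have p: "N p \<in> sets \<mu>" "g p \<in> isotropy fundamental_groupoid x" "(\<lambda>d. g p \<bullet>\<bullet> d) ` (N p) \<subseteq> Z"
    using insert.prems(1)[of p] by auto
  have "\<exists>Z'\<in>sets \<mu>. Z' \<subseteq> Z \<and> emeasure \<mu> Z' = emeasure \<mu> ?B2 \<and> ss ` Z' = ss ` ?B2"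
  proof (rule insert.IH)
    show "?B2 \<in> sets \<mu>" using insert.prems p by blast
    show "inj_on ss ?B2" using insert.prems(3) by (rule inj_on_subset) blast
    show "?B2 \<subseteq> \<Union>(N ` P)" using insert.prems(4) by auto
  qed (use insert.prems(1) in blast)
  then obtain Z2 where Z2: "Z2 \<in> sets \<mu>" "Z2 \<subseteq> Z" "emeasure \<mu> Z2 = emeasure \<mu> ?B2" "ss ` Z2 = ss ` ?B2" by blast
  have B1: "?B1 \<in> sets \<mu>" using insert.prems p by blast
  let ?Z1 = "(\<lambda>d. g p \<bullet>\<bullet> d) ` ?B1"
  have Z1: "?Z1 \<in> sets \<mu>" "?Z1 \<subseteq> Z" "emeasure \<mu> ?Z1 = emeasure \<mu> ?B1"
    using deck_image(1)[OF p(2)] B1 radon_measureD(1)[OF radon] p(3) emeasure_deck[OF p(2) B1] by auto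
  have B1Y: "?B1 \<subseteq> fib x" using sets.sets_into_space[OF B1] radon_measureD(2)[OF radon] by simp
  have "ss (g p \<bullet>\<bullet> d) = ss d" if "d \<in> ?B1" for d
  proof -
    have "d \<in> fib x" using that B1Y by blast
    then show ?thesis using p(2) by (simp add: isotropy_iff)
  qed
  then have sZ1: "ss ` ?Z1 = ss ` ?B1" by (simp add: image_image)
  have "ss ` ?B1 \<inter> ss ` ?B2 = {}"
    using inj_on_image_Int[OF insert.prems(3), of ?B1 ?B2] by auto
  \<comment> \<open>The induction records the source set of the moved piece for this purpose:
    disjoint sources force the translates to be disjoint, although they now lie in the same
    sheet.\<close>
  then have "?Z1 \<inter> Z2 = {}" using sZ1 Z2(4) by blast
  then have "emeasure \<mu> (?Z1 \<union> Z2) = emeasure \<mu> ?B1 + emeasure \<mu> ?B2"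
    using plus_emeasure[OF Z1(1) Z2(1)] Z1(3) Z2(3) by simp
  also have "\<dots> = emeasure \<mu> B"
    using insert.prems(2) p by (subst plus_emeasure) (auto simp: Int_Diff_Un)
  finally have "emeasure \<mu> (?Z1 \<union> Z2) = emeasure \<mu> B" .
  moreover have "ss ` (?Z1 \<union> Z2) = ss ` B"
    unfolding image_Un sZ1 Z2(4) by (simp flip: image_Un add: Int_Diff_Un)
  ultimately show ?case using Z1 Z2 by (intro bexI[of _ "?Z1 \<union> Z2"]) auto
qed

text \<open>The bound is the mass of \<open>Z\<close>, the compact sheet over \<open>L\<close>
  through a chosen point \<open>c\<close> above \<open>y\<close>. It is finite and does not depend
  on the transversal.\<close>

lemma transversal_bound:
  obtains V L b where "open V" "y \<in> V" "V \<subseteq> L" "compact L" "b < \<infinity>"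
    "\<And>B. transversal B \<Longrightarrow> emeasure \<mu> (B \<inter> ss -` L) \<le> b"
proof -
  let ?Y = "universal_cover x"
  obtain c where c: "c \<in> fib x" "ss c = y" by (rule cover_point)
  have cG: "c \<in> GG" "rr c = x" using c by auto
  obtain U where U: "good_open U" "x \<in> U" by (rule good_open_at[of x])
  obtain V where V: "good_open V" "y \<in> V" by (rule good_open_at[of y])
  obtain V1 L where V1: "open V1" "compact L" "y \<in> V1" "V1 \<subseteq> L" "L \<subseteq> V"
    using compact_nbhd_ex[OF good_openD(1)[OF V(1)] V(2)] by metis
  note gc = cG(1) U(1) V(1) U(2)[folded cG(2)] V(2)[folded c(2)]
  define Z where "Z = chart_section c U V ` ({x} \<times> L)"
  have sec: "chart_section c U V (x, v) \<in> GG" "rr (chart_section c U V (x, v)) = x"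
    "ss (chart_section c U V (x, v)) = v" if "v \<in> L" for v
    using chart_section[OF gc U(2), of v] that V1(5) by auto
  have "compactin (top_of_set (U \<times> V)) ({x} \<times> L)"
    using U V1 by (auto simp: compactin_subtopology intro!: compact_Times)
  from image_compactin[OF this continuous_chart_section[OF gc]]
  have Z: "compactin ?Y Z"
    using sec unfolding Z_def universal_cover_def by (auto simp: compactin_subtopology)
  have injZ: "inj_on ss Z" unfolding Z_def using sec by (auto intro!: inj_onI)
  have ZM: "Z \<in> sets \<mu>"
    using radon_measureD(7)[OF radon compactin_imp_closedin[OF universal_cover_Hausdorff Z]] .
  have "emeasure \<mu> (B \<inter> ss -` L) \<le> emeasure \<mu> Z" if B: "transversal B" for B
  proof -
    obtain C where C: "compactin ?Y C" "B \<subseteq> C" using B by (auto simp: transversal_def)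
    define C' where "C' = C \<inter> ss -` L"
    have CY: "C \<subseteq> fib x" using compactin_subset_topspace[OF C(1)] by simp
    have "closedin ?Y {c \<in> topspace ?Y. ss c \<in> L}"
      by (rule closedin_continuous_map_preimage[OF continuous_src_cover]) (simp add: compact_imp_closed V1(2))
    from closed_Int_compactin[OF this C(1)] have "compactin ?Y ({c \<in> topspace ?Y. ss c \<in> L} \<inter> C)" .
    moreover have "{c \<in> topspace ?Y. ss c \<in> L} \<inter> C = C'" unfolding C'_def using CY by auto
    ultimately have C': "compactin ?Y C'" by simp
    define N where "N p = nbh p U V \<inter> fib x" for p
    have N: "openin ?Y (N p) \<and> p \<in> N p" if "p \<in> C'" for p
    proof -
      have p: "p \<in> GG" "rr p = x" "ss p \<in> L" using that CY by (auto simp: C'_def)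
      have "openin ?Y (N p)"
        unfolding N_def universal_cover_def openin_subtopology
        using openin_nbh[OF p(1) good_openD(1)[OF U(1)] good_openD(1)[OF V(1)]] by blast
      moreover have "p \<in> nbh p U V" by (rule nbh_self) (use p U V1 in auto)
      ultimately show ?thesis using p by (simp add: N_def)
    qed
    obtain P where P: "finite P" "P \<subseteq> C'" "C' \<subseteq> \<Union>(N ` P)"
      by (rule compactin_pointwise_subcover[OF C', of N]) (use N in auto)
    define z where "z p = chart_section c U V (x, ss p)" for p
    \<comment> \<open>The deck transformation taking \<open>p\<close> to \<open>z p\<close>, the
      point of the sheet \<open>Z\<close> over the same source.\<close>
    define g where "g p = z p \<bullet>\<bullet> inv_class p" for p
    define N' where "N' p = N p \<inter> (ss -` L \<inter> fib x)" for p
    have "\<exists>Z'\<in>sets \<mu>. Z' \<subseteq> Z \<and> emeasure \<mu> Z' = emeasure \<mu> (B \<inter> ss -` L) \<and> ss ` Z' = ss ` (B \<inter> ss -` L)"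
    proof (rule transversal_into_sheet[OF P(1) injZ ZM])
      fix p assume "p \<in> P"
      then have pC: "p \<in> C'" using P by blast
      have p: "p \<in> GG" "rr p = x" "ss p \<in> L" using pC CY by (auto simp: C'_def)
      have pV: "ss p \<in> V" using p V1 by blast
      have zp: "z p \<in> nbh c U V" "z p \<in> GG" "rr (z p) = x" "ss (z p) = ss p"
        using chart_section[OF gc U(2) pV] by (simp_all add: z_def)
      have gp: "g p \<in> isotropy fundamental_groupoid x"
        using zp p by (simp add: g_def isotropy_iff)
      have "g p \<bullet>\<bullet> d \<in> Z" if d: "d \<in> N' p" for d
      proof -
        have d': "d \<in> nbh p U V" "rr d = x" "ss d \<in> L" "d \<in> GG" using d by (auto simp: N'_def N_def)
        obtain a b where ab: "d = a \<bullet>\<bullet> p \<bullet>\<bullet> b" "a \<in> classes_in U" "b \<in> classes_in V" "ss a = rr p" "ss p = rr b"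
          "a \<in> GG" "b \<in> GG"
          using nbhE[OF d'(1) p(1)] by metis
        \<comment> \<open>Both \<open>d\<close> and \<open>p\<close> have range \<open>x\<close>, so
          the factor \<open>a\<close> is a loop in \<open>U\<close>, hence a unit. Thus
          \<open>d\<close> differs from \<open>p\<close> only by the short class \<open>b\<close> on
          the right, and left multiplication by \<open>g p\<close> keeps \<open>b\<close>: the
          result lies on the sheet through \<open>c\<close>.\<close>
        have "rr a = x" using ab d'(2) p by simp
        then have "a = unit_class x"
          by (intro good_openD(2)[OF U(1) ab(2) classes_in_unit[OF U(2)]]) (use ab p in simp_all)
        then have "d = p \<bullet>\<bullet> b" using ab p by simp
        then have "g p \<bullet>\<bullet> d = z p \<bullet>\<bullet> (inv_class p \<bullet>\<bullet> (p \<bullet>\<bullet> b))"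
          unfolding g_def using zp p ab by (simp add: mult_assoc_class)
        also have "\<dots> = z p \<bullet>\<bullet> b" using p ab by simp
        finally have gd: "g p \<bullet>\<bullet> d = z p \<bullet>\<bullet> b" .
        have "z p \<bullet>\<bullet> b \<in> nbh (z p) U V"
          by (rule nbhI[OF classes_in_unit[OF U(2)] ab(3)]) (use zp ab in simp_all)
        then have "z p \<bullet>\<bullet> b \<in> nbh c U V" by (rule nbh_trans[OF zp(1) _ cG(1)])
        from chart_section_eq[OF cG(1) U(1) V(1) this]
        have "g p \<bullet>\<bullet> d = chart_section c U V (rr (g p \<bullet>\<bullet> d), ss (g p \<bullet>\<bullet> d))" unfolding gd by simp
        moreover have "rr (g p \<bullet>\<bullet> d) = x" "ss (g p \<bullet>\<bullet> d) = ss d" using gp d' by (simp_all add: isotropy_iff)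
        ultimately show ?thesis unfolding Z_def using d'(3) by (metis SigmaI imageI singletonI)
      qed
      moreover have "N' p \<in> sets \<mu>"
        unfolding N'_def using N[OF pC] radon_measureD(6)[OF radon] src_preimage_sets[OF V1(2)] by blast
      ultimately show "N' p \<in> sets \<mu> \<and> g p \<in> isotropy fundamental_groupoid x \<and> (\<lambda>d. g p \<bullet>\<bullet> d) ` N' p \<subseteq> Z"
        using gp by blast
    next
      have tB: "transversal (B \<inter> ss -` L)" by (rule transversal_Int[OF B V1(2)])
      then show "B \<inter> ss -` L \<in> sets \<mu>" "inj_on ss (B \<inter> ss -` L)" by (auto simp: transversal_def)
      show "B \<inter> ss -` L \<subseteq> \<Union>(N' ` P)"
      proof
        fix d assume d: "d \<in> B \<inter> ss -` L"
        then have "d \<in> C'" using C(2) by (auto simp: C'_def)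
        then obtain p where "p \<in> P" "d \<in> N p" using P(3) by auto
        moreover have "d \<in> fib x" using d transversal_sets(2)[OF B] by blast
        ultimately show "d \<in> \<Union>(N' ` P)" using d by (auto simp: N'_def)
      qed
    qed
    then show ?thesis using ZM by (metis emeasure_mono)
  qed
  then show ?thesis
    using that[OF V1(1,3,4,2) radon_measureD(3)[OF radon Z]] by blast
qed

text \<open>Finitely many of the sets from \<open>transversal_bound\<close> cover \<open>K\<close>;
  their overlaps are harmless because only an upper bound is wanted.\<close>

lemma base_content_finite:
  assumes K: "compact K" shows "base_content K < \<infinity>"
proof -
  have "\<exists>V L b. open V \<and> y \<in> V \<and> V \<subseteq> L \<and> compact L \<and> b < \<infinity> \<and>
    (\<forall>B. transversal B \<longrightarrow> emeasure \<mu> (B \<inter> ss -` L) \<le> b)" for y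
    by (rule transversal_bound[of y]) blast
  then obtain V L b where VL: "\<And>y. open (V y) \<and> y \<in> V y \<and> V y \<subseteq> L y \<and> compact (L y) \<and> b y < \<infinity> \<and>
    (\<forall>B. transversal B \<longrightarrow> emeasure \<mu> (B \<inter> ss -` L y) \<le> b y)"
    by metis
  have "compactin euclidean K" using K by simp
  then obtain P where P: "finite P" "P \<subseteq> K" "K \<subseteq> \<Union>(V ` P)"
    by (rule compactin_pointwise_subcover[of _ _ V]) (use VL in auto)
  have "base_content K \<le> (\<Sum>y\<in>P. b y)"
    unfolding base_content_def
  proof (rule SUP_least)
    fix B assume "B \<in> {B. transversal B \<and> ss ` B \<subseteq> K}"
    then have B: "transversal B" "ss ` B \<subseteq> K" by auto
    have BL: "B \<inter> ss -` L y \<in> sets \<mu>" for y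
      using transversal_Int[OF B(1)] VL transversal_sets(1) by blast
    have "B \<subseteq> (\<Union>y\<in>P. B \<inter> ss -` L y)"
    proof
      fix d assume d: "d \<in> B"
      then have "ss d \<in> \<Union>(V ` P)" using B(2) P(3) by blast
      then obtain y where "y \<in> P" "ss d \<in> V y" by blast
      then show "d \<in> (\<Union>y\<in>P. B \<inter> ss -` L y)" using d VL[of y] by blast
    qed
    then have "emeasure \<mu> B \<le> emeasure \<mu> (\<Union>y\<in>P. B \<inter> ss -` L y)"
      using BL P(1) by (intro emeasure_mono sets.finite_UN) auto
    also have "\<dots> \<le> (\<Sum>y\<in>P. emeasure \<mu> (B \<inter> ss -` L y))"
      using BL P(1) by (intro emeasure_subadditive_finite) auto
    also have "\<dots> \<le> (\<Sum>y\<in>P. b y)" using VL B(1) by (intro sum_mono) blast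
    finally show "emeasure \<mu> B \<le> (\<Sum>y\<in>P. b y)" .
  qed
  also have "\<dots> < \<infinity>" using VL P(1) by simp
  finally show ?thesis .
qed

lemma base_content_upper: "transversal B \<Longrightarrow> ss ` B \<subseteq> K \<Longrightarrow> emeasure \<mu> B \<le> base_content K"
  unfolding base_content_def by (rule SUP_upper) simp

lemma transversal_empty: "transversal {}"
  unfolding transversal_def using compactin_empty by auto

lemma radon_content_base: "radon_content (euclidean :: 'a topology) base_content"
proof
  show "Hausdorff_space (euclidean :: 'a topology)"
    unfolding Hausdorff_space_def disjnt_def using hausdorff by (metis open_openin)
  show "locally_compact_space (euclidean :: 'a topology)"
    unfolding locally_compact_space_def
    using compact_nbhd_ex[OF open_UNIV UNIV_I] by (metis compactin_euclidean_iff open_openin)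
next
  fix K L :: "'a set" assume "K \<subseteq> L"
  then show "base_content K \<le> base_content L"
    unfolding base_content_def by (intro SUP_subset_mono) auto
next
  fix K L :: "'a set" assume "compactin euclidean K" "compactin euclidean L"
  then have KL: "compact K" "compact L" by simp_all
  show "base_content (K \<union> L) \<le> base_content K + base_content L"
    unfolding base_content_def[of "K \<union> L"]
  proof (rule SUP_least)
    fix B assume "B \<in> {B. transversal B \<and> ss ` B \<subseteq> K \<union> L}"
    then have B: "transversal B" "ss ` B \<subseteq> K \<union> L" by auto
    note t = transversal_Int[OF B(1) KL(1)] transversal_Int[OF B(1) KL(2)]
    have "emeasure \<mu> B \<le> emeasure \<mu> ((B \<inter> ss -` K) \<union> (B \<inter> ss -` L))"
      using B t transversal_sets(1) by (intro emeasure_mono) auto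
    also have "\<dots> \<le> emeasure \<mu> (B \<inter> ss -` K) + emeasure \<mu> (B \<inter> ss -` L)"
      using t transversal_sets(1) by (intro emeasure_subadditive) auto
    also have "\<dots> \<le> base_content K + base_content L"
      using t by (intro add_mono base_content_upper) auto
    finally show "emeasure \<mu> B \<le> base_content K + base_content L" .
  qed
next
  fix K L :: "'a set" assume disj: "K \<inter> L = {}"
  have "emeasure \<mu> A + emeasure \<mu> B \<le> base_content (K \<union> L)"
    if A: "transversal A" "ss ` A \<subseteq> K" and B: "transversal B" "ss ` B \<subseteq> L" for A B
  proof -
    \<comment> \<open>Disjoint sources serve twice: they make \<open>A\<close> and \<open>B\<close>
      disjoint, and they keep the source map injective on the union, which is therefore again a
      transversal.\<close>
    have d: "ss ` A \<inter> ss ` B = {}" using A B disj by blast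
    then have "A \<inter> B = {}" by blast
    then have "emeasure \<mu> A + emeasure \<mu> B = emeasure \<mu> (A \<union> B)"
      using A B transversal_sets(1) by (intro plus_emeasure) auto
    also have "\<dots> \<le> base_content (K \<union> L)"
    proof (rule base_content_upper)
      obtain C D where CD: "compactin (universal_cover x) C" "A \<subseteq> C" "compactin (universal_cover x) D" "B \<subseteq> D"
        using A B by (auto simp: transversal_def)
      have "compactin (universal_cover x) (C \<union> D)" using CD by (intro compactin_Un)
      moreover have "inj_on ss (A \<union> B)"
        using A B d unfolding transversal_def inj_on_Un by blast
      moreover have "A \<union> B \<in> sets \<mu>" using A B transversal_sets(1) by blast
      ultimately show "transversal (A \<union> B)" unfolding transversal_def using CD by blast
    qed (use A B in auto)
    finally show ?thesis .
  qed
  \<comment> \<open>The suprema over \<open>A\<close> and over \<open>B\<close> are taken one after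
    the other. The empty transversal makes both index sets nonempty, as moving a supremum past a sum
    in \<open>ennreal\<close> requires.\<close>
  then have "base_content K + emeasure \<mu> B \<le> base_content (K \<union> L)" if "transversal B" "ss ` B \<subseteq> L" for B
    unfolding base_content_def[of K] using that transversal_empty
    by (subst ennreal_SUP_add_left[symmetric]) (auto intro!: SUP_least)
  then show "base_content K + base_content L \<le> base_content (K \<union> L)"
    unfolding base_content_def[of L] using transversal_empty
    by (subst ennreal_SUP_add_right) (auto intro!: SUP_least)
next
  fix K :: "'a set" assume "compactin euclidean K"
  then show "base_content K < \<infinity>" using base_content_finite by simp
qed

text \<open>What remains is full support: over any neighbourhood of \<open>y\<close> there lies a
  piece of a sheet with positive mass, and a transversal inside it bounds the measure below from the
  content.\<close>

theorem base_measure_exists: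
  "\<exists>\<nu>. radon_measure (euclidean :: 'a topology) \<nu> \<and> fully_supported (euclidean :: 'a topology) \<nu>"
proof -
  obtain \<nu> where \<nu>: "radon_measure (euclidean :: 'a topology) \<nu>"
    "\<And>W. openin euclidean W \<Longrightarrow> emeasure \<nu> W = (SUP K\<in>{K. compactin euclidean K \<and> K \<subseteq> W}. base_content K)"
    using radon_content.radon_measure_exists[OF radon_content_base] by metis
  have "emeasure \<nu> W > 0" if W: "open W" "y \<in> W" for W y
  proof -
    let ?Y = "universal_cover x"
    obtain c where c: "c \<in> fib x" "ss c = y" by (rule cover_point)
    have cG: "c \<in> GG" "rr c = x" using c by auto
    obtain U where U: "good_open U" "x \<in> U" by (rule good_open_at[of x])
    obtain V where V: "good_open V" "y \<in> V" "V \<subseteq> W" using good_open_ex[OF W] by metis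
    let ?N = "nbh c U V \<inter> fib x"
    have N: "openin ?Y ?N"
      unfolding universal_cover_def openin_subtopology
      using openin_nbh[OF cG(1) good_openD(1)[OF U(1)] good_openD(1)[OF V(1)]] by blast
    have cN: "c \<in> ?N" using c nbh_self[OF cG(1), of U V] U V cG by simp
    have "c \<in> measure_support ?Y \<mu>"
      using full c unfolding fully_supported_def topspace_universal_cover by blast
    then have "0 < emeasure \<mu> ?N"
      using N cN by (simp only: measure_support_def mem_Collect_eq simp_thms)
    \<comment> \<open>The open piece \<open>?N\<close> need not have a compact envelope; inner
      regularity replaces it by a compact part of positive mass, which is a transversal.\<close>
    then obtain K where K: "compactin ?Y K" "K \<subseteq> ?N" "0 < emeasure \<mu> K"
      unfolding radon_measureD(5)[OF radon N] by (auto simp: less_SUP_iff)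
    have KM: "K \<in> sets \<mu>"
      using radon_measureD(7)[OF radon compactin_imp_closedin[OF universal_cover_Hausdorff K(1)]] .
    have "inj_on ss K" by (rule inj_on_subset[OF inj_src_nbh[OF cG(1) U(1) V(1)] K(2)])
    then have tK: "transversal K" unfolding transversal_def using KM K(1) by blast
    have cK: "compact (ss ` K)" using image_compactin[OF K(1) continuous_src_cover] by simp
    have "ss ` K \<subseteq> W" using K(2) nbh_props(3)[OF _ cG(1), of _ U V] V(3) by blast
    note K(3)
    also have "emeasure \<mu> K \<le> base_content (ss ` K)" by (rule base_content_upper[OF tK]) simp
    also have "\<dots> \<le> emeasure \<nu> W"
      using \<nu>(2)[of W] W cK \<open>ss ` K \<subseteq> W\<close> by (auto intro: SUP_upper)
    finally show ?thesis .
  qed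
  then have "fully_supported (euclidean :: 'a topology) \<nu>"
    by (auto simp: fully_supported_def measure_support_def)
  with \<nu>(1) show ?thesis by blast
qed

end

theorem corollary2p5:
  fixes x :: "'a::t2_space"
  assumes "locally compact (UNIV :: 'a set)"
    and "path_connected (UNIV :: 'a set)"
    and "locally path_connected (UNIV :: 'a set)"
    and "semilocally_simply_connected (UNIV :: 'a set)"
  shows
    "((\<exists>\<alpha>. haar_system (fundamental_groupoid :: ((real \<Rightarrow> 'a) set, 'a) tgroupoid) \<alpha>) \<longleftrightarrow>
      (\<exists>\<mu>. radon_measure (universal_cover x) \<mu> \<and> fully_supported (universal_cover x) \<mu> \<and>
           pi1_invariant x \<mu>)) \<and>
     ((\<exists>\<nu>. radon_measure (euclidean :: 'a topology) \<nu> \<and>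
           fully_supported (euclidean :: 'a topology) \<nu>) \<longrightarrow>
      (\<exists>\<mu>. radon_measure (universal_cover x) \<mu> \<and> fully_supported (universal_cover x) \<mu> \<and>
           pi1_invariant x \<mu>)) \<and>
     (paracompact_space (euclidean :: 'a topology) \<longrightarrow>
      (\<exists>\<mu>. radon_measure (universal_cover x) \<mu> \<and> fully_supported (universal_cover x) \<mu> \<and>
           pi1_invariant x \<mu>) \<longrightarrow>
      (\<exists>\<nu>. radon_measure (euclidean :: 'a topology) \<nu> \<and>
           fully_supported (euclidean :: 'a topology) \<nu>))"
proof -
  let ?haar = "\<exists>\<alpha>. haar_system (fundamental_groupoid :: ((real \<Rightarrow> 'a) set, 'a) tgroupoid) \<alpha>"
  let ?cover = "\<exists>\<mu>. radon_measure (universal_cover x) \<mu> \<and> fully_supported (universal_cover x) \<mu> \<and> pi1_invariant x \<mu>"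
  let ?base = "\<exists>\<nu>. radon_measure (euclidean :: 'a topology) \<nu> \<and> fully_supported (euclidean :: 'a topology) \<nu>"
  interpret covered_space "TYPE('a)" using assms by unfold_locales
  have "?base \<Longrightarrow> ?haar"
  proof -
    assume ?base
    then obtain \<nu> :: "'a measure" where "radon_measure euclidean \<nu>" "fully_supported euclidean \<nu>" by blast
    then interpret base_measure "TYPE('a)" \<nu> by unfold_locales
    show ?haar using haar_system_lift_measure by blast
  qed
  moreover have "?haar \<Longrightarrow> ?cover" using haar_system_imp_invariant_measure by blast
  moreover have "?cover \<Longrightarrow> ?base"
  proof -
    assume ?cover
    then obtain \<mu> where "radon_measure (universal_cover x) \<mu>" "fully_supported (universal_cover x) \<mu>" "pi1_invariant x \<mu>"
      by blast
    then interpret invariant_cover_measure "TYPE('a)" x \<mu> using assms(2) by unfold_locales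
    show ?base by (rule base_measure_exists)
  qed
  ultimately show ?thesis by blast
qed

end
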